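(* Let $n\ge 3$, $0<m<\frac{n-2}{n}$, $\lambda_1>\lambda_2>0$, $\beta<0$, $\alpha=\frac{2\beta}{1-m}$, and $\mu_1=n-\frac{2}{1-m}$. Let $f_{\lambda_i}$, $U_{\lambda_i}$, $i=1,2$, be as defined in the context. Let $u_{0,1},u_{0,2}$ satisfy $$f_{\lambda_1}(x)\le u_{0,i}(x)\le f_{\lambda_2}(x)\quad\text{in }\mathbb{R}^n\setminus\{0\},\quad i=1,2,$$ and let $u_1,u_2$ be solutions of $$u_t=\frac{n-1}{m}\Delta u^m\ \text{ in }(\mathbb{R}^n\setminus\{0\})\times(0,\infty),\qquad u(\cdot,0)=u_0\ \text{ in }\mathbb{R}^n\setminus\{0\}$$ with initial values $u_0=u_{0,1},u_{0,2}$, respectively, which satisfy $$U_{\lambda_1}(x,t)\le u_i(x,t)\le U_{\lambda_2}(x,t)\quad\text{in }(\mathbb{R}^n\setminus\{0\})\times(0,\infty),\quad i=1,2.$$ Suppose that $u_{0,1}-u_{0,2}\in L^1(|x|^{-\mu};\mathbb{R}^n\setminus\{0\})$ for some constant $\mu\in(0,\mu_1]$. If either $\mu<\mu_1$, or $\mu=\mu_1$ and $0<m<\min\left(\frac{n-2}{n},\frac12\right)$, then $$\int_{\mathbb{R}^n\setminus\{0\}}|u_1-u_2|(x,t)|x|^{-\mu}\,dx\le\int_{\mathbb{R}^n\setminus\{0\}}|u_{0,1}-u_{0,2}|(x)|x|^{-\mu}\,dx\quad\forall t>0$$ and $$\int_{\mathbb{R}^n\setminus\{0\}}(u_1-u_2)_+(x,t)|x|^{-\mu}\,dx\le\int_{\mathbb{R}^n\setminus\{0\}}(u_{0,1}-u_{0,2})_+(x)|x|^{-\mu}\,dx\quad\forall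 t>0.$$
   Context: Self-similar functions. Given $\beta<0$ and $\alpha=\frac{2\beta}{1-m}$, let $f_1$ be the unique positive solution on $(0,\infty)$ of $\frac{n-1}{m}\left((f^m)_{rr}+\frac{n-1}{r}(f^m)_r\right)+\alpha f+\beta r f_r=0$ with $\lim_{r\to\infty}r^{\frac{n-2}{m}}f(r)=1$ (it exists and is unique), regarded also as the radial function $f_1(x)=f_1(|x|)$. For $\lambda>0$ put $f_\lambda(x)=\lambda^{\frac{2}{1-m}}f_1(\lambda x)$, $x\in\mathbb{R}^n\setminus\{0\}$, and $U_\lambda(x,t)=e^{-\alpha t}f_\lambda(e^{-\beta t}x)$, $x\in\mathbb{R}^n\setminus\{0\}$, $t\in\mathbb{R}$. Solutions. For $0\le u_0\in L^1_{\rm loc}(\mathbb{R}^n\setminus\{0\})$, a solution of the Cauchy problem is a function $u>0$ in $(\mathbb{R}^n\setminus\{0\})\times(0,\infty)$ satisfying $u_t=\frac{n-1}{m}\Delta u^m$ there in the classical sense and $\|u(\cdot,t)-u_0\|_{L^1(K)}\to0$ as $t\to0$ for any compact $K\subset\mathbb{R}^n\setminus\{0\}$. Weighted space. For $k:\mathbb{R}^n\setminus\{0\}\to[0,\infty)$, $L^1(k;\mathbb{R}^n\setminus\{0\})=\{h\in L^1_{\rm loc}(\mathbb{R}^n\setminus\{0\}):\int_{\mathbb{R}^n\setminus\{0\}}|h|k\,dx<\infty\}$. Also $v_+=\max(v,0)$. *)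

theory Defs
  imports "HOL-Analysis.Analysis"
begin

text \<open>
  Functions on the punctured space or on a half line are modelled by total functions; their values
  elsewhere play no role.
\<close>

definition punctured :: "'a::euclidean_space set" where
  "punctured = - {0}"

text \<open>
  No continuity of the second derivative of \<open>f\<^sup>m\<close> is required: as \<open>f > 0\<close>, it follows from the equation.
\<close>

definition is_profile :: "nat \<Rightarrow> real \<Rightarrow> real \<Rightarrow> real \<Rightarrow> (real \<Rightarrow> real) \<Rightarrow> bool" where
  "is_profile n m \<alpha> \<beta> f \<longleftrightarrow>
     (\<forall>r>0. f r > 0 \<and>
            f differentiable (at r) \<and>
            (\<lambda>s. f s powr m) differentiable (at r) \<and>
            deriv (\<lambda>s. f s powr m) differentiable (at r) \<and>
            (real n - 1) / m *
              (deriv (deriv (\<lambda>s. f s powr m)) r + (real n - 1) / r * deriv (\<lambda>s. f s powr m) r)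
              + \<alpha> * f r + \<beta> * r * deriv f r = 0) \<and>
     ((\<lambda>r. r powr ((real n - 2) / m) * f r) \<longlongrightarrow> 1) at_top"

definition f_scaled :: "real \<Rightarrow> (real \<Rightarrow> real) \<Rightarrow> real \<Rightarrow> 'a::euclidean_space \<Rightarrow> real" where
  "f_scaled m f1 l x = l powr (2 / (1 - m)) * f1 (norm (l *\<^sub>R x))"

definition U_selfsim ::
  "real \<Rightarrow> real \<Rightarrow> real \<Rightarrow> (real \<Rightarrow> real) \<Rightarrow> real \<Rightarrow> 'a::euclidean_space \<Rightarrow> real \<Rightarrow> real" where
  "U_selfsim m \<alpha> \<beta> f1 l x t = exp (- \<alpha> * t) * f_scaled m f1 l (exp (- \<beta> * t) *\<^sub>R x)"

definition pderiv_dir :: "'a::euclidean_space \<Rightarrow> ('a \<Rightarrow> real) \<Rightarrow> 'a \<Rightarrow> real" where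
  "pderiv_dir b g x = deriv (\<lambda>s. g (x + s *\<^sub>R b)) 0"

definition laplacian :: "('a::euclidean_space \<Rightarrow> real) \<Rightarrow> 'a \<Rightarrow> real" where
  "laplacian g x = (\<Sum>b\<in>Basis. pderiv_dir b (pderiv_dir b g) x)"

text \<open>
  The class \<open>C\<^sup>2\<^sup>,\<^sup>1\<close> on the product of the punctured space and \<open>(0,\<infinity>)\<close>: the function, its time
  derivative and its space derivatives of order at most two exist and are jointly continuous.
  Existence is stated separately because the operator \<open>deriv\<close> is total.
\<close>

definition C21 :: "('a::euclidean_space \<Rightarrow> real \<Rightarrow> real) \<Rightarrow> bool" where
  "C21 u \<longleftrightarrow>
     (\<forall>x\<in>punctured. \<forall>t>0.
        u x differentiable (at t) \<and>
        (\<forall>b\<in>Basis. (\<lambda>s. u (x + s *\<^sub>R b) t) differentiable (at 0)) \<and>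
        (\<forall>b\<in>Basis. \<forall>c\<in>Basis.
           (\<lambda>s. pderiv_dir b (\<lambda>y. u y t) (x + s *\<^sub>R c)) differentiable (at 0))) \<and>
     continuous_on (punctured \<times> {0<..}) (\<lambda>(x, t). u x t) \<and>
     continuous_on (punctured \<times> {0<..}) (\<lambda>(x, t). deriv (u x) t) \<and>
     (\<forall>b\<in>Basis. continuous_on (punctured \<times> {0<..}) (\<lambda>(x, t). pderiv_dir b (\<lambda>y. u y t) x)) \<and>
     (\<forall>b\<in>Basis. \<forall>c\<in>Basis. continuous_on (punctured \<times> {0<..})
        (\<lambda>(x, t). pderiv_dir c (pderiv_dir b (\<lambda>y. u y t)) x))"

definition L1_loc :: "('a::euclidean_space \<Rightarrow> real) set" where
  "L1_loc = {h. \<forall>K. compact K \<and> K \<subseteq> punctured \<longrightarrow> h absolutely_integrable_on K}"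

definition cauchy_solution ::
  "real \<Rightarrow> ('a::euclidean_space \<Rightarrow> real) \<Rightarrow> ('a \<Rightarrow> real \<Rightarrow> real) \<Rightarrow> bool" where
  "cauchy_solution m u0 u \<longleftrightarrow>
     u0 \<in> L1_loc \<and> (AE x\<in>punctured in lebesgue. 0 \<le> u0 x) \<and>
     C21 u \<and>
     (\<forall>x\<in>punctured. \<forall>t>0.
        u x t > 0 \<and>
        deriv (u x) t = (real DIM('a) - 1) / m * laplacian (\<lambda>y. u y t powr m) x) \<and>
     (\<forall>K. compact K \<and> K \<subseteq> punctured \<longrightarrow>
        ((\<lambda>t. LINT x:K|lebesgue. \<bar>u x t - u0 x\<bar>) \<longlongrightarrow> 0) (at_right 0))"

definition L1_weighted :: "('a::euclidean_space \<Rightarrow> real) \<Rightarrow> ('a \<Rightarrow> real) set" where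
  "L1_weighted k = {h \<in> L1_loc. (\<integral>\<^sup>+ x\<in>punctured. ennreal (\<bar>h x\<bar> * k x) \<partial>lebesgue) < \<infinity>}"

end

theory Submission
  imports Defs "HOL-Real_Asymp.Real_Asymp"
begin

text \<open>
  Kato's inequality for \<open>u\<^sub>1\<^sup>m - u\<^sub>2\<^sup>m\<close>, tested with \<open>\<eta> = |x|\<^sup>-\<^sup>\<mu> \<kappa>(ln |x| / L)\<close>, bounds the growth of
  \<open>\<integral> (u\<^sub>1 - u\<^sub>2)\<^sub>+ \<eta>\<close> by \<open>\<integral> (u\<^sub>1\<^sup>m - u\<^sub>2\<^sup>m)\<^sub>+ \<Delta>\<eta>\<close>. Since \<open>0 < \<mu> \<le> n - 2\<close>, the weight \<open>|x|\<^sup>-\<^sup>\<mu>\<close> is superharmonic and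
  only the derivatives of \<open>\<kappa>\<close> contribute; they are of size \<open>1/L\<close> and live on \<open>L \<le> |ln |x|| \<le> 2L\<close>.

  With \<open>S = -ln |x|\<close> and \<open>a = 2m/(1-m)\<close>, the function \<open>V(S) = |x|\<^sup>a f\<^sub>1\<^sup>m\<close> solves an autonomous equation in which
  \<open>U\<^sub>\<lambda>\<^sup>m = |x|\<^sup>-\<^sup>a V(S - ln \<lambda> + \<beta>t)\<close>. It is increasing, because its critical points are strict minima and \<open>V \<rightarrow> 0\<close> at
  \<open>-\<infinity>\<close>, and \<open>V = O(S\<^bsup>m/(1-m)\<^esup>)\<close> at \<open>+\<infinity>\<close>. The error is therefore at most \<open>1/L\<close> times the integral of
  \<open>exp (- (\<mu>\<^sub>1 - \<mu>) S) (V(S - ln \<lambda>\<^sub>2 + \<beta>t) - V(S - ln \<lambda>\<^sub>1 + \<beta>t))\<close> over \<open>L \<le> |S| \<le> 2L\<close>. For \<open>\<mu> < \<mu>\<^sub>1\<close> the integrand tends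
  to \<open>0\<close>; for \<open>\<mu> = \<mu>\<^sub>1\<close> the integral telescopes and is \<open>O(V(2L)) = o(L)\<close> when \<open>m < 1/2\<close>.
\<close>

section \<open>The profile in logarithmic coordinates\<close>

text \<open>The layer in which the cutoff varies has a length of order L in the variable S, which
  uses up the factor 1/L, so smallness must come from elsewhere. The factor |x|^-a of the barriers
  and the factor |x|^(-\<mu>-2) of the Laplacian combine to |x|^-n exp (-
  (\<open>\<mu>\<^sub>1\<close> - \<mu>) S), and |x|^-n dx is invariant under dilations:
  \<open>\<mu>\<^sub>1\<close> is the exponent at which the error is scale invariant. Below it the
  exponential beats the power growth of V at +infinity, and \<mu> > 0 gives decay at -infinity. At
  it no exponential is left at +infinity and V need not be bounded; only the cancellation between
  the two shifts of V helps, and m < 1/2 makes m/(1-m) less than 1. The error is integrated over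
  time, so its bound must be uniform in t. This is where \<beta>t \<le> 0 and the monotonicity of V
  meet. The comparison takes the upper barrier for the first solution and the lower one for the
  second. Both solutions lie between the same barriers, so they can be exchanged; this controls the
  negative part of the difference and with it the absolute value.\<close>

lemma profile_rescaled_ode:
  fixes f :: "real \<Rightarrow> real" and n :: nat
  assumes prof: "is_profile n m \<alpha> \<beta> f" and m: "0 < m" "m < 1" and n: "n \<ge> 2"
    and \<alpha>: "\<alpha> = 2 * \<beta> / (1 - m)"
    and a: "a = 2 * m / (1 - m)"
    and V: "V = (\<lambda>S. exp (- a * S) * f (exp (- S)) powr m)"
  obtains V1 V2 where
    "\<And>S. (V has_real_derivative V1 S) (at S)"
    "\<And>S. (V1 has_real_derivative V2 S) (at S)"
    "\<And>S. V2 S - (real n - 2 - 2 * a) * V1 S - a * (real n - 2 - a) * V S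
        = \<beta> * m / (real n - 1) * ((1 / m) * V S powr (1 / m - 1) * V1 S)"
    "\<And>S. V S > 0"
proof -
  define F where "F = (\<lambda>s. f s powr m)"
  define F1 where "F1 = deriv F"
  define F2 where "F2 = deriv F1"
  have fpos: "f r > 0" if "r > 0" for r using prof that unfolding is_profile_def by blast
  have "f differentiable (at r)" "F differentiable (at r)" "F1 differentiable (at r)" if "r > 0" for r
    using prof that unfolding is_profile_def F1_def F_def by blast+
  then have df: "(f has_real_derivative deriv f r) (at r)"
    and dF: "(F has_real_derivative F1 r) (at r)"
    and dF1: "(F1 has_real_derivative F2 r) (at r)" if "r > 0" for r
    unfolding F2_def using that unfolding F1_def by (simp_all add: DERIV_deriv_iff_real_differentiable)
  have ode: "(real n - 1) / m * (F2 r + (real n - 1) / r * F1 r) + \<alpha> * f r + \<beta> * r * deriv f r = 0"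
    if "r > 0" for r
    using prof that unfolding is_profile_def F1_def F_def F2_def by blast
  have dF': "((\<lambda>S. F (exp (- S))) has_real_derivative F1 (exp (- S)) * (- exp (- S))) (at S)" for S
    by (rule DERIV_chain2[where f=F, OF dF]) (auto intro!: derivative_eq_intros)
  have dF1': "((\<lambda>S. F1 (exp (- S))) has_real_derivative F2 (exp (- S)) * (- exp (- S))) (at S)" for S
    by (rule DERIV_chain2[where f=F1, OF dF1]) (auto intro!: derivative_eq_intros)
  have df': "((\<lambda>S. f (exp (- S))) has_real_derivative deriv f (exp (- S)) * (- exp (- S))) (at S)" for S
    by (rule DERIV_chain2[where f=f, OF df]) (auto intro!: derivative_eq_intros)
  define V1 where "V1 = (\<lambda>S. - exp (- a * S) * (a * F (exp (- S)) + exp (- S) * F1 (exp (- S))))"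
  define V2 where "V2 = (\<lambda>S. exp (- a * S) * (a\<^sup>2 * F (exp (- S)) + (2 * a + 1) * exp (- S) * F1 (exp (- S))
      + (exp (- S))\<^sup>2 * F2 (exp (- S))))"
  have VF: "V = (\<lambda>S. exp (- a * S) * F (exp (- S)))" by (simp add: V F_def)
  have dV: "(V has_real_derivative V1 S) (at S)" for S
    unfolding VF V1_def by (auto intro!: derivative_eq_intros dF' simp: algebra_simps)
  have dV1: "(V1 has_real_derivative V2 S) (at S)" for S
    unfolding V2_def V1_def
    by (auto intro!: derivative_eq_intros dF' dF1' simp: algebra_simps power2_eq_square)
  have Vpos: "V S > 0" for S unfolding VF F_def using fpos[of "exp (-S)"] by simp
  \<comment> \<open>The profile equation is invariant under f -> \<lambda>^c f(\<lambda> r), and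
    \<open>c\<close> is this scaling exponent. Because \<alpha> = c \<beta>, the terms \<alpha> f +
    \<beta> r f' form a perfect derivative: with r = exp (-S) they equal -\<beta> r^-c times the
    S-derivative of r^c f, which is \<open>V powr (1 / m)\<close>. The identity c = a + 2 accounts
    for the r^2 of the Laplacian.\<close>
  define c where "c = 2 / (1 - m)"
  have ca: "c = a + 2" unfolding c_def a using m by (simp add: field_simps)
  have am: "a = c * m" unfolding c_def a by simp
  have G: "V S powr (1 / m) = exp (- c * S) * f (exp (- S))" for S
    using m fpos[of "exp (-S)"]
    by (simp add: V powr_mult powr_powr am exp_powr_real)
  have "((\<lambda>S. V S powr (1 / m)) has_real_derivative (1 / m) * V S powr (1 / m - 1) * V1 S) (at S)" for S
    by (auto intro!: derivative_eq_intros dV simp: Vpos less_imp_neq[symmetric])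
  moreover have "((\<lambda>S. V S powr (1 / m)) has_real_derivative
     - exp (- c * S) * (c * f (exp (- S)) + exp (- S) * deriv f (exp (- S)))) (at S)" for S
    unfolding G by (auto intro!: derivative_eq_intros df' simp: algebra_simps)
  ultimately have G1: "(1 / m) * V S powr (1 / m - 1) * V1 S
     = - exp (- c * S) * (c * f (exp (- S)) + exp (- S) * deriv f (exp (- S)))" for S
    using DERIV_unique by blast
  have "V2 S - (real n - 2 - 2 * a) * V1 S - a * (real n - 2 - a) * V S
        = \<beta> * m / (real n - 1) * ((1 / m) * V S powr (1 / m - 1) * V1 S)" for S
  proof -
    define r where "r = exp (- S)"
    have r: "r > 0" by (simp add: r_def)
    have ex: "exp (- c * S) = exp (- a * S) * r\<^sup>2"
      by (simp add: r_def ca power2_eq_square flip: exp_add) (simp add: algebra_simps)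
    have l: "V2 S - (real n - 2 - 2 * a) * V1 S - a * (real n - 2 - a) * V S
       = exp (- a * S) * (r\<^sup>2 * F2 r + (real n - 1) * r * F1 r)"
      unfolding V2_def V1_def VF r_def[symmetric] by (simp add: algebra_simps power2_eq_square)
    have "r\<^sup>2 * F2 r + (real n - 1) * r * F1 r = r\<^sup>2 * (F2 r + (real n - 1) / r * F1 r)"
      using r by (simp add: field_simps power2_eq_square)
    also have "F2 r + (real n - 1) / r * F1 r = - (\<alpha> * f r + \<beta> * r * deriv f r) * m / (real n - 1)"
      using ode[OF r] m n by (simp add: field_simps)
    also have "\<alpha> = \<beta> * c" by (simp add: \<alpha> c_def)
    finally show ?thesis unfolding l G1 ex r_def[symmetric]
      by (simp add: field_simps)
  qed
  then show ?thesis using that dV dV1 Vpos by blast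
qed

text \<open>After the power \<open>m\<close> the decay of the profile reads r^(n-2) f^m -> 1, so V
  behaves like exp ((n - 2 - a) S) at -infinity. For a = 2m/(1-m) this rate is
  \<open>\<mu>\<^sub>1\<close>.\<close>

lemma profile_rescaled_tendsto_at_bot:
  fixes f :: "real \<Rightarrow> real"
  assumes lim: "((\<lambda>r. r powr ((real n - 2) / m) * f r) \<longlongrightarrow> 1) at_top" and m: "0 < m"
    and pos: "\<And>r. r > 0 \<Longrightarrow> f r > 0"
  shows "((\<lambda>S. exp (- (real n - 2 - a) * S) * (exp (- a * S) * f (exp (- S)) powr m)) \<longlongrightarrow> 1) at_bot"
proof -
  have "filterlim (\<lambda>S::real. exp (- S)) at_top at_bot" by real_asymp
  from filterlim_compose[OF lim this]
  have "((\<lambda>S. exp (- S) powr ((real n - 2) / m) * f (exp (- S))) \<longlongrightarrow> 1) at_bot" .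
  then have "((\<lambda>S. (exp (- S) powr ((real n - 2) / m) * f (exp (- S))) powr m) \<longlongrightarrow> 1 powr m) at_bot"
    by (intro tendsto_intros) auto
  moreover have "(exp (- S) powr ((real n - 2) / m) * f (exp (- S))) powr m
     = exp (- (real n - 2 - a) * S) * (exp (- a * S) * f (exp (- S)) powr m)" for S
    using m pos[of "exp (-S)"]
    by (simp add: powr_mult exp_powr_real mult.assoc[symmetric] flip: exp_add)
       (simp add: algebra_simps)
  ultimately show ?thesis by simp
qed

text \<open>Suppose \<open>V1 S \<le> 0\<close>. Since \<open>V\<close> is smaller than
  \<open>V S\<close> far to the left, it has a maximum over (-infinity, S]. There \<open>V1\<close>
  vanishes, even if the maximum is at \<open>S\<close>, where the assumed sign excludes a positive
  slope; then \<open>crit\<close> makes \<open>V\<close> larger just to the left, a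
  contradiction.\<close>

lemma rescaled_deriv_pos:
  fixes V V1 V2 :: "real \<Rightarrow> real"
  assumes dV: "\<And>S. (V has_real_derivative V1 S) (at S)"
    and dV1: "\<And>S. (V1 has_real_derivative V2 S) (at S)"
    and crit: "\<And>S. V1 S = 0 \<Longrightarrow> V2 S > 0"
    and pos: "\<And>S. V S > 0" and lim: "(V \<longlongrightarrow> 0) at_bot"
  shows "V1 S > 0"
proof (rule ccontr)
  assume "\<not> V1 S > 0"
  then have neg: "V1 S \<le> 0" by simp
  obtain R where R: "\<And>x. x \<le> R \<Longrightarrow> V x < V S"
    using order_tendstoD(2)[OF lim, of "V S"] pos[of S] unfolding eventually_at_bot_linorder by auto
  have RS: "R < S" using R[of S] by (metis linorder_not_le order_less_irrefl)
  have "continuous_on {R..S} V"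
    using dV DERIV_isCont continuous_at_imp_continuous_on by blast
  with RS obtain s where s: "s \<in> {R..S}" "\<And>y. y \<in> {R..S} \<Longrightarrow> V y \<le> V s"
    using continuous_attains_sup[of "{R..S}" V] by auto
  have "V S \<le> V s" using s(2)[of S] RS by auto
  then have sR: "R < s" using R[of s] s(1) by force
  have all: "V y \<le> V s" if "y \<le> S" for y
    using s(2)[of y] R[of y] that \<open>V S \<le> V s\<close> by (cases "y \<le> R") auto
  have "V1 s \<ge> 0"
  proof (rule ccontr)
    assume "\<not> V1 s \<ge> 0"
    then obtain d where d: "d > 0" "\<And>h. h > 0 \<Longrightarrow> h < d \<Longrightarrow> V s < V (s - h)"
      using DERIV_neg_dec_left[OF dV[of s]] by auto
    show False using d(2)[of "d/2"] d(1) all[of "s - d/2"] s(1) by auto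
  qed
  moreover have "V1 s \<le> 0"
  proof (rule ccontr)
    assume c: "\<not> V1 s \<le> 0"
    then obtain d where d: "d > 0" "\<And>h. h > 0 \<Longrightarrow> h < d \<Longrightarrow> V s < V (s + h)"
      using DERIV_pos_inc_right[OF dV[of s]] by auto
    have "s < S" using c neg s(1) by (cases "s = S") auto
    then show False using d(2)[of "min (d/2) (S - s)"] d(1) all[of "s + min (d/2) (S - s)"] by linarith
  qed
  ultimately have s0: "V1 s = 0" by simp
  obtain d where d: "d > 0" "\<And>h. h > 0 \<Longrightarrow> h < d \<Longrightarrow> V1 (s - h) < V1 s"
    using DERIV_pos_inc_left[OF dV1[of s] crit[OF s0]] by auto
  obtain z where z: "s - d/2 < z" "z < s" "V s - V (s - d/2) = (s - (s - d/2)) * V1 z"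
    using MVT2[of "s - d/2" s V V1] dV d(1) by auto
  have "V1 z < 0" using d(2)[of "s - z"] z s0 by auto
  then have "(s - (s - d/2)) * V1 z < 0" using d(1) by (simp add: mult_pos_neg)
  then show False using z(3) all[of "s - d/2"] s(1) d(1) by auto
qed

text \<open>The linear part of the equation has exponentially growing solutions because
  \<open>A > 0\<close>. The damping term with \<open>b > 0\<close> excludes this growth. For p = 1/m
  the bound says that \<open>V\<close> is O(S^(m/(1-m))).\<close>

lemma rescaled_growth:
  fixes V V1 V2 :: "real \<Rightarrow> real"
  assumes dV: "\<And>S. (V has_real_derivative V1 S) (at S)"
    and dV1: "\<And>S. (V1 has_real_derivative V2 S) (at S)"
    and ode: "\<And>S. V2 S - B * V1 S - A * V S = - b * (p * V S powr (p - 1) * V1 S)"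
    and pos: "\<And>S. V S > 0" "\<And>S. V1 S > 0" and A: "A > 0" "b > 0"
  obtains K where "K > 0" "\<And>S. S \<ge> 0 \<Longrightarrow> V S powr (p - 1) \<le> K * (1 + S)"
proof -
  have mono: "V x \<le> V y" if "x \<le> y" for x y
    using DERIV_nonneg_imp_nondecreasing[OF that] dV pos(2) less_imp_le by metis
  \<comment> \<open>The equation says \<open>E' = A V\<close>, and \<open>V\<close> increases, so \<open>E\<close> grows at most like \<open>S V(S)\<close>;
    dividing \<open>b V\<^sup>p \<le> E + B V\<close> by \<open>V\<close> gives the bound.\<close>
  define E where "E = (\<lambda>S. V1 S - B * V S + b * V S powr p)"
  have dE: "(E has_real_derivative A * V S) (at S)" for S
    unfolding E_def
    using ode[of S] by (auto intro!: derivative_eq_intros dV dV1 simp: pos algebra_simps)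
  define K where "K = (\<bar>E 0\<bar> / V 0 + \<bar>B\<bar> + A) / b"
  have K: "K > 0" unfolding K_def using A pos(1)[of 0] by (intro divide_pos_pos add_nonneg_pos) auto
  have "V S powr (p - 1) \<le> K * (1 + S)" if S: "S \<ge> 0" for S
  proof -
    have "E S \<le> E 0 + A * S * V S"
    proof (cases "S = 0")
      case False
      then have "0 < S" using S by simp
      then obtain z where z: "0 < z" "z < S" "E S - E 0 = (S - 0) * (A * V z)"
        using MVT2[of 0 S E "\<lambda>S. A * V S"] dE by auto
      have "S * (A * V z) \<le> S * (A * V S)" using z A mono[of z S] by (intro mult_left_mono) auto
      then show ?thesis using z(3) by (simp add: algebra_simps)
    qed simp
    then have "b * V S powr p \<le> \<bar>E 0\<bar> + A * S * V S + B * V S"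
      using pos(2)[of S] unfolding E_def by linarith
    \<comment> \<open>The constant \<open>\<bar>E 0\<bar>\<close> becomes a multiple of
      \<open>V S\<close> through \<open>V 0 \<le> V S\<close>, so that \<open>V S\<close> can be
      cancelled.\<close>
    also have "\<dots> \<le> \<bar>E 0\<bar> / V 0 * V S + A * S * V S + \<bar>B\<bar> * V S"
    proof -
      have "\<bar>E 0\<bar> = \<bar>E 0\<bar> / V 0 * V 0" using pos(1)[of 0] by simp
      also have "\<dots> \<le> \<bar>E 0\<bar> / V 0 * V S" using mono[OF S] pos(1)[of 0] by (intro mult_left_mono) auto
      finally show ?thesis using mult_right_mono[OF abs_ge_self, of "V S" B] pos(1)[of S] by linarith
    qed
    also have "\<dots> = (\<bar>E 0\<bar> / V 0 + \<bar>B\<bar> + A * S) * V S" by (simp add: algebra_simps)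
    also have "V S powr p = V S powr (p - 1) * V S"
      using pos(1)[of S] by (simp add: powr_diff)
    finally have "(b * V S powr (p - 1)) * V S \<le> (\<bar>E 0\<bar> / V 0 + \<bar>B\<bar> + A * S) * V S" by (simp add: mult.assoc)
    then have "b * V S powr (p - 1) \<le> \<bar>E 0\<bar> / V 0 + \<bar>B\<bar> + A * S"
      using pos(1)[of S] by simp
    also have "\<dots> \<le> (\<bar>E 0\<bar> / V 0 + \<bar>B\<bar> + A) * (1 + S)"
    proof -
      have "0 \<le> (\<bar>E 0\<bar> / V 0 + \<bar>B\<bar>) * S" using S pos(1)[of 0] by (intro mult_nonneg_nonneg) auto
      then show ?thesis using A by (simp only: distrib_left mult_1_right distrib_right)
    qed
    finally show ?thesis unfolding K_def using A by (simp add: field_simps)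
  qed
  with K that show ?thesis by blast
qed

text \<open>The three limits serve the cutoff error at its two ends: at +infinity power growth is
  set against \<open>S\<close> or against an exponential, at -infinity the exponential decay of
  \<open>V\<close> is used. The shift \<open>c\<close> will be -ln \<lambda>.\<close>

lemma profile_rescaled_properties:
  fixes f :: "real \<Rightarrow> real" and n :: nat
  assumes prof: "is_profile n m \<alpha> \<beta> f" and m: "0 < m" "m < (real n - 2) / real n" and n: "n \<ge> 3"
    and \<alpha>: "\<alpha> = 2 * \<beta> / (1 - m)" and \<beta>: "\<beta> < 0"
    and a: "a = 2 * m / (1 - m)"
    and V: "V = (\<lambda>S. exp (- a * S) * f (exp (- S)) powr m)"
  shows "V S > 0" and "mono V"
    and "m < 1 / 2 \<Longrightarrow> ((\<lambda>S. V (S + c) / S) \<longlongrightarrow> 0) at_top"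
    and "\<delta> > 0 \<Longrightarrow> ((\<lambda>S. exp (- \<delta> * S) * V (S + c)) \<longlongrightarrow> 0) at_top"
    and "\<delta> < real n - 2 - a \<Longrightarrow> ((\<lambda>S. exp (- \<delta> * S) * V (S + c)) \<longlongrightarrow> 0) at_bot"
proof -
  have m1: "m < 1" 
  proof -
    have "(real n - 2) / real n < 1" using n by simp
    then show ?thesis using m(2) by linarith
  qed
  obtain V1 V2 where dV: "\<And>S. (V has_real_derivative V1 S) (at S)"
    and dV1: "\<And>S. (V1 has_real_derivative V2 S) (at S)"
    and ode: "\<And>S. V2 S - (real n - 2 - 2 * a) * V1 S - a * (real n - 2 - a) * V S
        = \<beta> * m / (real n - 1) * ((1 / m) * V S powr (1 / m - 1) * V1 S)"
    and pos: "\<And>S. V S > 0"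
    by (rule profile_rescaled_ode[OF prof m(1) m1 _ \<alpha> a V]) (use n in auto)
  have a0: "a > 0" using a m m1 by simp
  \<comment> \<open>The upper bound on \<open>m\<close> is equivalent to n - 2 - a > 0, which makes
    \<open>V\<close> decay at -infinity and be strictly convex at its critical points.\<close>
  have "m * real n < real n - 2" using m(2) n by (simp add: field_simps)
  then have mu: "real n - 2 - a > 0" unfolding a using m m1 by (simp add: field_simps)
  have fpos: "f r > 0" if "r > 0" for r using prof that unfolding is_profile_def by blast
  have flim: "((\<lambda>r. r powr ((real n - 2) / m) * f r) \<longlongrightarrow> 1) at_top"
    using prof unfolding is_profile_def by blast
  have lim1: "((\<lambda>S. exp (- (real n - 2 - a) * S) * V S) \<longlongrightarrow> 1) at_bot"
    using profile_rescaled_tendsto_at_bot[OF flim m(1) fpos, of a] unfolding V by simp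
  have bot: "((\<lambda>S. exp (- \<delta> * S) * V S) \<longlongrightarrow> 0) at_bot" if d: "\<delta> < real n - 2 - a" for \<delta>
  proof -
    have "real n - 2 - a - \<delta> > 0" using d by simp
    then have "((\<lambda>S. exp ((real n - 2 - a - \<delta>) * S)) \<longlongrightarrow> 0) at_bot" by real_asymp
    from tendsto_mult[OF this lim1] show ?thesis
      by (simp add: mult.assoc[symmetric] flip: exp_add) (simp add: algebra_simps)
  qed
  have V0: "(V \<longlongrightarrow> 0) at_bot" using bot[of 0] mu by simp
  have V1pos: "V1 S > 0" for S
  proof (rule rescaled_deriv_pos[OF dV dV1 _ pos V0])
    fix S assume "V1 S = 0"
    then have "V2 S = a * (real n - 2 - a) * V S" using ode[of S] by simp
    then show "V2 S > 0" using a0 mu pos[of S] by simp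
  qed
  show "V S > 0" by (rule pos)
  show mono: "mono V"
    by (rule monoI) (metis DERIV_nonneg_imp_nondecreasing dV V1pos less_imp_le)
  obtain K where K: "K > 0" "\<And>S. S \<ge> 0 \<Longrightarrow> V S powr (1 / m - 1) \<le> K * (1 + S)"
  proof (rule rescaled_growth[where p = "1/m" and b = "- \<beta> * m / (real n - 1)", OF dV dV1 _ pos V1pos])
    show "V2 S - (real n - 2 - 2 * a) * V1 S - (a * (real n - 2 - a)) * V S
      = - (- \<beta> * m / (real n - 1)) * (1 / m * V S powr (1 / m - 1) * V1 S)" for S
      using ode[of S] by simp
    show "a * (real n - 2 - a) > 0" using a0 mu by simp
    show "- \<beta> * m / (real n - 1) > 0" using \<beta> m n by (intro divide_pos_pos) (auto simp: mult_neg_pos)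
  qed auto
  \<comment> \<open>\<open>\<theta>\<close> inverts the exponent \<open>1 / m - 1\<close> of the
    growth bound; it is below 1 exactly for m < 1/2.\<close>
  define \<theta> where "\<theta> = m / (1 - m)"
  have th: "\<theta> > 0" "(1 / m - 1) * \<theta> = 1" using m m1 by (auto simp: \<theta>_def field_simps)
  have VK: "V S \<le> (K * (1 + S)) powr \<theta>" if "S \<ge> 0" for S
  proof -
    have "V S = (V S powr (1 / m - 1)) powr \<theta>" using pos[of S] th(2) by (simp add: powr_powr)
    also have "\<dots> \<le> (K * (1 + S)) powr \<theta>" using K(2)[OF that] th(1) by (intro powr_mono2) auto
    finally show ?thesis .
  qed
  show "((\<lambda>S. V (S + c) / S) \<longlongrightarrow> 0) at_top" if "m < 1 / 2"
  proof (rule tendsto_sandwich[where f = "\<lambda>_. 0"])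
    show "\<forall>\<^sub>F S in at_top. V (S + c) / S \<le> (K * (1 + (S + c))) powr \<theta> / S"
      using eventually_ge_at_top[of "max 1 (- c)"]
      by eventually_elim (auto intro!: divide_right_mono VK)
    show "\<forall>\<^sub>F S in at_top. 0 \<le> V (S + c) / S"
      using eventually_gt_at_top[of 0] by eventually_elim (simp add: pos less_imp_le)
    have "\<theta> < 1" using that m by (simp add: \<theta>_def field_simps)
    then show "((\<lambda>S. (K * (1 + (S + c))) powr \<theta> / S) \<longlongrightarrow> 0) at_top" using th(1) K(1) by real_asymp
  qed simp
  show "((\<lambda>S. exp (- \<delta> * S) * V (S + c)) \<longlongrightarrow> 0) at_top" if "\<delta> > 0"
  proof (rule tendsto_sandwich[where f = "\<lambda>_. 0"])
    show "\<forall>\<^sub>F S in at_top. exp (- \<delta> * S) * V (S + c) \<le> exp (- \<delta> * S) * (K * (1 + (S + c))) powr \<theta>"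
      using eventually_ge_at_top[of "- c"]
      by eventually_elim (auto intro!: mult_left_mono VK)
    show "\<forall>\<^sub>F S in at_top. 0 \<le> exp (- \<delta> * S) * V (S + c)"
      by (simp add: pos less_imp_le)
    show "((\<lambda>S. exp (- \<delta> * S) * (K * (1 + (S + c))) powr \<theta>) \<longlongrightarrow> 0) at_top"
      using th(1) K(1) that by real_asymp
  qed simp
  show "((\<lambda>S. exp (- \<delta> * S) * V (S + c)) \<longlongrightarrow> 0) at_bot" if "\<delta> < real n - 2 - a"
  proof -
    have "filterlim (\<lambda>S::real. S + c) at_bot at_bot" by real_asymp
    from filterlim_compose[OF bot[OF that] this]
    have "((\<lambda>S. exp (\<delta> * c) * (exp (- \<delta> * (S + c)) * V (S + c))) \<longlongrightarrow> exp (\<delta> * c) * 0) at_bot"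
      by (intro tendsto_intros) 
    then show ?thesis
      by (simp add: mult.assoc[symmetric] flip: exp_add) (simp add: algebra_simps)
  qed
qed

section \<open>The image of the measure under the logarithmic radius\<close>

text \<open>The image of \<open>|x|\<^sup>-\<^sup>n dx\<close> under \<open>x \<mapsto> -ln |x|\<close>. It is a multiple of Lebesgue measure, but translation
  invariance and local finiteness, which follow from scaling, suffice and avoid polar coordinates.\<close>

definition log_radial_measure :: "'a::euclidean_space itself \<Rightarrow> real measure" where
  "log_radial_measure _ = distr (density lborel (\<lambda>x::'a. ennreal (norm x powr - real DIM('a)))) borel
     (\<lambda>x. - ln (norm x))"

lemma sets_log_radial_measure [simp, measurable_cong]:
  "sets (log_radial_measure TYPE('a::euclidean_space)) = sets borel"
  by (simp add: log_radial_measure_def)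

lemma nn_integral_log_radial_measure:
  assumes [measurable]: "\<psi> \<in> borel_measurable borel"
  shows "(\<integral>\<^sup>+S. \<psi> S \<partial>log_radial_measure TYPE('a::euclidean_space))
    = (\<integral>\<^sup>+(x::'a). ennreal (norm x powr - real DIM('a)) * \<psi> (- ln (norm x)) \<partial>lborel)"
  unfolding log_radial_measure_def
  by (subst nn_integral_distr) (auto simp: nn_integral_density)

text \<open>Dilation by exp (-c) moves \<open>- ln (norm x)\<close> by \<open>c\<close>, and its
  Jacobian exp (-c)^n is cancelled by the weight |x|^-n.\<close>

lemma nn_integral_log_radial_measure_shift:
  assumes [measurable]: "\<psi> \<in> borel_measurable borel"
  shows "(\<integral>\<^sup>+S. \<psi> (S + c) \<partial>log_radial_measure TYPE('a::euclidean_space))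
    = (\<integral>\<^sup>+S. \<psi> S \<partial>log_radial_measure TYPE('a))"
proof -
  define G where "G = (\<lambda>x::'a. ennreal (norm x powr - real DIM('a)) * \<psi> (- ln (norm x)))"
  have [measurable]: "G \<in> borel_measurable borel" unfolding G_def by measurable
  have "(\<integral>\<^sup>+x. G x \<partial>lborel)
      = (\<integral>\<^sup>+x. G x \<partial>density (distr lborel borel (\<lambda>x. 0 + exp (- c) *\<^sub>R x)) (\<lambda>_. \<bar>exp (- c)\<bar> ^ DIM('a)))"
    by (subst lborel_affine[of "exp (- c)" "0::'a"]) auto
  also have "\<dots> = (\<integral>\<^sup>+x. ennreal (exp (- c) ^ DIM('a)) * G (exp (- c) *\<^sub>R x) \<partial>lborel)"
    by (simp add: nn_integral_density nn_integral_distr)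
  also have "\<dots> = (\<integral>\<^sup>+(x::'a). ennreal (norm x powr - real DIM('a)) * \<psi> (- ln (norm x) + c) \<partial>lborel)"
  proof (rule nn_integral_cong)
    fix x :: 'a
    show "ennreal (exp (- c) ^ DIM('a)) * G (exp (- c) *\<^sub>R x)
        = ennreal (norm x powr - real DIM('a)) * \<psi> (- ln (norm x) + c)"
    \<comment> \<open>At the origin both sides vanish, since
      \<open>0 powr - real DIM('a) = 0\<close>.\<close>
    proof (cases "x = 0")
      case False
      have 1: "- ln (norm (exp (- c) *\<^sub>R x)) = - ln (norm x) + c"
        using False by (simp add: ln_mult)
      have 2: "exp (- c) ^ DIM('a) * norm (exp (- c) *\<^sub>R x) powr - real DIM('a) = norm x powr - real DIM('a)"
      proof -
        have "norm (exp (- c) *\<^sub>R x) powr - real DIM('a)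
            = exp (- c) powr - real DIM('a) * norm x powr - real DIM('a)"
          by (simp add: powr_mult)
        moreover have "exp (- c) ^ DIM('a) * exp (- c) powr - real DIM('a) = 1"
          by (simp add: powr_minus powr_realpow)
        ultimately show ?thesis by (simp add: mult.assoc[symmetric])
      qed
      show ?thesis unfolding G_def 1 2[symmetric]
        by (simp add: mult.assoc[symmetric] ennreal_mult')
    qed (simp add: G_def)
  qed
  finally show ?thesis
    by (simp add: nn_integral_log_radial_measure G_def)
qed

lemma emeasure_log_radial_measure_shift:
  "emeasure (log_radial_measure TYPE('a::euclidean_space)) {A + c..B + c}
    = emeasure (log_radial_measure TYPE('a)) {A..B}"
proof -
  have "(\<integral>\<^sup>+S. indicator {A + c..B + c} (S + c) \<partial>log_radial_measure TYPE('a))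
    = (\<integral>\<^sup>+S. indicator {A + c..B + c} S \<partial>log_radial_measure TYPE('a))"
    by (rule nn_integral_log_radial_measure_shift) auto
  moreover have "(\<lambda>S. indicator {A + c..B + c} (S + c)) = (indicator {A..B} :: real \<Rightarrow> ennreal)"
    by (auto simp: indicator_def)
  ultimately show ?thesis by simp
qed

text \<open>On the annulus exp (-1) \<le> |x| \<le> 1 the weight |x|^-n is at most exp n, and the
  annulus lies in a ball.\<close>

lemma emeasure_log_radial_measure_unit:
  "emeasure (log_radial_measure TYPE('a::euclidean_space)) {0..1} < \<infinity>"
proof -
  have "emeasure (log_radial_measure TYPE('a)) {0..1}
      = (\<integral>\<^sup>+S. indicator {0..1} S \<partial>log_radial_measure TYPE('a))" by simp
  also have "\<dots> = (\<integral>\<^sup>+(x::'a). ennreal (norm x powr - real DIM('a)) * indicator {0..1} (- ln (norm x)) \<partial>lborel)"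
    by (subst nn_integral_log_radial_measure) auto
  also have "\<dots> \<le> (\<integral>\<^sup>+(x::'a). ennreal (exp (real DIM('a))) * indicator (ball 0 2) x \<partial>lborel)"
  proof (rule nn_integral_mono)
    fix x :: 'a
    show "ennreal (norm x powr - real DIM('a)) * indicator {0..1} (- ln (norm x))
      \<le> ennreal (exp (real DIM('a))) * indicator (ball 0 2) x"
    proof (cases "x \<noteq> 0 \<and> 0 \<le> - ln (norm x) \<and> - ln (norm x) \<le> 1")
      case True
      then have "norm x \<le> 1" using ln_le_zero_iff[of "norm x"] by simp
      moreover have "norm x powr - real DIM('a) \<le> exp (real DIM('a))"
        using True mult_left_mono[of "- ln (norm x)" 1 "real DIM('a)"] by (simp add: powr_def)
      ultimately show ?thesis by (auto simp: indicator_def intro: ennreal_leI)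
    qed (auto simp: indicator_def)
  qed
  also have "\<dots> < \<infinity>"
    using emeasure_lborel_ball_finite[of "0::'a" 2] 
    by (subst nn_integral_cmult_indicator) (auto simp: ennreal_mult_less_top)
  finally show ?thesis .
qed

text \<open>Translates of [0, 1] cover the interval. The additional term is the case
  \<open>k = 0\<close>, a single point, whose measure has not been shown to vanish.\<close>

lemma emeasure_log_radial_measure_le:
  "emeasure (log_radial_measure TYPE('a::euclidean_space)) {A..A + real k}
    \<le> of_nat k * emeasure (log_radial_measure TYPE('a)) {0..1} + emeasure (log_radial_measure TYPE('a)) {0..0}"
proof (induction k)
  case 0
  then show ?case using emeasure_log_radial_measure_shift[of 0 A 0, where 'a = 'a] by simp
next
  case (Suc k)
  have "emeasure (log_radial_measure TYPE('a)) {A..A + real (Suc k)}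
     \<le> emeasure (log_radial_measure TYPE('a)) ({A..A + real k} \<union> {0 + (A + real k)..1 + (A + real k)})"
    by (rule emeasure_mono) auto
  also have "\<dots> \<le> emeasure (log_radial_measure TYPE('a)) {A..A + real k}
     + emeasure (log_radial_measure TYPE('a)) {0 + (A + real k)..1 + (A + real k)}"
    by (rule emeasure_subadditive) auto
  also have "\<dots> \<le> (of_nat k * emeasure (log_radial_measure TYPE('a)) {0..1} + emeasure (log_radial_measure TYPE('a)) {0..0})
      + emeasure (log_radial_measure TYPE('a)) {0..1}"
    unfolding emeasure_log_radial_measure_shift by (rule add_right_mono[OF Suc.IH])
  finally show ?case by (simp add: algebra_simps)
qed

lemma emeasure_log_radial_measure_bound:
  obtains N where "N > 0"
    "\<And>A k. emeasure (log_radial_measure TYPE('a::euclidean_space)) {A..A + real k} \<le> ennreal (N * (real k + 1))"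
proof -
  \<comment> \<open>The added 1 makes \<open>N\<close> positive, so that it may stand in a
    denominator.\<close>
  define N where "N = enn2real (emeasure (log_radial_measure TYPE('a)) {0..1}) + 1"
  have "emeasure (log_radial_measure TYPE('a)) {0..1} = ennreal (enn2real (emeasure (log_radial_measure TYPE('a)) {0..1}))"
    using emeasure_log_radial_measure_unit[where 'a='a] by simp
  also have "\<dots> \<le> ennreal N" unfolding N_def by (intro ennreal_leI) simp
  finally have e1: "emeasure (log_radial_measure TYPE('a)) {0..1} \<le> ennreal N" .
  then have e0: "emeasure (log_radial_measure TYPE('a)) {0..0} \<le> ennreal N"
    using emeasure_mono[of "{0..0::real}" "{0..1}" "log_radial_measure TYPE('a)"] by (auto intro: order_trans)
  have N0: "N > 0" unfolding N_def by (simp add: add_nonneg_pos)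
  have "emeasure (log_radial_measure TYPE('a)) {A..A + real k} \<le> ennreal (N * (real k + 1))" for A k
  proof -
    have "emeasure (log_radial_measure TYPE('a)) {A..A + real k} \<le> of_nat k * ennreal N + ennreal N"
      using emeasure_log_radial_measure_le[of A k, where 'a='a] e1 e0
      by (meson add_mono mult_left_mono order_trans zero_le)
    also have "\<dots> = ennreal (N * (real k + 1))"
      using N0 by (simp add: ennreal_of_nat_eq_real_of_nat algebra_simps flip: ennreal_mult' ennreal_plus)
    finally show ?thesis .
  qed
  with N0 that show ?thesis by blast
qed

text \<open>The difference telescopes: after a translation only the values of \<open>V\<close> on \<open>[R + c1, R + c2]\<close> survive.\<close>

lemma nn_integral_log_radial_increment_le:
  fixes V :: "real \<Rightarrow> real"
  assumes V: "\<And>s. V s > 0" "mono V" and c: "c1 \<le> c2"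
  shows "(\<integral>\<^sup>+S. indicator {-R..R} S * ennreal (V (S + c2) - V (S + c1)) \<partial>log_radial_measure TYPE('a::euclidean_space))
    \<le> ennreal (V (R + c2)) * emeasure (log_radial_measure TYPE('a)) {c1..c2}"
    (is "?D \<le> ?B")
proof -
  let ?\<nu> = "log_radial_measure TYPE('a)"
  have [measurable]: "V \<in> borel_measurable borel" using V(2) by (rule borel_measurable_mono)
  define I where "I = (\<lambda>c. \<integral>\<^sup>+S. indicator {-R + c..R + c} S * ennreal (V S) \<partial>?\<nu>)"
  have shift: "(\<integral>\<^sup>+S. indicator {-R..R} S * ennreal (V (S + c)) \<partial>?\<nu>) = I c" for c
  proof -
    have "(\<integral>\<^sup>+S. indicator {-R + c..R + c} (S + c) * ennreal (V (S + c)) \<partial>?\<nu>) = I c"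
      unfolding I_def by (rule nn_integral_log_radial_measure_shift) measurable
    moreover have "indicator {-R + c..R + c} (S + c) = (indicator {-R..R} S :: ennreal)" for S
      by (auto simp: indicator_def)
    ultimately show ?thesis by (simp only:)
  qed
  \<comment> \<open>Finiteness of \<open>I c1\<close> is what permits its cancellation in
    \<open>ennreal\<close> at the end.\<close>
  have fin: "I c1 < \<infinity>"
  proof -
    obtain k :: nat where k: "2 * R \<le> real k" using real_arch_simple by blast
    have "I c1 \<le> (\<integral>\<^sup>+S. ennreal (V (R + c1)) * indicator {-R + c1..-R + c1 + real k} S \<partial>?\<nu>)"
      unfolding I_def
    proof (rule nn_integral_mono)
      fix S
      show "indicator {-R + c1..R + c1} S * ennreal (V S)
          \<le> ennreal (V (R + c1)) * indicator {-R + c1..-R + c1 + real k} S"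
      proof (cases "S \<in> {-R + c1..R + c1}")
        case True
        then have "V S \<le> V (R + c1)" using monoD[OF V(2), of S "R + c1"] by simp
        then show ?thesis using True k by (simp add: ennreal_leI)
      qed simp
    qed
    also have "\<dots> = ennreal (V (R + c1)) * emeasure ?\<nu> {-R + c1..-R + c1 + real k}"
      by (subst nn_integral_cmult_indicator) auto
    also have "\<dots> < \<infinity>"
    proof -
      obtain N where "emeasure ?\<nu> {-R + c1..-R + c1 + real k} \<le> ennreal (N * (real k + 1))"
        by (rule emeasure_log_radial_measure_bound[where 'a='a]) blast
      then have "emeasure ?\<nu> {-R + c1..-R + c1 + real k} < \<infinity>"
        by (rule order_le_less_trans) simp
      then show ?thesis by (simp add: ennreal_mult_less_top)
    qed
    finally show ?thesis .
  qed
  have "?D + I c1 = I c2"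
  proof -
    have "?D + I c1 = (\<integral>\<^sup>+S. indicator {-R..R} S * ennreal (V (S + c2) - V (S + c1))
        + indicator {-R..R} S * ennreal (V (S + c1)) \<partial>?\<nu>)"
      unfolding shift[symmetric] by (rule nn_integral_add[symmetric]) measurable
    also have "\<dots> = (\<integral>\<^sup>+S. indicator {-R..R} S * ennreal (V (S + c2)) \<partial>?\<nu>)"
    proof (rule nn_integral_cong)
      fix S
      have "V (S + c1) \<le> V (S + c2)" using c by (intro monoD[OF V(2)]) simp
      then have "ennreal (V (S + c2) - V (S + c1)) + ennreal (V (S + c1)) = ennreal (V (S + c2))"
        using V(1)[of "S + c1"] by (simp flip: ennreal_plus)
      then show "indicator {-R..R} S * ennreal (V (S + c2) - V (S + c1)) + indicator {-R..R} S * ennreal (V (S + c1))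
        = indicator {-R..R} S * ennreal (V (S + c2))" by (simp add: distrib_left[symmetric])
    qed
    finally show ?thesis unfolding shift .
  qed
  \<comment> \<open>The window of \<open>c2\<close> leaves that of \<open>c1\<close> only on the
    right, within [R + c1, R + c2], where \<open>V\<close> is at most \<open>V (R + c2)\<close>.
    What it misses on the left only helps.\<close>
  also have "I c2 \<le> (\<integral>\<^sup>+S. indicator {-R + c1..R + c1} S * ennreal (V S)
       + ennreal (V (R + c2)) * indicator {R + c1..R + c2} S \<partial>?\<nu>)"
    unfolding I_def
  proof (rule nn_integral_mono)
    fix S
    show "indicator {-R + c2..R + c2} S * ennreal (V S) \<le> indicator {-R + c1..R + c1} S * ennreal (V S)
       + ennreal (V (R + c2)) * indicator {R + c1..R + c2} S"
    proof (cases "S \<in> {-R + c2..R + c2}")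
      case True
      then have "V S \<le> V (R + c2)" using monoD[OF V(2), of S "R + c2"] by simp
      then have "ennreal (V S) \<le> ennreal (V (R + c2))" by (rule ennreal_leI)
      then show ?thesis using True c by (cases "S \<le> R + c1") (auto simp: indicator_def)
    qed simp
  qed
  also have "\<dots> = I c1 + (\<integral>\<^sup>+S. ennreal (V (R + c2)) * indicator {R + c1..R + c2} S \<partial>?\<nu>)"
    unfolding I_def by (rule nn_integral_add) auto
  also have "(\<integral>\<^sup>+S. ennreal (V (R + c2)) * indicator {R + c1..R + c2} S \<partial>?\<nu>)
     = ennreal (V (R + c2)) * emeasure ?\<nu> {c1 + R..c2 + R}"
    by (subst nn_integral_cmult_indicator) (auto simp: add.commute)
  also have "\<dots> = ?B" by (simp only: emeasure_log_radial_measure_shift)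
  finally have "I c1 + ?D \<le> I c1 + ?B" by (simp add: add.commute)
  then show ?thesis using fin by (auto simp: ennreal_add_left_cancel_le)
qed

text \<open>\<open>\<tau>\<close> stands for \<beta>t, so a threshold for \<open>L\<close> that
  serves all \<open>\<tau> \<le> 0\<close> gives an error bound uniform in time; monotonicity of
  \<open>V\<close> reduces every \<tau> to 0. The factor \<open>real L\<close> on the right will
  meet the 1/L of the Laplacian.\<close>

lemma cutoff_error_negligible:
  fixes V :: "real \<Rightarrow> real"
  assumes V: "\<And>s. V s > 0" "mono V" and c: "c1 \<le> c2"
    and lim: "\<delta> = 0 \<Longrightarrow> ((\<lambda>S. V (S + c2) / S) \<longlongrightarrow> 0) at_top"
      "\<delta> \<noteq> 0 \<Longrightarrow> ((\<lambda>S. exp (- \<delta> * S) * V (S + c2)) \<longlongrightarrow> 0) at_top"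
      "\<delta> \<noteq> 0 \<Longrightarrow> ((\<lambda>S. exp (- \<delta> * S) * V (S + c2)) \<longlongrightarrow> 0) at_bot"
    and \<epsilon>: "\<epsilon> > 0"
  shows "\<forall>\<^sub>F L :: nat in sequentially. \<forall>\<tau>\<le>0.
    (\<integral>\<^sup>+S. indicator {S. real L \<le> \<bar>S\<bar> \<and> \<bar>S\<bar> \<le> 2 * real L} S
        * ennreal (exp (- \<delta> * S) * (V (S + c2 + \<tau>) - V (S + c1 + \<tau>))) \<partial>log_radial_measure TYPE('a::euclidean_space))
      \<le> ennreal (real L * \<epsilon>)"
proof -
  let ?\<nu> = "log_radial_measure TYPE('a)"
  have [measurable]: "V \<in> borel_measurable borel" using V(2) by (rule borel_measurable_mono)
  obtain N where N: "N > 0" "\<And>A k. emeasure ?\<nu> {A..A + real k} \<le> ennreal (N * (real k + 1))"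
    by (rule emeasure_log_radial_measure_bound[where 'a='a]) blast
  show ?thesis
  proof (cases "\<delta> = 0")
    case True
    obtain k :: nat where k: "c2 - c1 \<le> real k" using real_arch_simple by blast
    define D where "D = N * (real k + 1)"
    have D: "D > 0" unfolding D_def using N by simp
    \<comment> \<open>\<open>D\<close> bounds the measure of every translate of [c1, c2], and the
      limit is used at S = 2L; hence the factor 2D.\<close>
    define \<epsilon>' where "\<epsilon>' = \<epsilon> / (2 * D)"
    have \<epsilon>': "\<epsilon>' > 0" unfolding \<epsilon>'_def using \<epsilon> D by simp
    have fl: "filterlim (\<lambda>L::nat. 2 * real L) at_top sequentially"
      by (intro filterlim_tendsto_pos_mult_at_top[OF tendsto_const] filterlim_real_sequentially) auto
    have "\<forall>\<^sub>F L in sequentially. V (2 * real L + c2) / (2 * real L) < \<epsilon>'"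
      using order_tendstoD(2)[OF filterlim_compose[OF lim(1)[OF True] fl] \<epsilon>'] .
    then show ?thesis using eventually_gt_at_top[of 0]
    proof eventually_elim
      case (elim L)
      have "(\<integral>\<^sup>+S. indicator {S. real L \<le> \<bar>S\<bar> \<and> \<bar>S\<bar> \<le> 2 * real L} S
        * ennreal (exp (- \<delta> * S) * (V (S + c2 + \<tau>) - V (S + c1 + \<tau>))) \<partial>?\<nu>) \<le> ennreal (real L * \<epsilon>)"
        (is "?I \<le> _") if \<tau>: "\<tau> \<le> 0" for \<tau>
      proof -
        have "?I \<le> (\<integral>\<^sup>+S. indicator {- (2 * real L)..2 * real L} S * ennreal (V (S + (c2 + \<tau>)) - V (S + (c1 + \<tau>))) \<partial>?\<nu>)"
          by (intro nn_integral_mono) (auto simp: indicator_def True add.assoc)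
        also have "\<dots> \<le> ennreal (V (2 * real L + (c2 + \<tau>))) * emeasure ?\<nu> {c1 + \<tau>..c2 + \<tau>}"
          by (rule nn_integral_log_radial_increment_le[OF V]) (use c in simp)
        also have "\<dots> \<le> ennreal (V (2 * real L + c2)) * ennreal D"
        proof (rule mult_mono)
          show "ennreal (V (2 * real L + (c2 + \<tau>))) \<le> ennreal (V (2 * real L + c2))"
            using \<tau> by (intro ennreal_leI monoD[OF V(2)]) simp
          have "emeasure ?\<nu> {c1 + \<tau>..c2 + \<tau>} \<le> emeasure ?\<nu> {c1 + \<tau>..c1 + \<tau> + real k}"
            using k by (intro emeasure_mono) auto
          with N(2)[of "c1 + \<tau>" k] show "emeasure ?\<nu> {c1 + \<tau>..c2 + \<tau>} \<le> ennreal D" by (simp add: D_def)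
        qed auto
        also have "\<dots> = ennreal (V (2 * real L + c2) * D)"
          using V(1) D by (simp add: ennreal_mult' less_imp_le)
        also have "\<dots> \<le> ennreal (real L * \<epsilon>)"
        proof (rule ennreal_leI)
          have "V (2 * real L + c2) \<le> \<epsilon>' * (2 * real L)"
            using elim by (simp add: divide_less_eq)
          then have "V (2 * real L + c2) * D \<le> \<epsilon>' * (2 * real L) * D"
            using D by (intro mult_right_mono) auto
          also have "\<dots> = real L * \<epsilon>" unfolding \<epsilon>'_def using D by (simp add: field_simps)
          finally show "V (2 * real L + c2) * D \<le> real L * \<epsilon>" .
        qed
        finally show ?thesis .
      qed
      then show ?case by (intro allI impI)
    qed
  next
    case False
    \<comment> \<open>The layer lies in an interval of length 4L, whose measure is at most N (4L +
      1) \<le> 5 N L once L \<ge> 1.\<close>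
    define \<epsilon>' where "\<epsilon>' = \<epsilon> / (5 * N)"
    have \<epsilon>': "\<epsilon>' > 0" unfolding \<epsilon>'_def using \<epsilon> N by simp
    obtain A where A: "\<And>S. S \<ge> A \<Longrightarrow> exp (- \<delta> * S) * V (S + c2) < \<epsilon>'"
      using order_tendstoD(2)[OF lim(2)[OF False] \<epsilon>'] unfolding eventually_at_top_linorder by auto
    obtain B where B: "\<And>S. S \<le> B \<Longrightarrow> exp (- \<delta> * S) * V (S + c2) < \<epsilon>'"
      using order_tendstoD(2)[OF lim(3)[OF False] \<epsilon>'] unfolding eventually_at_bot_linorder by auto
    have "\<forall>\<^sub>F L::nat in sequentially. real L \<ge> max (max A (- B)) 1"
      using filterlim_real_sequentially unfolding filterlim_at_top by (rule spec)
    then show ?thesis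
    proof eventually_elim
      case (elim L)
      have "(\<integral>\<^sup>+S. indicator {S. real L \<le> \<bar>S\<bar> \<and> \<bar>S\<bar> \<le> 2 * real L} S
        * ennreal (exp (- \<delta> * S) * (V (S + c2 + \<tau>) - V (S + c1 + \<tau>))) \<partial>?\<nu>) \<le> ennreal (real L * \<epsilon>)"
        (is "?I \<le> _") if \<tau>: "\<tau> \<le> 0" for \<tau>
      proof -
        have "?I \<le> (\<integral>\<^sup>+S. ennreal \<epsilon>' * indicator {- (2 * real L)..- (2 * real L) + real (4 * L)} S \<partial>?\<nu>)"
        proof (rule nn_integral_mono)
          fix S
          show "indicator {S. real L \<le> \<bar>S\<bar> \<and> \<bar>S\<bar> \<le> 2 * real L} S
            * ennreal (exp (- \<delta> * S) * (V (S + c2 + \<tau>) - V (S + c1 + \<tau>)))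
            \<le> ennreal \<epsilon>' * indicator {- (2 * real L)..- (2 * real L) + real (4 * L)} S"
          proof (cases "real L \<le> \<bar>S\<bar> \<and> \<bar>S\<bar> \<le> 2 * real L")
            case True
            have "S \<ge> A \<or> S \<le> B" using True elim by linarith
            then have "exp (- \<delta> * S) * V (S + c2) \<le> \<epsilon>'" using A[of S] B[of S] by (auto intro: less_imp_le)
            \<comment> \<open>Here the exponential suffices without cancellation: the difference is
              bounded by its first term, and monotonicity removes
              \<open>\<tau> \<le> 0\<close>.\<close>
            moreover have "V (S + c2 + \<tau>) - V (S + c1 + \<tau>) \<le> V (S + c2)"
              using V(1)[of "S + c1 + \<tau>"] monoD[OF V(2), of "S + c2 + \<tau>" "S + c2"] \<tau> by linarith
            then have "exp (- \<delta> * S) * (V (S + c2 + \<tau>) - V (S + c1 + \<tau>)) \<le> exp (- \<delta> * S) * V (S + c2)"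
              by (intro mult_left_mono) auto
            ultimately have "exp (- \<delta> * S) * (V (S + c2 + \<tau>) - V (S + c1 + \<tau>)) \<le> \<epsilon>'" by linarith
            then show ?thesis using True by (auto simp: indicator_def intro!: ennreal_leI)
          qed simp
        qed
        also have "\<dots> = ennreal \<epsilon>' * emeasure ?\<nu> {- (2 * real L)..- (2 * real L) + real (4 * L)}"
          by (subst nn_integral_cmult_indicator) auto
        also have "\<dots> \<le> ennreal \<epsilon>' * ennreal (N * (real (4 * L) + 1))"
          by (intro mult_left_mono N) auto
        also have "\<dots> = ennreal (\<epsilon>' * (N * (real (4 * L) + 1)))"
          using \<epsilon>' by (simp add: ennreal_mult')
        also have "\<dots> \<le> ennreal (real L * \<epsilon>)"
        proof (rule ennreal_leI)
          have "\<epsilon>' * (N * (real (4 * L) + 1)) \<le> \<epsilon>' * (N * (5 * real L))"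
            using elim \<epsilon>' N(1) by (intro mult_left_mono) auto
          also have "\<dots> = real L * \<epsilon>" unfolding \<epsilon>'_def using N(1) by (simp add: field_simps)
          finally show "\<epsilon>' * (N * (real (4 * L) + 1)) \<le> real L * \<epsilon>" .
        qed
        finally show ?thesis .
      qed
      then show ?case by (intro allI impI)
    qed
  qed
qed

section \<open>Directional derivatives and Green's formula\<close>

abbreviation has_dirderiv :: "('a::euclidean_space \<Rightarrow> real) \<Rightarrow> real \<Rightarrow> 'a \<Rightarrow> 'a \<Rightarrow> bool" where
  "has_dirderiv g d b x \<equiv> ((\<lambda>s. g (x + s *\<^sub>R b)) has_real_derivative d) (at 0)"

lemma punctured_iff [simp]: "x \<in> punctured \<longleftrightarrow> x \<noteq> 0"
  by (simp add: punctured_def)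

lemma open_punctured [simp]: "open (punctured :: 'a::euclidean_space set)"
  unfolding punctured_def by (rule open_Compl) simp

section \<open>Continuity, lines and translations\<close>

lemma continuous_on_slices:
  assumes "continuous_on (A \<times> B) (\<lambda>(x, t). h x t)"
  shows "t \<in> B \<Longrightarrow> continuous_on A (\<lambda>x. h x t)" and "x \<in> A \<Longrightarrow> continuous_on B (\<lambda>t. h x t)"
proof -
  have "continuous_on A (\<lambda>x. (x, t))" "continuous_on B (\<lambda>t. (x, t))" for t x
    by (intro continuous_intros)+
  then show "t \<in> B \<Longrightarrow> continuous_on A (\<lambda>x. h x t)" "x \<in> A \<Longrightarrow> continuous_on B (\<lambda>t. h x t)"
    using continuous_on_compose2[OF assms, of A "\<lambda>x. (x, t)"]
      continuous_on_compose2[OF assms, of B "\<lambda>t. (x, t)"] by (auto simp: image_subset_iff)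
qed

lemma eventually_line_in_open:
  fixes x b :: "'a::euclidean_space"
  assumes "open U" "x \<in> U"
  shows "\<forall>\<^sub>F s in nhds 0. x + s *\<^sub>R b \<in> U"
proof -
  have "isCont (\<lambda>s. x + s *\<^sub>R b) 0" by (intro continuous_intros)
  then have "((\<lambda>s. x + s *\<^sub>R b) \<longlongrightarrow> x + 0 *\<^sub>R b) (nhds 0)"
    by (simp add: isCont_def tendsto_nhds_iff)
  from topological_tendstoD[OF this assms(1)] assms(2) show ?thesis by simp
qed

lemma has_dirderiv_cong:
  assumes "open U" "x \<in> U" "\<And>y. y \<in> U \<Longrightarrow> g y = h y"
  shows "has_dirderiv g d b x \<longleftrightarrow> has_dirderiv h d b x"
  by (rule DERIV_cong_ev[OF refl _ refl])
     (use eventually_line_in_open[OF assms(1,2), of b] assms(3) in \<open>auto elim: eventually_mono\<close>)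

text \<open>The open sets \<open>punctured\<close> and \<open>- K\<close> cover the space, and on
  the second one \<open>g\<close> is 0.\<close>

lemma continuous_on_zero_extension:
  fixes g :: "'a::euclidean_space \<Rightarrow> real"
  assumes g: "continuous_on punctured g" and K: "compact K" "K \<subseteq> punctured" "\<And>x. x \<notin> K \<Longrightarrow> g x = 0"
  shows "continuous_on UNIV g"
proof -
  have "continuous_on (punctured \<union> - K) g"
  proof (rule continuous_on_open_Un[OF _ _ g])
    show "continuous_on (- K) g"
      by (subst continuous_on_cong[OF refl, of _ _ "\<lambda>_. 0"]) (auto simp: K(3))
    show "open (- K)" using K(1) compact_imp_closed by blast
  qed simp
  moreover have "punctured \<union> - K = UNIV" using K(2) by auto
  ultimately show ?thesis by simp
qed

lemma continuous_on_times_compact_support: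
  fixes g \<eta> :: "'a::euclidean_space \<Rightarrow> real"
  assumes g: "continuous_on punctured g" and \<eta>: "continuous_on UNIV \<eta>"
    and K: "compact K" "K \<subseteq> punctured" "\<And>x. x \<notin> K \<Longrightarrow> \<eta> x = 0"
  shows "continuous_on UNIV (\<lambda>x. g x * \<eta> x)"
proof (rule continuous_on_zero_extension[OF _ K(1,2)])
  show "continuous_on punctured (\<lambda>x. g x * \<eta> x)"
    by (intro continuous_intros g continuous_on_subset[OF \<eta>]) auto
qed (simp add: K(3))

lemma integrable_continuous_compact_support:
  fixes g :: "'a::euclidean_space \<Rightarrow> real"
  assumes g: "continuous_on UNIV g" and K: "compact K" "\<And>x. x \<notin> K \<Longrightarrow> g x = 0"
  shows "integrable lborel g"
proof -
  have "integrable lborel (\<lambda>x. indicator K x *\<^sub>R g x)"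
    using borel_integrable_compact[OF K(1) continuous_on_subset[OF g]] by simp
  moreover have "(\<lambda>x. indicator K x *\<^sub>R g x) = g" using K(2) by (fastforce simp: indicator_def)
  ultimately show ?thesis by simp
qed

lemma lborel_integral_translate:
  fixes g :: "'a::euclidean_space \<Rightarrow> real"
  shows "integrable lborel g \<Longrightarrow> (\<integral>x. g (x + c) \<partial>lborel) = (\<integral>x. g x \<partial>lborel)"
    and "integrable lborel g \<Longrightarrow> integrable lborel (\<lambda>x. g (x + c))"
proof -
  have m: "(\<lambda>x. x + c) \<in> measurable lborel borel" by simp
  have g: "g \<in> borel_measurable borel" if "integrable lborel g" for g :: "'a \<Rightarrow> real"
    using that by (simp add: borel_measurable_integrable)
  have d: "distr lborel borel (\<lambda>x. x + c) = lborel"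
    using lborel_distr_plus[of c] by (metis (no_types, lifting) ext add.commute)
  have i: "integrable lborel (\<lambda>x. g (x + c)) \<longleftrightarrow> integrable lborel g"
    if "g \<in> borel_measurable borel" for g :: "'a \<Rightarrow> real"
    using integrable_distr_eq[OF m that] d by simp
  show "integrable lborel g \<Longrightarrow> integrable lborel (\<lambda>x. g (x + c))"
    using i g by blast
  show "(\<integral>x. g (x + c) \<partial>lborel) = (\<integral>x. g x \<partial>lborel)" if "integrable lborel g"
    using integral_distr[OF m g[OF that]] d by simp
qed

text \<open>By translation invariance every difference quotient of \<open>g\<close> has integral 0.
  The quotients converge to \<open>g'\<close> and, by the mean value theorem, are bounded by a
  constant on a fixed ball and 0 outside it, so dominated convergence applies.\<close>

lemma integral_dirderiv_eq_0:
  fixes g g' :: "'a::euclidean_space \<Rightarrow> real"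
  assumes d: "\<And>x. ((\<lambda>s. g (x + s *\<^sub>R b)) has_real_derivative g' x) (at 0)"
    and cg: "continuous_on UNIV g" and cg': "continuous_on UNIV g'"
    and K: "compact K" "\<And>x. x \<notin> K \<Longrightarrow> g x = 0"
  shows "integral\<^sup>L lborel g' = 0"
proof -
  \<comment> \<open>The hypothesis gives the derivative at parameter 0 from every base point; moving
    the base point to x + s b gives it at \<open>s\<close>.\<close>
  have dd: "((\<lambda>s. g (x + s *\<^sub>R b)) has_real_derivative g' (x + s *\<^sub>R b)) (at s)" for x s
  proof -
    have "((\<lambda>r. g ((x + s *\<^sub>R b) + (r - s) *\<^sub>R b)) has_real_derivative g' (x + s *\<^sub>R b) * 1) (at s)"
      by (rule DERIV_chain2[where f = "\<lambda>r. g ((x + s *\<^sub>R b) + r *\<^sub>R b)"])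
         (use d[of "x + s *\<^sub>R b"] in \<open>auto intro!: derivative_eq_intros\<close>)
    then show ?thesis by (simp add: algebra_simps)
  qed
  have g'0: "g' x = 0" if "x \<notin> K" for x
  proof -
    have "\<forall>\<^sub>F s in nhds 0. x + s *\<^sub>R b \<in> - K"
      using that K(1) by (intro eventually_line_in_open) (auto dest: compact_imp_closed)
    then have "\<forall>\<^sub>F s in nhds 0. g (x + s *\<^sub>R b) = 0" by eventually_elim (use K(2) in auto)
    then have "((\<lambda>s. g (x + s *\<^sub>R b)) has_real_derivative 0) (at 0)"
      by (subst DERIV_cong_ev[OF refl _ refl, where g = "\<lambda>_. 0"]) auto
    then show ?thesis using d DERIV_unique by blast
  qed
  obtain R where R: "R > 0" "K \<subseteq> ball 0 R" using K(1) compact_imp_bounded bounded_subset_ballD by blast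
  have "compact (g' ` K)" using K(1) cg' by (meson compact_continuous_image continuous_on_subset subset_UNIV)
  then obtain M where M: "M > 0" "\<And>x. x \<in> K \<Longrightarrow> \<bar>g' x\<bar> \<le> M"
    using compact_imp_bounded[of "g' ` K"] unfolding bounded_pos by auto
  have Mall: "\<bar>g' x\<bar> \<le> M" for x using M g'0[of x] by (cases "x \<in> K") auto
  define q where "q = (\<lambda>k x. real (Suc k) * (g (x + (1 / real (Suc k)) *\<^sub>R b) - g x))"
  \<comment> \<open>The steps have length at most |b|, so outside this ball neither \<open>x\<close>
    nor the shifted point lies in \<open>K\<close>.\<close>
  define B where "B = ball (0::'a) (R + norm b)"
  have gint: "integrable lborel g" by (rule integrable_continuous_compact_support[OF cg K])
  have q0: "(\<integral>x. q k x \<partial>lborel) = 0" for k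
    unfolding q_def using gint by (simp add: lborel_integral_translate)
  have "(\<lambda>k. \<integral>x. q k x \<partial>lborel) \<longlonglongrightarrow> (\<integral>x. g' x \<partial>lborel)"
  proof (rule integral_dominated_convergence[where w = "\<lambda>x. M * indicator B x"])
    show "g' \<in> borel_measurable lborel" using cg' borel_measurable_continuous_onI by simp
    have gm: "g \<in> borel_measurable borel" using cg borel_measurable_continuous_onI by simp
    show "q k \<in> borel_measurable lborel" for k unfolding q_def using gm by measurable
    show "integrable lborel (\<lambda>x. M * indicator B x :: real)"
      unfolding B_def using emeasure_lborel_ball_finite by (intro integrable_mult_right integrable_real_indicator) auto
    show "AE x in lborel. (\<lambda>k. q k x) \<longlonglongrightarrow> g' x"
    proof (rule AE_I2)
      fix x
      have "(\<lambda>h. (g (x + h *\<^sub>R b) - g x) / h) \<midarrow>0\<rightarrow> g' x"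
        using d[of x] unfolding DERIV_def by simp
      moreover have "filterlim (\<lambda>k. 1 / real (Suc k)) (at 0) sequentially"
        by (rule filterlim_atI) (use LIMSEQ_inverse_real_of_nat in \<open>auto simp: inverse_eq_divide\<close>)
      ultimately have "(\<lambda>k. (g (x + (1 / real (Suc k)) *\<^sub>R b) - g x) / (1 / real (Suc k))) \<longlonglongrightarrow> g' x"
        by (rule filterlim_compose)
      then show "(\<lambda>k. q k x) \<longlonglongrightarrow> g' x" unfolding q_def by (simp add: mult.commute)
    qed
    show "AE x in lborel. norm (q k x) \<le> M * indicator B x" for k
    proof (rule AE_I2)
      fix x
      let ?h = "1 / real (Suc k)"
      show "norm (q k x) \<le> M * indicator B x"
      proof (cases "x \<in> B")
        case True
        obtain z where "g (x + ?h *\<^sub>R b) - g (x + 0 *\<^sub>R b) = (?h - 0) * g' (x + z *\<^sub>R b)"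
          using MVT2[of 0 ?h "\<lambda>s. g (x + s *\<^sub>R b)" "\<lambda>s. g' (x + s *\<^sub>R b)"] dd by auto
        then have "q k x = g' (x + z *\<^sub>R b)" unfolding q_def by simp
        then show ?thesis using Mall True by simp
      next
        case False
        then have nx: "norm x \<ge> R + norm b" by (simp add: B_def)
        have hb: "norm (?h *\<^sub>R b) \<le> norm b" 
          using mult_left_le_one_le[of "norm b" ?h] by simp
        have "norm x - norm (?h *\<^sub>R b) \<le> norm (x + ?h *\<^sub>R b)"
          by (rule norm_diff_ineq)
        then have "norm (x + ?h *\<^sub>R b) \<ge> R" using nx hb by linarith
        moreover have "norm x \<ge> R" using nx norm_ge_zero[of b] by linarith
        ultimately have "x + ?h *\<^sub>R b \<notin> K" "x \<notin> K" using R(2) by (auto simp: subset_iff) 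
        then show ?thesis using K(2) False unfolding q_def by simp
      qed
    qed
  qed
  then show ?thesis using q0 by (simp add: LIMSEQ_const_iff)
qed

text \<open>The derivatives are parameters so that Green's formula can work in one direction at a
  time; the Laplacian involves the unmixed second derivatives alone. As all of them vanish outside
  \<open>K\<close>, products with functions singular at the origin extend by 0.\<close>

locale test_function =
  fixes K :: "'a::euclidean_space set" and \<eta> :: "'a \<Rightarrow> real" and \<eta>1 \<eta>2 :: "'a \<Rightarrow> 'a \<Rightarrow> real"
  assumes compact_support: "compact K" "K \<subseteq> punctured"
    and outside: "x \<notin> K \<Longrightarrow> \<eta> x = 0" "b \<in> Basis \<Longrightarrow> x \<notin> K \<Longrightarrow> \<eta>1 b x = 0" "b \<in> Basis \<Longrightarrow> x \<notin> K \<Longrightarrow> \<eta>2 b x = 0"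
    and cont: "continuous_on UNIV \<eta>" "b \<in> Basis \<Longrightarrow> continuous_on UNIV (\<eta>1 b)" "b \<in> Basis \<Longrightarrow> continuous_on UNIV (\<eta>2 b)"
    and deriv: "b \<in> Basis \<Longrightarrow> has_dirderiv \<eta> (\<eta>1 b x) b x" "b \<in> Basis \<Longrightarrow> has_dirderiv (\<eta>1 b) (\<eta>2 b x) b x"
    and nonneg: "\<eta> x \<ge> 0"
begin

lemma zero_outside: "0 \<notin> K" "\<eta> 0 = 0"
  using outside(1)[of 0] compact_support(2) by (auto simp: subset_iff)

lemma integrable_times:
  fixes g :: "'a \<Rightarrow> real"
  assumes "continuous_on punctured g"
  shows "integrable lborel (\<lambda>x. g x * \<eta> x)" "b \<in> Basis \<Longrightarrow> integrable lborel (\<lambda>x. g x * \<eta>2 b x)"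
  using continuous_on_times_compact_support[OF assms cont(1) compact_support]
    continuous_on_times_compact_support[OF assms cont(3) compact_support] compact_support(1) outside
  by (auto intro!: integrable_continuous_compact_support)

text \<open>\<open>\<psi>2 * \<eta> - \<psi> * \<eta>2 b\<close> is the derivative of
  \<open>\<psi>1 * \<eta> - \<psi> * \<eta>1 b\<close> in direction \<open>b\<close>, the mixed
  terms cancelling. Near the origin the latter function is 0, whatever \<open>\<psi>\<close> does
  there.\<close>

lemma green_direction:
  assumes b: "b \<in> Basis"
    and d: "\<And>x. x \<noteq> 0 \<Longrightarrow> has_dirderiv \<psi> (\<psi>1 x) b x" "\<And>x. x \<noteq> 0 \<Longrightarrow> has_dirderiv \<psi>1 (\<psi>2 x) b x"
    and c: "continuous_on punctured \<psi>" "continuous_on punctured \<psi>1" "continuous_on punctured \<psi>2"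
  shows "(\<integral>x. \<psi>2 x * \<eta> x \<partial>lborel) = (\<integral>x. \<psi> x * \<eta>2 b x \<partial>lborel)"
proof -
  note cc = continuous_on_times_compact_support[OF _ _ compact_support]
  have "(\<integral>x. \<psi>2 x * \<eta> x - \<psi> x * \<eta>2 b x \<partial>lborel) = 0"
  proof (rule integral_dirderiv_eq_0[where g = "\<lambda>x. \<psi>1 x * \<eta> x - \<psi> x * \<eta>1 b x" and b = b])
    show "continuous_on UNIV (\<lambda>x. \<psi>1 x * \<eta> x - \<psi> x * \<eta>1 b x)"
      "continuous_on UNIV (\<lambda>x. \<psi>2 x * \<eta> x - \<psi> x * \<eta>2 b x)"
      by (intro continuous_on_diff cc c cont b outside; assumption)+
    show "compact K" by (rule compact_support)
    show "\<psi>1 x * \<eta> x - \<psi> x * \<eta>1 b x = 0" if "x \<notin> K" for x using outside(1)[OF that] outside(2)[OF b that] by simp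
    show "has_dirderiv (\<lambda>x. \<psi>1 x * \<eta> x - \<psi> x * \<eta>1 b x) (\<psi>2 x * \<eta> x - \<psi> x * \<eta>2 b x) b x" for x
    proof (cases "x \<in> K")
      case True
      then have "x \<noteq> 0" using compact_support(2) by auto
      then show ?thesis
        by (auto intro!: derivative_eq_intros d deriv b)
    next
      case False
      have "has_dirderiv (\<lambda>x. \<psi>1 x * \<eta> x - \<psi> x * \<eta>1 b x) 0 b x \<longleftrightarrow> has_dirderiv (\<lambda>_. 0) 0 b x"
        by (rule has_dirderiv_cong[of "- K"])
           (use False compact_imp_closed[OF compact_support(1)] outside b in auto)
      then show ?thesis using outside(1)[OF False] outside(3)[OF b False] by simp
    qed
  qed
  then show ?thesis using integrable_times c b by simp
qed

end

section \<open>Kato's inequality\<close>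

text \<open>A smooth convex regularisation of the positive part. As \<open>\<epsilon> \<rightarrow> 0\<close> its derivative tends to
  \<open>(1 + sgn s) / 2\<close>; the value at \<open>0\<close> is immaterial, as long as the same limit occurs for \<open>u\<^sub>1 - u\<^sub>2\<close> in time and
  for \<open>u\<^sub>1\<^sup>m - u\<^sub>2\<^sup>m\<close> in space, which have the same sign.\<close>

definition smooth_pos :: "real \<Rightarrow> real \<Rightarrow> real" where
  "smooth_pos \<epsilon> s = (s + sqrt (s\<^sup>2 + \<epsilon>)) / 2"

definition smooth_pos' :: "real \<Rightarrow> real \<Rightarrow> real" where
  "smooth_pos' \<epsilon> s = (1 + s / sqrt (s\<^sup>2 + \<epsilon>)) / 2"

definition smooth_pos'' :: "real \<Rightarrow> real \<Rightarrow> real" where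
  "smooth_pos'' \<epsilon> s = \<epsilon> / (2 * (s\<^sup>2 + \<epsilon>) * sqrt (s\<^sup>2 + \<epsilon>))"

lemma smooth_pos_deriv:
  assumes "\<epsilon> > 0"
  shows "(smooth_pos \<epsilon> has_real_derivative smooth_pos' \<epsilon> s) (at s)"
    and "(smooth_pos' \<epsilon> has_real_derivative smooth_pos'' \<epsilon> s) (at s)"
proof -
  define Q where "Q = sqrt (s\<^sup>2 + \<epsilon>)"
  have p: "s\<^sup>2 + \<epsilon> > 0" using assms by (simp add: add_nonneg_pos)
  then have Q: "Q > 0" "Q * Q = s\<^sup>2 + \<epsilon>" by (simp_all add: Q_def)
  have "((\<lambda>s. s\<^sup>2 + \<epsilon>) has_real_derivative 2 * s) (at s)"
    by (auto intro!: derivative_eq_intros)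
  from DERIV_chain2[where f = sqrt, OF DERIV_real_sqrt[OF p] this]
  have dQ: "((\<lambda>s. sqrt (s\<^sup>2 + \<epsilon>)) has_real_derivative s / Q) (at s)"
    by (rule DERIV_cong) (simp add: Q_def divide_simps)
  show "(smooth_pos \<epsilon> has_real_derivative smooth_pos' \<epsilon> s) (at s)"
    unfolding smooth_pos_def[abs_def] smooth_pos'_def Q_def[symmetric]
    by (intro DERIV_cdivide DERIV_add DERIV_ident dQ)
  have "((\<lambda>s. s / sqrt (s\<^sup>2 + \<epsilon>)) has_real_derivative (1 * Q - s * (s / Q)) / (Q * Q)) (at s)"
    using DERIV_divide[OF DERIV_ident dQ] Q by (simp add: Q_def)
  also have "(1 * Q - s * (s / Q)) / (Q * Q) = (Q * Q - s\<^sup>2) / (Q * Q * Q)"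
    using Q(1) by (simp add: field_simps power2_eq_square)
  also have "\<dots> = \<epsilon> / ((s\<^sup>2 + \<epsilon>) * Q)" unfolding Q(2) by simp
  finally have dq: "((\<lambda>s. s / sqrt (s\<^sup>2 + \<epsilon>)) has_real_derivative \<epsilon> / ((s\<^sup>2 + \<epsilon>) * Q)) (at s)" .
  show "(smooth_pos' \<epsilon> has_real_derivative smooth_pos'' \<epsilon> s) (at s)"
    unfolding smooth_pos'_def[abs_def] smooth_pos''_def Q_def[symmetric]
    using DERIV_cdivide[OF DERIV_add[OF DERIV_const dq], of 1 2] by (simp add: algebra_simps)
qed

lemma smooth_pos_bounds:
  assumes "0 < \<epsilon>" "\<epsilon> \<le> 1"
  shows "0 \<le> smooth_pos' \<epsilon> s" "smooth_pos' \<epsilon> s \<le> 1" "0 \<le> smooth_pos'' \<epsilon> s" "\<bar>smooth_pos \<epsilon> s\<bar> \<le> \<bar>s\<bar> + 1"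
proof -
  have p: "s\<^sup>2 + \<epsilon> > 0" using assms by (simp add: add_nonneg_pos)
  have l: "\<bar>s\<bar> \<le> sqrt (s\<^sup>2 + \<epsilon>)" using assms by (intro real_le_rsqrt) auto
  then have "\<bar>s / sqrt (s\<^sup>2 + \<epsilon>)\<bar> \<le> 1" using p by (simp add: abs_divide)
  then show "0 \<le> smooth_pos' \<epsilon> s" "smooth_pos' \<epsilon> s \<le> 1" unfolding smooth_pos'_def abs_le_iff by simp_all
  show "0 \<le> smooth_pos'' \<epsilon> s" unfolding smooth_pos''_def using p assms by simp
  have "sqrt (s\<^sup>2 + \<epsilon>) \<le> \<bar>s\<bar> + 1"
    using assms by (intro real_le_lsqrt) (auto simp: power2_eq_square algebra_simps)
  then have "0 \<le> s + sqrt (s\<^sup>2 + \<epsilon>)" "s + sqrt (s\<^sup>2 + \<epsilon>) \<le> 2 * (\<bar>s\<bar> + 1)"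
    using l abs_ge_self[of s] abs_ge_minus_self[of s] abs_ge_zero[of s] unfolding distrib_left by linarith+
  then show "\<bar>smooth_pos \<epsilon> s\<bar> \<le> \<bar>s\<bar> + 1" unfolding smooth_pos_def by simp
qed

lemma smooth_pos_continuous:
  assumes "\<epsilon> > 0"
  shows "continuous_on UNIV (smooth_pos \<epsilon>)" "continuous_on UNIV (smooth_pos' \<epsilon>)" "continuous_on UNIV (smooth_pos'' \<epsilon>)"
proof -
  have p: "s\<^sup>2 + \<epsilon> \<noteq> 0" "2 * (s\<^sup>2 + \<epsilon>) \<noteq> 0" for s
    using assms by (smt (verit) zero_le_power2)+
  show "continuous_on UNIV (smooth_pos \<epsilon>)" "continuous_on UNIV (smooth_pos' \<epsilon>)" "continuous_on UNIV (smooth_pos'' \<epsilon>)"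
    unfolding smooth_pos_def[abs_def] smooth_pos'_def[abs_def] smooth_pos''_def[abs_def]
    by (auto intro!: continuous_intros simp del: distrib_left_numeral simp: p)
qed

lemma smooth_pos_tendsto:
  "(\<lambda>k. smooth_pos (1 / real (Suc k)) s) \<longlonglongrightarrow> max s 0"
  "(\<lambda>k. smooth_pos' (1 / real (Suc k)) s) \<longlonglongrightarrow> (1 + sgn s) / 2"
proof -
  have e: "(\<lambda>k. 1 / real (Suc k)) \<longlonglongrightarrow> 0"
    using LIMSEQ_inverse_real_of_nat by (simp add: inverse_eq_divide)
  have l: "(\<lambda>k. sqrt (s\<^sup>2 + 1 / real (Suc k))) \<longlonglongrightarrow> sqrt (s\<^sup>2 + 0)"
    by (intro tendsto_intros e)
  then have "(\<lambda>k. smooth_pos (1 / real (Suc k)) s) \<longlonglongrightarrow> (s + \<bar>s\<bar>) / 2"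
    unfolding smooth_pos_def by (intro tendsto_intros) simp_all
  moreover have "(s + \<bar>s\<bar>) / 2 = max s 0" by (simp add: max_def)
  ultimately show "(\<lambda>k. smooth_pos (1 / real (Suc k)) s) \<longlonglongrightarrow> max s 0" by (simp only:)
  show "(\<lambda>k. smooth_pos' (1 / real (Suc k)) s) \<longlonglongrightarrow> (1 + sgn s) / 2"
  proof (cases "s = 0")
    case False
    then have "(\<lambda>k. smooth_pos' (1 / real (Suc k)) s) \<longlonglongrightarrow> (1 + s / sqrt (s\<^sup>2 + 0)) / 2"
      unfolding smooth_pos'_def by (intro tendsto_intros l) auto
    moreover have "s / sqrt (s\<^sup>2 + 0) = sgn s" using False by (simp add: sgn_if abs_if)
    ultimately show ?thesis by simp
  qed (simp add: smooth_pos'_def)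
qed

text \<open>By convexity the Laplacian of \<open>smooth_pos \<epsilon>\<close> of
  \<open>\<phi>\<close> is at least \<open>smooth_pos' \<epsilon>\<close> of \<open>\<phi>\<close>
  times that of \<open>\<phi>\<close>. Green's formula moves the derivatives to
  \<open>\<eta>\<close>, and \<epsilon> -> 0 by dominated convergence on both sides.
  \<open>w\<close> enters through its sign alone, so that u1 - u2 may stand on the left and u1^m -
  u2^m on the right.\<close>

lemma (in test_function) kato_inequality:
  fixes \<phi> w wt :: "'a \<Rightarrow> real" and \<phi>1 \<phi>2 :: "'a \<Rightarrow> 'a \<Rightarrow> real"
  assumes d: "\<And>b x. b \<in> Basis \<Longrightarrow> x \<noteq> 0 \<Longrightarrow> has_dirderiv \<phi> (\<phi>1 b x) b x"
      "\<And>b x. b \<in> Basis \<Longrightarrow> x \<noteq> 0 \<Longrightarrow> has_dirderiv (\<phi>1 b) (\<phi>2 b x) b x"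
    and c: "continuous_on punctured \<phi>" "\<And>b. b \<in> Basis \<Longrightarrow> continuous_on punctured (\<phi>1 b)"
      "\<And>b. b \<in> Basis \<Longrightarrow> continuous_on punctured (\<phi>2 b)" "continuous_on punctured wt"
    and eq: "\<And>x. x \<noteq> 0 \<Longrightarrow> wt x = C * (\<Sum>b\<in>Basis. \<phi>2 b x)" and C: "C \<ge> 0"
    and sgn: "\<And>x. x \<noteq> 0 \<Longrightarrow> sgn (w x) = sgn (\<phi> x)"
  shows "(\<integral>x. wt x * ((1 + sgn (w x)) / 2) * \<eta> x \<partial>lborel)
    \<le> C * (\<integral>x. max (\<phi> x) 0 * (\<Sum>b\<in>Basis. \<eta>2 b x) \<partial>lborel)"
proof -
  define e where "e = (\<lambda>k. 1 / real (Suc k))"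
  have e: "e k > 0" "e k \<le> 1" for k by (auto simp: e_def)
  define \<phi>e where "\<phi>e = (\<lambda>k x. smooth_pos (e k) (\<phi> x))"
  have comp: "continuous_on punctured (\<lambda>x. h (\<phi> x))" if "continuous_on UNIV h" for h :: "real \<Rightarrow> real"
    using continuous_on_compose2[OF that c(1)] by simp
  note sc = smooth_pos_continuous[OF e(1), THEN comp]
  have step: "(\<integral>x. wt x * smooth_pos' (e k) (\<phi> x) * \<eta> x \<partial>lborel)
     \<le> C * (\<integral>x. smooth_pos (e k) (\<phi> x) * (\<Sum>b\<in>Basis. \<eta>2 b x) \<partial>lborel)" for k
  proof -
    \<comment> \<open>This is the second derivative of \<open>smooth_pos (e k) (\<phi> x)\<close> in
      direction \<open>b\<close>. Its first summand is nonnegative by convexity and will be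
      dropped.\<close>
    define \<psi>2 where "\<psi>2 = (\<lambda>b x. smooth_pos'' (e k) (\<phi> x) * (\<phi>1 b x)\<^sup>2 + smooth_pos' (e k) (\<phi> x) * \<phi>2 b x)"
    have c2: "continuous_on punctured (\<psi>2 b)" if "b \<in> Basis" for b
      unfolding \<psi>2_def by (intro continuous_intros c sc that)
    have green: "(\<integral>x. \<psi>2 b x * \<eta> x \<partial>lborel) = (\<integral>x. smooth_pos (e k) (\<phi> x) * \<eta>2 b x \<partial>lborel)"
      if b: "b \<in> Basis" for b
    proof (rule green_direction[OF b, of _ "\<lambda>x. smooth_pos' (e k) (\<phi> x) * \<phi>1 b x"])
      fix x :: 'a assume x: "x \<noteq> 0"
      show "has_dirderiv (\<lambda>x. smooth_pos (e k) (\<phi> x)) (smooth_pos' (e k) (\<phi> x) * \<phi>1 b x) b x"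
        using DERIV_chain2[where f = "smooth_pos (e k)", OF _ d(1)[OF b x]] smooth_pos_deriv[OF e(1)] by simp
      have "has_dirderiv (\<lambda>x. smooth_pos' (e k) (\<phi> x)) (smooth_pos'' (e k) (\<phi> x) * \<phi>1 b x) b x"
        using DERIV_chain2[where f = "smooth_pos' (e k)", OF _ d(1)[OF b x]] smooth_pos_deriv[OF e(1)] by simp
      then show "has_dirderiv (\<lambda>x. smooth_pos' (e k) (\<phi> x) * \<phi>1 b x) (\<psi>2 b x) b x"
        unfolding \<psi>2_def
        by (auto intro!: derivative_eq_intros d(2)[OF b x] simp: power2_eq_square algebra_simps)
    qed (intro continuous_intros c sc c2 b)+
    have i1: "integrable lborel (\<lambda>x. wt x * smooth_pos' (e k) (\<phi> x) * \<eta> x)"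
      by (intro integrable_times continuous_intros c sc)
    have i2: "integrable lborel (\<lambda>x. (\<Sum>b\<in>Basis. \<psi>2 b x * \<eta> x))"
      by (intro Bochner_Integration.integrable_sum integrable_times c2)
    have "(\<integral>x. wt x * smooth_pos' (e k) (\<phi> x) * \<eta> x \<partial>lborel)
      \<le> (\<integral>x. C * (\<Sum>b\<in>Basis. \<psi>2 b x * \<eta> x) \<partial>lborel)"
    proof (rule integral_mono[OF i1 integrable_mult_right[OF i2]])
      fix x
      show "wt x * smooth_pos' (e k) (\<phi> x) * \<eta> x \<le> C * (\<Sum>b\<in>Basis. \<psi>2 b x * \<eta> x)"
      proof (cases "x = 0")
        case True
        then show ?thesis by (simp add: zero_outside)
      next
        case False
        have "wt x * smooth_pos' (e k) (\<phi> x) * \<eta> x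
          = C * (\<Sum>b\<in>Basis. (smooth_pos' (e k) (\<phi> x) * \<phi>2 b x) * \<eta> x)"
          unfolding eq[OF False] by (simp add: sum_distrib_left sum_distrib_right algebra_simps)
        also have "\<dots> \<le> C * (\<Sum>b\<in>Basis. \<psi>2 b x * \<eta> x)"
          using smooth_pos_bounds(3)[OF e] nonneg C unfolding \<psi>2_def
          by (intro mult_left_mono sum_mono mult_right_mono) auto
        finally show ?thesis .
      qed
    qed
    also have "\<dots> = C * (\<Sum>b\<in>Basis. \<integral>x. \<psi>2 b x * \<eta> x \<partial>lborel)"
      by (simp add: Bochner_Integration.integral_sum integrable_times c2)
    also have "(\<Sum>b\<in>Basis. \<integral>x. \<psi>2 b x * \<eta> x \<partial>lborel) = (\<Sum>b\<in>Basis. \<integral>x. smooth_pos (e k) (\<phi> x) * \<eta>2 b x \<partial>lborel)"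
      by (intro sum.cong green refl)
    also have "\<dots> = (\<integral>x. smooth_pos (e k) (\<phi> x) * (\<Sum>b\<in>Basis. \<eta>2 b x) \<partial>lborel)"
      by (simp add: sum_distrib_left Bochner_Integration.integral_sum integrable_times sc)
    finally show ?thesis .
  qed
  \<comment> \<open>\<open>g\<close> is controlled off the origin only; \<open>h\<close> vanishes at
    the origin because \<open>0 \<notin> K\<close>, so \<open>g\<close> may be cut off
    there.\<close>
  have meas: "(\<lambda>x. g x * h x) \<in> borel_measurable lborel"
    if g: "continuous_on punctured g" and h: "h \<in> borel_measurable borel" "\<And>x. x \<notin> K \<Longrightarrow> h x = 0"
    for g h :: "'a \<Rightarrow> real"
  proof -
    have "(\<lambda>x. indicator punctured x *\<^sub>R g x) \<in> borel_measurable borel"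
      by (rule borel_measurable_continuous_on_indicator[OF _ g]) simp
    then have "(\<lambda>x. (indicator punctured x *\<^sub>R g x) * h x) \<in> borel_measurable borel"
      using h(1) by measurable
    moreover have "(\<lambda>x. (indicator punctured x *\<^sub>R g x) * h x) = (\<lambda>x. g x * h x)"
      using h(2)[OF zero_outside(1)] by (auto simp: fun_eq_iff indicator_def)
    ultimately show ?thesis by simp
  qed
  have \<eta>m: "\<eta> \<in> borel_measurable borel" using cont(1) borel_measurable_continuous_onI by blast
  have \<eta>2m: "(\<lambda>x. \<Sum>b\<in>Basis. \<eta>2 b x) \<in> borel_measurable borel"
    using cont(3) borel_measurable_continuous_onI by (intro borel_measurable_sum) blast
  have lim: "(\<lambda>k. wt x * smooth_pos' (e k) (\<phi> x) * \<eta> x) \<longlonglongrightarrow> wt x * ((1 + sgn (w x)) / 2) * \<eta> x" for x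
  proof (cases "x = 0")
    case False
    show ?thesis unfolding sgn[OF False] e_def by (intro tendsto_intros smooth_pos_tendsto)
  qed (simp add: zero_outside)
  have L: "(\<lambda>k. \<integral>x. wt x * smooth_pos' (e k) (\<phi> x) * \<eta> x \<partial>lborel)
     \<longlonglongrightarrow> (\<integral>x. wt x * ((1 + sgn (w x)) / 2) * \<eta> x \<partial>lborel)"
  proof (rule integral_dominated_convergence[where w = "\<lambda>x. \<bar>wt x * \<eta> x\<bar>"])
    show "AE x in lborel. (\<lambda>k. wt x * smooth_pos' (e k) (\<phi> x) * \<eta> x)
        \<longlonglongrightarrow> wt x * ((1 + sgn (w x)) / 2) * \<eta> x"
      by (rule AE_I2[OF lim])
    show m: "(\<lambda>x. wt x * smooth_pos' (e k) (\<phi> x) * \<eta> x) \<in> borel_measurable lborel" for k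
      by (rule meas) (auto intro!: continuous_intros c sc \<eta>m outside)
    show "(\<lambda>x. wt x * ((1 + sgn (w x)) / 2) * \<eta> x) \<in> borel_measurable lborel"
      by (rule borel_measurable_LIMSEQ_real[OF lim m])
    show "integrable lborel (\<lambda>x. \<bar>wt x * \<eta> x\<bar>)" by (intro integrable_abs integrable_times c)
    show "AE x in lborel. norm (wt x * smooth_pos' (e k) (\<phi> x) * \<eta> x) \<le> \<bar>wt x * \<eta> x\<bar>" for k
      using smooth_pos_bounds(1,2)[OF e]
      by (auto simp: abs_mult intro!: mult_right_mono mult_left_le)
  qed
  have R: "(\<lambda>k. \<integral>x. smooth_pos (e k) (\<phi> x) * (\<Sum>b\<in>Basis. \<eta>2 b x) \<partial>lborel)
     \<longlonglongrightarrow> (\<integral>x. max (\<phi> x) 0 * (\<Sum>b\<in>Basis. \<eta>2 b x) \<partial>lborel)"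
  proof (rule integral_dominated_convergence[where w = "\<lambda>x. (\<bar>\<phi> x\<bar> + 1) * (\<Sum>b\<in>Basis. \<bar>\<eta>2 b x\<bar>)"])
    show "AE x in lborel. (\<lambda>k. smooth_pos (e k) (\<phi> x) * (\<Sum>b\<in>Basis. \<eta>2 b x)) \<longlonglongrightarrow> max (\<phi> x) 0 * (\<Sum>b\<in>Basis. \<eta>2 b x)"
      unfolding e_def by (intro AE_I2 tendsto_intros smooth_pos_tendsto)
    show "(\<lambda>x. smooth_pos (e k) (\<phi> x) * (\<Sum>b\<in>Basis. \<eta>2 b x)) \<in> borel_measurable lborel" for k
      by (rule meas) (auto intro!: sc \<eta>2m sum.neutral outside)
    show "(\<lambda>x. max (\<phi> x) 0 * (\<Sum>b\<in>Basis. \<eta>2 b x)) \<in> borel_measurable lborel"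
      by (rule meas) (auto intro!: continuous_intros c \<eta>2m sum.neutral outside)
    have "integrable lborel (\<lambda>x. \<Sum>b\<in>Basis. \<bar>(\<bar>\<phi> x\<bar> + 1) * \<eta>2 b x\<bar>)"
      by (intro Bochner_Integration.integrable_sum integrable_abs integrable_times continuous_intros c)
    then show "integrable lborel (\<lambda>x. (\<bar>\<phi> x\<bar> + 1) * (\<Sum>b\<in>Basis. \<bar>\<eta>2 b x\<bar>))"
      by (simp add: abs_mult sum_distrib_left)
    show "AE x in lborel. norm (smooth_pos (e k) (\<phi> x) * (\<Sum>b\<in>Basis. \<eta>2 b x)) \<le> (\<bar>\<phi> x\<bar> + 1) * (\<Sum>b\<in>Basis. \<bar>\<eta>2 b x\<bar>)" for k
      using smooth_pos_bounds(4)[OF e]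
      by (auto simp: abs_mult intro!: mult_mono)
  qed
  show ?thesis
    by (rule LIMSEQ_le[OF L tendsto_mult_left[OF R]]) (use step in blast)
qed

text \<open>The positive part of \<open>f\<close> need not be differentiable where \<open>f\<close>
  vanishes, so the fundamental theorem is applied to \<open>smooth_pos \<epsilon>\<close> of
  \<open>f\<close> before \<epsilon> -> 0. The limit of the derivatives carries the same factor (1 +
  sgn) / 2 as Kato's inequality.\<close>

lemma integral_deriv_pos_part:
  fixes f f' :: "real \<Rightarrow> real"
  assumes ab: "a \<le> b" and d: "\<And>t. a \<le> t \<Longrightarrow> t \<le> b \<Longrightarrow> (f has_real_derivative f' t) (at t)"
    and c: "\<And>t. a \<le> t \<Longrightarrow> t \<le> b \<Longrightarrow> isCont f' t"
  shows "(\<integral>t. f' t * ((1 + sgn (f t)) / 2) * indicator {a..b} t \<partial>lborel) = max (f b) 0 - max (f a) 0"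
proof -
  define e where "e = (\<lambda>k. 1 / real (Suc k))"
  have e: "e k > 0" "e k \<le> 1" for k by (auto simp: e_def)
  have cf: "isCont f t" if "a \<le> t" "t \<le> b" for t using d[OF that] DERIV_isCont by blast
  have cs: "isCont (smooth_pos' (e k)) s" for k s
    using smooth_pos_continuous(2)[OF e(1)] by (simp add: continuous_on_eq_continuous_at)
  have cc: "isCont (\<lambda>t. f' t * smooth_pos' (e k) (f t)) t" if "a \<le> t" "t \<le> b" for k t
    using c[OF that] isCont_o2[OF cf[OF that] cs] by (rule continuous_mult)
  have ftc: "(\<integral>t. f' t * smooth_pos' (e k) (f t) * indicator {a..b} t \<partial>lborel)
     = smooth_pos (e k) (f b) - smooth_pos (e k) (f a)" for k
  proof (rule integral_FTC_Icc_real[OF ab _ cc])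
    show "((\<lambda>t. smooth_pos (e k) (f t)) has_real_derivative f' t * smooth_pos' (e k) (f t)) (at t)"
      if "a \<le> t" "t \<le> b" for t
      using DERIV_chain2[OF smooth_pos_deriv(1)[OF e(1)] d[OF that]] by (simp add: mult.commute)
  qed
  have ci: "continuous_on {a..b} f'" using c by (intro continuous_at_imp_continuous_on) auto
  have m: "(\<lambda>t. f' t * smooth_pos' (e k) (f t) * indicator {a..b} t) \<in> borel_measurable lborel" for k
    using borel_measurable_continuous_on_indicator[of "{a..b}" "\<lambda>t. f' t * smooth_pos' (e k) (f t)"]
      continuous_at_imp_continuous_on[of "{a..b}" "\<lambda>t. f' t * smooth_pos' (e k) (f t)"] cc
    by (simp add: mult.commute)
  have lim: "(\<lambda>k. f' t * smooth_pos' (e k) (f t) * indicator {a..b} t)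
        \<longlonglongrightarrow> f' t * ((1 + sgn (f t)) / 2) * indicator {a..b} t" for t
    unfolding e_def by (intro tendsto_intros smooth_pos_tendsto)
  have "(\<lambda>k. \<integral>t. f' t * smooth_pos' (e k) (f t) * indicator {a..b} t \<partial>lborel)
     \<longlonglongrightarrow> (\<integral>t. f' t * ((1 + sgn (f t)) / 2) * indicator {a..b} t \<partial>lborel)"
  proof (rule integral_dominated_convergence[where w = "\<lambda>t. indicator {a..b} t *\<^sub>R \<bar>f' t\<bar>"])
    show "(\<lambda>t. f' t * ((1 + sgn (f t)) / 2) * indicator {a..b} t) \<in> borel_measurable lborel"
      by (rule borel_measurable_LIMSEQ_real[OF lim m])
    show "integrable lborel (\<lambda>t. indicator {a..b} t *\<^sub>R \<bar>f' t\<bar>)"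
      by (rule borel_integrable_compact) (auto intro!: continuous_intros ci)
    show "AE t in lborel. norm (f' t * smooth_pos' (e k) (f t) * indicator {a..b} t) \<le> indicator {a..b} t *\<^sub>R \<bar>f' t\<bar>" for k
      using smooth_pos_bounds(1,2)[OF e]
      by (auto simp: abs_mult indicator_def intro!: mult_left_le)
  qed (use m lim in auto)
  moreover have "(\<lambda>k. \<integral>t. f' t * smooth_pos' (e k) (f t) * indicator {a..b} t \<partial>lborel)
     \<longlonglongrightarrow> max (f b) 0 - max (f a) 0"
    unfolding ftc unfolding e_def by (intro tendsto_intros smooth_pos_tendsto)
  ultimately show ?thesis by (rule LIMSEQ_unique)
qed

text \<open>Instead of differentiating the integral of the positive part in time, Fubini exchanges
  two integrals: integrated first in time, \<open>F\<close> gives the increment of the positive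
  part; integrated first in space, it is bounded by \<open>J\<close> at each time.\<close>

lemma (in test_function) kato_time_integrated:
  fixes w wt :: "'a \<Rightarrow> real \<Rightarrow> real"
  assumes wc: "continuous_on (punctured \<times> {0<..}) (\<lambda>(x, t). w x t)"
    and wtc: "continuous_on (punctured \<times> {0<..}) (\<lambda>(x, t). wt x t)"
    and d: "\<And>x t. x \<noteq> 0 \<Longrightarrow> t > 0 \<Longrightarrow> (w x has_real_derivative wt x t) (at t)"
    and t: "0 < t0" "t0 \<le> t1"
    and J: "\<And>t. t0 \<le> t \<Longrightarrow> t \<le> t1 \<Longrightarrow> (\<integral>x. wt x t * ((1 + sgn (w x t)) / 2) * \<eta> x \<partial>lborel) \<le> J"
  shows "(\<integral>x. max (w x t1) 0 * \<eta> x \<partial>lborel) - (\<integral>x. max (w x t0) 0 * \<eta> x \<partial>lborel) \<le> (t1 - t0) * J"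
proof -
  define F where "F = (\<lambda>x t. wt x t * ((1 + sgn (w x t)) / 2) * \<eta> x * indicator {t0..t1} t)"
  define Q where "Q = K \<times> {t0..t1}"
  have Q: "compact Q" unfolding Q_def using compact_support(1) by (intro compact_Times) auto
  have sub: "Q \<subseteq> punctured \<times> {0<..}" unfolding Q_def using compact_support(2) t by (auto simp: subset_iff)
  have F: "integrable (lborel \<Otimes>\<^sub>M lborel) (case_prod F)"
  proof -
    \<comment> \<open>The sign of \<open>w\<close> is not continuous, so \<open>F\<close> is split
      into \<open>G\<close>, which is continuous on the compact set \<open>Q\<close> and 0 outside,
      and a measurable factor bounded by 1.\<close>
    define G where "G = (\<lambda>p. indicator Q p *\<^sub>R (case p of (x, t) \<Rightarrow> wt x t * \<eta> x))"
    define S where "S = (\<lambda>p. indicator Q p *\<^sub>R (case p of (x, t) \<Rightarrow> w x t))"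
    have "continuous_on Q (\<lambda>p. (case p of (x, t) \<Rightarrow> wt x t) * \<eta> (fst p))"
      by (intro continuous_on_mult continuous_on_subset[OF wtc sub] continuous_on_compose2[OF cont(1)])
         (auto intro!: continuous_intros)
    then have "continuous_on Q (\<lambda>(x, t). wt x t * \<eta> x)" by (simp add: case_prod_unfold)
    then have G: "integrable lborel G" unfolding G_def by (rule borel_integrable_compact[OF Q])
    have S: "S \<in> borel_measurable borel" unfolding S_def
      by (rule borel_measurable_continuous_on_indicator[OF borel_compact[OF Q] continuous_on_subset[OF wc sub]])
    have "integrable lborel (\<lambda>p. G p * ((1 + sgn (S p)) / 2))"
    proof (rule Bochner_Integration.integrable_bound[OF G])
      show "(\<lambda>p. G p * ((1 + sgn (S p)) / 2)) \<in> borel_measurable lborel"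
        using S borel_measurable_integrable[OF G] by simp
      have "norm ((1 + sgn s) / 2) \<le> 1" for s :: real by (simp add: sgn_if)
      then have "norm (G p) * norm ((1 + sgn (S p)) / 2) \<le> norm (G p)" for p by (intro mult_left_le) auto
      then show "AE p in lborel. norm (G p * ((1 + sgn (S p)) / 2)) \<le> norm (G p)"
        unfolding norm_mult by (intro AE_I2)
    qed
    moreover have "(\<lambda>p. G p * ((1 + sgn (S p)) / 2)) = case_prod F"
      using outside(1) by (fastforce simp: fun_eq_iff F_def G_def S_def Q_def indicator_def)
    ultimately show ?thesis by (simp add: lborel_prod)
  qed
  have in_t: "(\<integral>t. F x t \<partial>lborel) = max (w x t1) 0 * \<eta> x - max (w x t0) 0 * \<eta> x" for x
  proof (cases "x = 0")
    case False
    have "continuous_on {0<..} (\<lambda>t. wt x t)"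
      using continuous_on_slices(2)[OF wtc] False by simp
    then have "isCont (wt x) t" if "t > 0" for t
      using that by (simp add: continuous_on_eq_continuous_at)
    then have "(\<integral>t. wt x t * ((1 + sgn (w x t)) / 2) * indicator {t0..t1} t \<partial>lborel)
       = max (w x t1) 0 - max (w x t0) 0"
      using t False by (intro integral_deriv_pos_part d) auto
    moreover have "F x = (\<lambda>t. (wt x t * ((1 + sgn (w x t)) / 2) * indicator {t0..t1} t) * \<eta> x)"
      by (auto simp: F_def)
    ultimately show ?thesis by (simp add: left_diff_distrib)
  qed (simp add: F_def zero_outside)
  have wint: "integrable lborel (\<lambda>x. max (w x t) 0 * \<eta> x)" if "t > 0" for t
  proof (rule integrable_times)
    have "continuous_on punctured (\<lambda>x. w x t)"
      using continuous_on_slices(1)[OF wc] that by simp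
    then show "continuous_on punctured (\<lambda>x. max (w x t) 0)" by (intro continuous_intros)
  qed
  have "(\<integral>x. max (w x t1) 0 * \<eta> x \<partial>lborel) - (\<integral>x. max (w x t0) 0 * \<eta> x \<partial>lborel)
     = (\<integral>x. (\<integral>t. F x t \<partial>lborel) \<partial>lborel)"
    unfolding in_t using wint t by simp
  also have "\<dots> = (\<integral>t. (\<integral>x. F x t \<partial>lborel) \<partial>lborel)"
    by (rule lborel_pair.Fubini_integral[OF F, symmetric])
  also have "\<dots> \<le> (\<integral>t. J * indicator {t0..t1} t \<partial>lborel)"
  proof (rule integral_mono)
    show "integrable lborel (\<lambda>t. \<integral>x. F x t \<partial>lborel)"
      using lborel_pair.integrable_snd[OF F] by simp
    show "integrable lborel (\<lambda>t. J * indicator {t0..t1} t)"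
      by (intro integrable_mult_right integrable_real_indicator) (auto simp: emeasure_lborel_Icc_eq)
    show "(\<integral>x. F x t \<partial>lborel) \<le> J * indicator {t0..t1} t" for t
      unfolding F_def using J[of t] by (simp add: indicator_def)
  qed
  also have "\<dots> = (t1 - t0) * J" using t by simp
  finally show ?thesis .
qed

section \<open>Space derivatives of powers of a solution\<close>

lemma has_dirderiv_imp_pderiv_dir: "has_dirderiv g d b x \<Longrightarrow> pderiv_dir b g x = d"
  unfolding pderiv_dir_def by (rule DERIV_imp_deriv)

lemma has_dirderiv_pderiv_dir:
  "(\<lambda>s. g (x + s *\<^sub>R b)) differentiable (at 0) \<Longrightarrow> has_dirderiv g (pderiv_dir b g x) b x"
  unfolding pderiv_dir_def by (simp add: DERIV_deriv_iff_real_differentiable)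

text \<open>Positivity of \<open>u\<close> keeps the power away from its singularity at 0. The
  derivatives are handed over as functions, in the form in which Kato's inequality asks for
  them.\<close>

lemma C21_powr:
  fixes u :: "'a::euclidean_space \<Rightarrow> real \<Rightarrow> real"
  assumes u: "C21 u" and pos: "\<And>x. x \<noteq> 0 \<Longrightarrow> u x t > 0" and t: "t > 0"
  obtains p1 p2 :: "'a \<Rightarrow> 'a \<Rightarrow> real" where
    "\<And>b x. b \<in> Basis \<Longrightarrow> x \<noteq> 0 \<Longrightarrow> has_dirderiv (\<lambda>y. u y t powr m) (p1 b x) b x"
    "\<And>b x. b \<in> Basis \<Longrightarrow> x \<noteq> 0 \<Longrightarrow> has_dirderiv (p1 b) (p2 b x) b x"
    "continuous_on punctured (\<lambda>y. u y t powr m)"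
    "\<And>b. b \<in> Basis \<Longrightarrow> continuous_on punctured (p1 b)"
    "\<And>b. b \<in> Basis \<Longrightarrow> continuous_on punctured (p2 b)"
    "\<And>x. x \<noteq> 0 \<Longrightarrow> laplacian (\<lambda>y. u y t powr m) x = (\<Sum>b\<in>Basis. p2 b x)"
proof -
  define v where "v = (\<lambda>x. u x t)"
  define v1 where "v1 = (\<lambda>b. pderiv_dir b v)"
  define v2 where "v2 = (\<lambda>b. pderiv_dir b (v1 b))"
  have d1: "has_dirderiv v (v1 b x) b x" if "b \<in> Basis" "x \<noteq> 0" for b x
    using u t that unfolding C21_def v1_def v_def
    by (intro has_dirderiv_pderiv_dir) auto
  have d2: "has_dirderiv (v1 b) (v2 b x) b x" if "b \<in> Basis" "x \<noteq> 0" for b x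
    using u t that unfolding C21_def v2_def v1_def v_def
    by (intro has_dirderiv_pderiv_dir) auto
  have slice: "continuous_on punctured (\<lambda>x. h x t)"
    if "continuous_on (punctured \<times> {0<..}) (\<lambda>(x, t). h x t)" for h :: "'a \<Rightarrow> real \<Rightarrow> real"
    using continuous_on_slices(1)[OF that] t by simp
  have c0: "continuous_on punctured v"
    unfolding v_def using u unfolding C21_def by (intro slice) blast
  have c1: "continuous_on punctured (v1 b)" if "b \<in> Basis" for b
    using u that slice[of "\<lambda>x t. pderiv_dir b (\<lambda>y. u y t) x"] unfolding C21_def v1_def v_def by blast
  have c2: "continuous_on punctured (v2 b)" if "b \<in> Basis" for b
    using u that slice[of "\<lambda>x t. pderiv_dir b (pderiv_dir b (\<lambda>y. u y t)) x"]
    unfolding C21_def v2_def v1_def v_def by blast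
  have vpos: "v x > 0" if "x \<noteq> 0" for x using pos[OF that] by (simp add: v_def)
  define p1 where "p1 = (\<lambda>b x. m * v x powr (m - 1) * v1 b x)"
  define p2 where "p2 = (\<lambda>b x. m * ((m - 1) * v x powr (m - 2)) * (v1 b x)\<^sup>2 + m * v x powr (m - 1) * v2 b x)"
  have dp: "has_dirderiv (\<lambda>y. v y powr q) (q * v x powr (q - 1) * v1 b x) b x" if "b \<in> Basis" "x \<noteq> 0" for b x q
    using DERIV_chain2[OF has_real_derivative_powr[of "v (x + 0 *\<^sub>R b)" q] d1[OF that]] vpos[OF that(2)] by simp
  have e2: "has_dirderiv (p1 b) (p2 b x) b x" if "b \<in> Basis" "x \<noteq> 0" for b x
    unfolding p1_def p2_def
    using DERIV_mult[OF DERIV_cmult[OF dp[OF that, of "m - 1"], of m] d2[OF that]]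
    by (rule DERIV_cong) (simp add: power2_eq_square algebra_simps)
  have e1: "has_dirderiv (\<lambda>y. v y powr m) (p1 b x) b x" if "b \<in> Basis" "x \<noteq> 0" for b x
    unfolding p1_def by (rule dp[OF that])
  have vne: "v x \<noteq> 0" if "x \<in> punctured" for x using vpos that by force
  have "laplacian (\<lambda>y. v y powr m) x = (\<Sum>b\<in>Basis. p2 b x)" if x: "x \<noteq> 0" for x
    unfolding laplacian_def
  proof (rule sum.cong[OF refl])
    fix b :: 'a assume b: "b \<in> Basis"
    \<comment> \<open>The first derivative of the power is known to be \<open>p1\<close> on
      \<open>punctured\<close> only, but this set is open, and the second derivative at
      \<open>x\<close> depends on nearby values alone.\<close>
    have "has_dirderiv (pderiv_dir b (\<lambda>y. v y powr m)) (p2 b x) b x \<longleftrightarrow> has_dirderiv (p1 b) (p2 b x) b x"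
      by (rule has_dirderiv_cong[of punctured]) (auto simp: x intro!: has_dirderiv_imp_pderiv_dir e1 b)
    with e2[OF b x] show "pderiv_dir b (pderiv_dir b (\<lambda>y. v y powr m)) x = p2 b x"
      by (intro has_dirderiv_imp_pderiv_dir) blast
  qed
  moreover have "continuous_on punctured (\<lambda>y. v y powr m)"
    "\<And>b. b \<in> Basis \<Longrightarrow> continuous_on punctured (p1 b)"
    "\<And>b. b \<in> Basis \<Longrightarrow> continuous_on punctured (p2 b)"
    unfolding p1_def p2_def by (intro continuous_intros c0 c1 c2 ballI vne; assumption)+
  ultimately show ?thesis using that e1 e2 unfolding v_def by blast
qed

section \<open>Radial test functions\<close>

lemma DERIV_max_power:
  "((\<lambda>s::real. max s 0 ^ (k + 2)) has_real_derivative real (k + 2) * max s 0 ^ (k + 1)) (at s)"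
proof (cases "s = 0")
  case True
  \<comment> \<open>Caratheodory's criterion at 0: one factor \<open>z\<close> splits off, and the
    remaining power is continuous and vanishes at 0.\<close>
  have "isCont (\<lambda>z::real. max z 0 ^ (k + 1)) 0" by (intro continuous_intros)
  moreover have "max z 0 ^ (k + 2) = max z 0 ^ (k + 1) * z" for z :: real
    by (simp add: max_def)
  ultimately have "((\<lambda>s::real. max s 0 ^ (k + 2)) has_real_derivative 0) (at 0)"
    unfolding CARAT_DERIV by (intro exI[of _ "\<lambda>z. max z 0 ^ (k + 1)"]) auto
  then show ?thesis using True by simp
next
  case False
  show ?thesis
  proof (cases "s > 0")
    case True
    have "\<forall>\<^sub>F z in nhds s. z \<in> {0<..}" using True by (intro eventually_nhds_in_open) auto
    then have "\<forall>\<^sub>F z in nhds s. max z 0 ^ (k + 2) = z ^ (k + 2)" by eventually_elim simp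
    moreover have "((\<lambda>z. z ^ (k + 2)) has_real_derivative real (k + 2) * s ^ (k + 1)) (at s)"
      using DERIV_pow[of "k + 2" s] by simp
    ultimately have "((\<lambda>z. max z 0 ^ (k + 2)) has_real_derivative real (k + 2) * s ^ (k + 1)) (at s)"
      by (subst DERIV_cong_ev[OF refl _ refl]) auto
    then show ?thesis using True by simp
  next
    case f: False
    have "\<forall>\<^sub>F z in nhds s. z \<in> {..<0}" using f False by (intro eventually_nhds_in_open) auto
    then have "\<forall>\<^sub>F z in nhds s. max z 0 ^ (k + 2) = 0" by eventually_elim simp
    then have "((\<lambda>z. max z 0 ^ (k + 2)) has_real_derivative 0) (at s)"
      by (subst DERIV_cong_ev[OF refl _ refl, where g = "\<lambda>_. 0"]) auto
    then show ?thesis using f by simp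
  qed
qed

text \<open>The cube \<open>P\<close> of the positive part is of class C^2, and so is \<kappa> = P
  (1 - P (g)). The 3 in \<open>g\<close> is 2^2 - 1: \<open>g\<close> is at most 0 for |y| \<le> 1
  and at least 1 for |y| \<ge> 2, which gives \<kappa> the values 1 and 0 there. \<open>M\<close>
  exists since both derivatives are continuous and vanish outside [-2, 2].\<close>

lemma smooth_cutoff:
  obtains \<kappa> \<kappa>1 \<kappa>2 :: "real \<Rightarrow> real" and M where
    "\<And>y. (\<kappa> has_real_derivative \<kappa>1 y) (at y)" "\<And>y. (\<kappa>1 has_real_derivative \<kappa>2 y) (at y)"
    "continuous_on UNIV \<kappa>2"
    "\<And>y. 0 \<le> \<kappa> y" "\<And>y. \<kappa> y \<le> 1" "\<And>y. \<bar>y\<bar> \<le> 1 \<Longrightarrow> \<kappa> y = 1" "\<And>y. \<bar>y\<bar> \<ge> 2 \<Longrightarrow> \<kappa> y = 0"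
    "\<And>y. \<bar>y\<bar> \<le> 1 \<or> \<bar>y\<bar> \<ge> 2 \<Longrightarrow> \<kappa>1 y = 0 \<and> \<kappa>2 y = 0"
    "\<And>y. \<bar>\<kappa>1 y\<bar> \<le> M" "\<And>y. \<bar>\<kappa>2 y\<bar> \<le> M"
proof -
  define P where "P = (\<lambda>s::real. max s 0 ^ 3)"
  define P1 where "P1 = (\<lambda>s::real. 3 * max s 0 ^ 2)"
  define P2 where "P2 = (\<lambda>s::real. 6 * max s 0)"
  have dP: "(P has_real_derivative P1 s) (at s)" for s
    using DERIV_max_power[of 1 s] by (simp add: P_def P1_def numeral_3_eq_3 numeral_2_eq_2)
  have dP1: "(P1 has_real_derivative P2 s) (at s)" for s
    using DERIV_cmult[OF DERIV_max_power[of 0 s], of 3] by (simp add: P2_def P1_def numeral_2_eq_2)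
  have cP: "continuous_on UNIV P" "continuous_on UNIV P1" "continuous_on UNIV P2"
    unfolding P_def P1_def P2_def by (intro continuous_intros)+
  define g where "g = (\<lambda>y::real. (y\<^sup>2 - 1) / 3)"
  have dg: "(g has_real_derivative 2 * y / 3) (at y)" for y
    unfolding g_def by (auto intro!: derivative_eq_intros)
  define \<kappa> where "\<kappa> = (\<lambda>y. P (1 - P (g y)))"
  define \<kappa>1 where "\<kappa>1 = (\<lambda>y. - (P1 (1 - P (g y)) * (P1 (g y) * (2 * y / 3))))"
  define \<kappa>2 where "\<kappa>2 = (\<lambda>y. P2 (1 - P (g y)) * (P1 (g y) * (2 * y / 3))\<^sup>2
      - P1 (1 - P (g y)) * (P2 (g y) * (2 * y / 3)\<^sup>2 + P1 (g y) * (2 / 3)))"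
  have dPg: "((\<lambda>y. P (g y)) has_real_derivative P1 (g y) * (2 * y / 3)) (at y)" for y
    by (rule DERIV_chain2[OF dP dg])
  have dP1g: "((\<lambda>y. P1 (g y)) has_real_derivative P2 (g y) * (2 * y / 3)) (at y)" for y
    by (rule DERIV_chain2[OF dP1 dg])
  have d1g: "((\<lambda>y. 1 - P (g y)) has_real_derivative - (P1 (g y) * (2 * y / 3))) (at y)" for y
    using DERIV_diff[OF DERIV_const dPg, of 1 y] by simp
  have d1: "(\<kappa> has_real_derivative \<kappa>1 y) (at y)" for y
    unfolding \<kappa>_def \<kappa>1_def using DERIV_chain2[OF dP d1g, of y] by simp
  have dy: "((\<lambda>y::real. 2 * y / 3) has_real_derivative 2 / 3) (at y)" for y
    by (auto intro!: derivative_eq_intros)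
  have d2: "(\<kappa>1 has_real_derivative \<kappa>2 y) (at y)" for y
  proof -
    have "((\<lambda>y. P1 (1 - P (g y))) has_real_derivative P2 (1 - P (g y)) * - (P1 (g y) * (2 * y / 3))) (at y)"
      by (rule DERIV_chain2[OF dP1 d1g])
    moreover have "((\<lambda>y. P1 (g y) * (2 * y / 3)) has_real_derivative
        P2 (g y) * (2 * y / 3) * (2 * y / 3) + 2 / 3 * P1 (g y)) (at y)"
      by (rule DERIV_mult[OF dP1g dy])
    ultimately show ?thesis
      unfolding \<kappa>1_def \<kappa>2_def
      by (rule DERIV_cong[OF DERIV_minus[OF DERIV_mult]]) (simp add: power2_eq_square algebra_simps)
  qed
  have cg: "continuous_on UNIV g" unfolding g_def by (intro continuous_intros) auto
  have cc: "continuous_on UNIV (\<lambda>y. h (k y))" if "continuous_on UNIV h" "continuous_on UNIV k" for h k :: "real \<Rightarrow> real"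
    using continuous_on_compose2[OF that] by simp
  have c1g: "continuous_on UNIV (\<lambda>y. 1 - P (g y))" 
    by (rule continuous_on_diff[OF continuous_on_const cc[OF cP(1) cg]])
  have c1: "continuous_on UNIV \<kappa>1" unfolding \<kappa>1_def
    by (intro continuous_intros cc[OF cP(2) c1g] cc[OF cP(2) cg]) auto
  have c2: "continuous_on UNIV \<kappa>2" unfolding \<kappa>2_def
    by (intro continuous_intros cc[OF cP(2) c1g] cc[OF cP(3) c1g] cc[OF cP(2) cg] cc[OF cP(3) cg]) auto
  have small: "g y \<le> 0" if "\<bar>y\<bar> \<le> 1" for y
    using that by (simp add: g_def abs_square_le_1)
  have large: "1 - P (g y) \<le> 0" if "\<bar>y\<bar> \<ge> 2" for y
  proof -
    have "y\<^sup>2 \<ge> 4" using power_mono[OF that, of 2] by simp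
    then have "g y \<ge> 1" by (simp add: g_def)
    then show ?thesis by (simp add: P_def one_le_power)
  qed
  have z: "P s = 0" "P1 s = 0" "P2 s = 0" if "s \<le> 0" for s using that by (auto simp: P_def P1_def P2_def)
  have s0: "\<kappa>1 y = 0 \<and> \<kappa>2 y = 0" if "\<bar>y\<bar> \<le> 1" for y
    unfolding \<kappa>1_def \<kappa>2_def using z[OF small[OF that]] by simp
  have l0: "\<kappa>1 y = 0 \<and> \<kappa>2 y = 0" if "\<bar>y\<bar> \<ge> 2" for y
    unfolding \<kappa>1_def \<kappa>2_def using z[OF large[OF that]] by simp
  have bdd: "\<exists>M. \<forall>y. \<bar>h y\<bar> \<le> M" if "continuous_on UNIV h" "\<And>y. \<bar>y\<bar> \<ge> 2 \<Longrightarrow> h y = 0" for h :: "real \<Rightarrow> real"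
  proof -
    have "compact (h ` {-2..2})"
      using that(1) by (intro compact_continuous_image) (auto intro: continuous_on_subset)
    then obtain M where M: "M > 0" "\<forall>v\<in>h ` {-2..2}. norm v \<le> M"
      using compact_imp_bounded[of "h ` {-2..2}"] unfolding bounded_pos by auto
    have "\<bar>h y\<bar> \<le> M" for y
    proof (cases "\<bar>y\<bar> \<le> 2")
      case True
      then have "y \<in> {-2..2}" by auto
      then show ?thesis using M(2) by auto
    next
      case False
      then show ?thesis using that(2)[of y] M(1) by simp
    qed
    then show ?thesis by blast
  qed
  have "\<exists>M. \<forall>y. \<bar>\<kappa>1 y\<bar> \<le> M" "\<exists>M. \<forall>y. \<bar>\<kappa>2 y\<bar> \<le> M"
    by (rule bdd[OF c1], use l0 in simp) (rule bdd[OF c2], use l0 in simp)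
  then obtain M1 M2 where M: "\<And>y. \<bar>\<kappa>1 y\<bar> \<le> M1" "\<And>y. \<bar>\<kappa>2 y\<bar> \<le> M2" by auto
  show ?thesis
  proof (rule that[OF d1 d2 c2])
    show "0 \<le> \<kappa> y" for y by (simp add: \<kappa>_def P_def)
    show "\<kappa> y \<le> 1" for y by (simp add: \<kappa>_def P_def power_le_one)
    show "\<kappa> y = 1" if "\<bar>y\<bar> \<le> 1" for y using z(1)[OF small[OF that]] by (simp add: \<kappa>_def P_def)
    show "\<kappa> y = 0" if "\<bar>y\<bar> \<ge> 2" for y using z(1)[OF large[OF that]] by (simp add: \<kappa>_def)
    show "\<kappa>1 y = 0 \<and> \<kappa>2 y = 0" if "\<bar>y\<bar> \<le> 1 \<or> \<bar>y\<bar> \<ge> 2" for y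
      using that s0 l0 by blast
    show "\<bar>\<kappa>1 y\<bar> \<le> max M1 M2" "\<bar>\<kappa>2 y\<bar> \<le> max M1 M2" for y using M[of y] by auto
  qed
qed

lemma has_dirderiv_norm_inner:
  fixes x b :: "'a::euclidean_space"
  assumes x: "x \<noteq> 0"
  shows "has_dirderiv (\<lambda>y. - ln (norm y)) (- (x \<bullet> b) / (x \<bullet> x)) b x"
    and "has_dirderiv (\<lambda>y. y \<bullet> y) (2 * (x \<bullet> b)) b x"
    and "has_dirderiv (\<lambda>y. y \<bullet> b) (b \<bullet> b) b x"
proof -
  \<comment> \<open>In this form the logarithm of an inner product is differentiated, and the norm
    itself never is.\<close>
  have l: "ln (norm y) = ln (y \<bullet> y) / 2" for y :: 'a
    by (cases "y = 0") (simp_all add: norm_eq_sqrt_inner ln_sqrt)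
  show 2: "has_dirderiv (\<lambda>y. y \<bullet> y) (2 * (x \<bullet> b)) b x"
    by (auto intro!: derivative_eq_intros simp: algebra_simps inner_commute)
  show "has_dirderiv (\<lambda>y. y \<bullet> b) (b \<bullet> b) b x"
    by (auto intro!: derivative_eq_intros simp: algebra_simps)
  have "x \<bullet> x > 0" using x by simp
  then have "has_dirderiv (\<lambda>y. ln (y \<bullet> y)) (1 / (x \<bullet> x) * (2 * (x \<bullet> b))) b x"
    using DERIV_chain2[OF DERIV_ln_divide 2] by simp
  from DERIV_minus[OF DERIV_cdivide[OF this, of 2]]
  show "has_dirderiv (\<lambda>y. - ln (norm y)) (- (x \<bullet> b) / (x \<bullet> x)) b x"
    unfolding l by (rule DERIV_cong) simp
qed

text \<open>The function \<sigma> = -ln |x| has squared gradient |x|^-2 and Laplacian -(n-2) |x|^-2,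
  so the chain rule gives the formula for the sum. \<open>K\<close> is the annulus on which
  |\<sigma>| \<le> R.\<close>

lemma radial_test_function:
  fixes h h1 h2 :: "real \<Rightarrow> real" and R :: real
  defines "K \<equiv> {x::'a::euclidean_space. exp (- R) \<le> norm x \<and> norm x \<le> exp R}"
  defines "\<eta> \<equiv> \<lambda>x::'a. if x = 0 then 0 else h (- ln (norm x))"
  assumes d: "\<And>s. (h has_real_derivative h1 s) (at s)" "\<And>s. (h1 has_real_derivative h2 s) (at s)"
    and c: "continuous_on UNIV h2"
    and z: "\<And>s. \<bar>s\<bar> \<ge> R \<Longrightarrow> h s = 0" "\<And>s. \<bar>s\<bar> \<ge> R \<Longrightarrow> h1 s = 0" "\<And>s. \<bar>s\<bar> \<ge> R \<Longrightarrow> h2 s = 0"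
    and nonneg: "\<And>s. h s \<ge> 0"
  obtains \<eta>1 \<eta>2 where "test_function K \<eta> \<eta>1 \<eta>2"
    "\<And>x. x \<noteq> 0 \<Longrightarrow> (\<Sum>b\<in>Basis. \<eta>2 b x)
       = norm x powr (-2) * (h2 (- ln (norm x)) - (real DIM('a) - 2) * h1 (- ln (norm x)))"
    "\<And>b. b \<in> Basis \<Longrightarrow> \<eta>2 b 0 = 0"
proof -
  define \<sigma> where "\<sigma> = (\<lambda>x::'a. - ln (norm x))"
  define \<eta>1 where "\<eta>1 = (\<lambda>b x::'a. if x = 0 then 0 else - (h1 (\<sigma> x) * (x \<bullet> b) / (x \<bullet> x)))"
  define \<eta>2 where "\<eta>2 = (\<lambda>b x::'a. if x = 0 then 0 else h2 (\<sigma> x) * (x \<bullet> b)\<^sup>2 / (x \<bullet> x)\<^sup>2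
     - h1 (\<sigma> x) * (1 / (x \<bullet> x) - 2 * (x \<bullet> b)\<^sup>2 / (x \<bullet> x)\<^sup>2))"
  have Keq: "K = cball 0 (exp R) - ball 0 (exp (- R))" by (auto simp: K_def)
  have K: "compact K" unfolding Keq by (intro compact_diff compact_cball open_ball)
  have Kp: "K \<subseteq> punctured" by (auto simp: K_def)
  have out: "\<bar>\<sigma> x\<bar> \<ge> R" if "x \<notin> K" "x \<noteq> 0" for x
  proof -
    have "norm x > 0" using that by simp
    then have "norm x = exp (- \<sigma> x)" by (simp add: \<sigma>_def)
    then have "\<not> (- R \<le> - \<sigma> x \<and> - \<sigma> x \<le> R)" using that unfolding K_def by simp
    then show ?thesis by linarith
  qed
  have ch: "continuous_on UNIV h" "continuous_on UNIV h1"
    by (auto intro!: continuous_at_imp_continuous_on DERIV_isCont d)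
  have c\<sigma>: "continuous_on punctured \<sigma>" unfolding \<sigma>_def by (intro continuous_intros) auto
  have ch\<sigma>: "continuous_on punctured (\<lambda>x. h (\<sigma> x))" "continuous_on punctured (\<lambda>x. h1 (\<sigma> x))"
    "continuous_on punctured (\<lambda>x. h2 (\<sigma> x))"
    using continuous_on_compose2[OF ch(1) c\<sigma>] continuous_on_compose2[OF ch(2) c\<sigma>]
      continuous_on_compose2[OF c c\<sigma>] by auto
  note glue = continuous_on_zero_extension[OF _ K Kp]
  have out0: "\<eta> x = 0" "\<eta>1 b x = 0" "\<eta>2 b x = 0" if "x \<notin> K" for b x
    using out[OF that] z by (auto simp: \<eta>_def \<eta>1_def \<eta>2_def \<sigma>_def)
  have nz: "x \<bullet> x \<noteq> 0" "(x \<bullet> x)\<^sup>2 \<noteq> 0" if "x \<in> punctured" for x :: 'a using that by auto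
  have dd: "has_dirderiv \<eta> (\<eta>1 b x) b x \<and> has_dirderiv (\<eta>1 b) (\<eta>2 b x) b x" if b: "b \<in> Basis" for b x
  proof (cases "x = 0")
    case True
    have "x \<in> - K" using True Kp by auto
    then have "has_dirderiv \<eta> 0 b x \<longleftrightarrow> has_dirderiv (\<lambda>_. 0) 0 b x"
      "has_dirderiv (\<eta>1 b) 0 b x \<longleftrightarrow> has_dirderiv (\<lambda>_. 0) 0 b x"
      using out0 compact_imp_closed[OF K] by (intro has_dirderiv_cong[of "- K"]; auto)+
    then show ?thesis using True by (simp add: \<eta>1_def \<eta>2_def)
  next
    case x: False
    note s = has_dirderiv_norm_inner[OF x, of b]
    have s1: "has_dirderiv \<sigma> (- (x \<bullet> b) / (x \<bullet> x)) b x" unfolding \<sigma>_def by (rule s(1))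
    have xx: "x \<bullet> x \<noteq> 0" using x by simp
    have e1: "has_dirderiv (\<lambda>y. h (\<sigma> y)) (h1 (\<sigma> x) * (- (x \<bullet> b) / (x \<bullet> x))) b x"
      using DERIV_chain2[OF d(1) s1] by simp
    have e2: "has_dirderiv (\<lambda>y. h1 (\<sigma> y)) (h2 (\<sigma> x) * (- (x \<bullet> b) / (x \<bullet> x))) b x"
      using DERIV_chain2[OF d(2) s1] by simp
    have "has_dirderiv \<eta> (\<eta>1 b x) b x \<longleftrightarrow> has_dirderiv (\<lambda>y. h (\<sigma> y)) (\<eta>1 b x) b x"
      by (rule has_dirderiv_cong[of punctured]) (auto simp: \<eta>_def \<sigma>_def x)
    moreover have "has_dirderiv (\<lambda>y. h (\<sigma> y)) (\<eta>1 b x) b x"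
      using e1 x by (simp add: \<eta>1_def)
    moreover have "has_dirderiv (\<eta>1 b) (\<eta>2 b x) b x
       \<longleftrightarrow> has_dirderiv (\<lambda>y. - (h1 (\<sigma> y) * (y \<bullet> b) / (y \<bullet> y))) (\<eta>2 b x) b x"
      by (rule has_dirderiv_cong[of punctured]) (auto simp: \<eta>1_def x)
    moreover have "has_dirderiv (\<lambda>y. - (h1 (\<sigma> y) * (y \<bullet> b) / (y \<bullet> y))) (\<eta>2 b x) b x"
    proof (rule DERIV_cong[OF DERIV_minus[OF DERIV_divide[OF DERIV_mult[OF e2 s(3)] s(2)]]])
      show "(x + 0 *\<^sub>R b) \<bullet> (x + 0 *\<^sub>R b) \<noteq> 0" using xx by simp
      have "b \<bullet> b = 1" using b by (simp add: inner_same_Basis)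
      then show "- (((h2 (\<sigma> x) * (- (x \<bullet> b) / (x \<bullet> x)) * ((x + 0 *\<^sub>R b) \<bullet> b) + b \<bullet> b * h1 (\<sigma> (x + 0 *\<^sub>R b))) *
             ((x + 0 *\<^sub>R b) \<bullet> (x + 0 *\<^sub>R b)) -
             h1 (\<sigma> (x + 0 *\<^sub>R b)) * ((x + 0 *\<^sub>R b) \<bullet> b) * (2 * (x \<bullet> b))) /
            ((x + 0 *\<^sub>R b) \<bullet> (x + 0 *\<^sub>R b) * ((x + 0 *\<^sub>R b) \<bullet> (x + 0 *\<^sub>R b)))) = \<eta>2 b x"
        using x xx unfolding \<eta>2_def by (simp add: power2_eq_square divide_simps) (simp add: algebra_simps)
    qed
    ultimately show ?thesis by blast
  qed
  have "test_function K \<eta> \<eta>1 \<eta>2"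
  proof
    show "continuous_on UNIV \<eta>"
    proof (rule glue)
      show "continuous_on punctured \<eta>"
        using ch\<sigma>(1) by (subst continuous_on_cong[OF refl, of _ _ "\<lambda>x. h (\<sigma> x)"]) (auto simp: \<eta>_def \<sigma>_def)
    qed (rule out0)
    show "continuous_on UNIV (\<eta>1 b)" for b
    proof (rule glue)
      have "continuous_on punctured (\<lambda>x. - (h1 (\<sigma> x) * (x \<bullet> b) / (x \<bullet> x)))"
        by (intro continuous_intros ch\<sigma> ballI nz)
      then show "continuous_on punctured (\<eta>1 b)"
        by (subst continuous_on_cong[OF refl]) (auto simp: \<eta>1_def)
    qed (rule out0)
    show "continuous_on UNIV (\<eta>2 b)" for b
    proof (rule glue)
      have "continuous_on punctured (\<lambda>x. h2 (\<sigma> x) * (x \<bullet> b)\<^sup>2 / (x \<bullet> x)\<^sup>2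
         - h1 (\<sigma> x) * (1 / (x \<bullet> x) - 2 * (x \<bullet> b)\<^sup>2 / (x \<bullet> x)\<^sup>2))"
        by (intro continuous_intros ch\<sigma> ballI nz)
      then show "continuous_on punctured (\<eta>2 b)"
        by (subst continuous_on_cong[OF refl]) (auto simp: \<eta>2_def)
    qed (rule out0)
    show "\<eta> x \<ge> 0" for x by (simp add: \<eta>_def nonneg)
  qed (use K Kp out0 dd in auto)
  moreover have "(\<Sum>b\<in>Basis. \<eta>2 b x)
       = norm x powr (-2) * (h2 (- ln (norm x)) - (real DIM('a) - 2) * h1 (- ln (norm x)))" if x: "x \<noteq> 0" for x
  proof -
    define q where "q = x \<bullet> x"
    have q: "q > 0" using x by (simp add: q_def)
    have sq: "(\<Sum>b\<in>Basis. (x \<bullet> b)\<^sup>2) = q"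
      unfolding q_def by (subst euclidean_inner) (simp add: power2_eq_square)
    have "(\<Sum>b\<in>Basis. \<eta>2 b x) = (\<Sum>b\<in>(Basis::'a set). (h2 (\<sigma> x) + 2 * h1 (\<sigma> x)) / q\<^sup>2 * (x \<bullet> b)\<^sup>2 - h1 (\<sigma> x) / q)"
      using x q by (intro sum.cong) (auto simp: \<eta>2_def q_def[symmetric] field_simps)
    also have "\<dots> = (h2 (\<sigma> x) + 2 * h1 (\<sigma> x)) / q\<^sup>2 * q - real DIM('a) * (h1 (\<sigma> x) / q)"
      unfolding sum_subtractf sum_distrib_left[symmetric] sq by simp
    also have "\<dots> = (h2 (\<sigma> x) - (real DIM('a) - 2) * h1 (\<sigma> x)) / q"
      using q by (simp add: field_simps power2_eq_square)
    also have "1 / q = norm x powr (-2)"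
      using x by (simp add: q_def powr_minus powr_realpow[of _ 2, simplified] dot_square_norm divide_inverse)
    then have "(h2 (\<sigma> x) - (real DIM('a) - 2) * h1 (\<sigma> x)) / q
      = norm x powr (-2) * (h2 (\<sigma> x) - (real DIM('a) - 2) * h1 (\<sigma> x))"
      by (metis mult.commute times_divide_eq_right mult_1_right)
    finally show ?thesis by (simp add: \<sigma>_def)
  qed
  ultimately show ?thesis using that by (simp add: \<eta>2_def)
qed

text \<open>The test function is h(S) = exp (\<mu>S) \<kappa>(S/L) with S = -ln |x|. In h'' - (n-2)
  h' the term with \<kappa> itself has the coefficient \<mu> (\<mu> - (n-2)) \<le> 0, and each
  derivative of \<kappa> brings a factor 1/L. A one-sided bound suffices, since the Laplacian will
  be multiplied by a nonnegative function.\<close>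

lemma radial_cutoff_test_functions:
  fixes \<mu> :: real
  assumes \<mu>: "0 < \<mu>" "\<mu> \<le> real DIM('a::euclidean_space) - 2"
  obtains M where "M > 0"
    "\<And>L::nat. L > 0 \<Longrightarrow> \<exists>K (\<eta> :: 'a \<Rightarrow> real) \<eta>1 \<eta>2. test_function K \<eta> \<eta>1 \<eta>2 \<and>
      (\<forall>x. x \<noteq> 0 \<longrightarrow> \<eta> x \<le> norm x powr - \<mu>) \<and>
      (\<forall>x. x \<noteq> 0 \<longrightarrow> \<bar>ln (norm x)\<bar> \<le> real L \<longrightarrow> \<eta> x = norm x powr - \<mu>) \<and>
      (\<forall>b\<in>Basis. \<eta>2 b 0 = 0) \<and>
      (\<forall>x. x \<noteq> 0 \<longrightarrow> (\<Sum>b\<in>Basis. \<eta>2 b x) \<le> norm x powr (- \<mu> - 2) * (M / real L)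
          * indicator {S. real L \<le> \<bar>S\<bar> \<and> \<bar>S\<bar> \<le> 2 * real L} (- ln (norm x)))"
proof -
  define n where "n = real DIM('a)"
  obtain \<kappa> \<kappa>1 \<kappa>2 :: "real \<Rightarrow> real" and M where
    d\<kappa>: "\<And>y. (\<kappa> has_real_derivative \<kappa>1 y) (at y)" "\<And>y. (\<kappa>1 has_real_derivative \<kappa>2 y) (at y)"
    and c\<kappa>: "continuous_on UNIV \<kappa>2"
    and \<kappa>: "\<And>y. 0 \<le> \<kappa> y" "\<And>y. \<kappa> y \<le> 1" "\<And>y. \<bar>y\<bar> \<le> 1 \<Longrightarrow> \<kappa> y = 1" "\<And>y. \<bar>y\<bar> \<ge> 2 \<Longrightarrow> \<kappa> y = 0"
    and \<kappa>0: "\<And>y. \<bar>y\<bar> \<le> 1 \<or> \<bar>y\<bar> \<ge> 2 \<Longrightarrow> \<kappa>1 y = 0 \<and> \<kappa>2 y = 0"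
    and M: "\<And>y. \<bar>\<kappa>1 y\<bar> \<le> M" "\<And>y. \<bar>\<kappa>2 y\<bar> \<le> M"
    by (rule smooth_cutoff) blast
  have M0: "M \<ge> 0" using M(1)[of 0] by linarith
  \<comment> \<open>\<open>q\<close> is the coefficient of \<open>\<kappa>1 / l\<close> in h'' -
    (n-2) h'. \<open>M'\<close> bounds q \<kappa>1 + \<kappa>2 / l for l \<ge> 1, and its last 1
    makes it positive.\<close>
  define q where "q = 2 * \<mu> - (n - 2)"
  define M' where "M' = (\<bar>q\<bar> + 1) * M + 1"
  have M': "M' > 0" using M0 by (simp add: M'_def add_nonneg_pos)
  have pw: "exp (\<mu> * - ln (norm x)) = norm x powr - \<mu>" if "x \<noteq> 0" for x :: 'a
    using that by (simp add: powr_def)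
  have "\<exists>K (\<eta> :: 'a \<Rightarrow> real) \<eta>1 \<eta>2. test_function K \<eta> \<eta>1 \<eta>2 \<and>
      (\<forall>x. x \<noteq> 0 \<longrightarrow> \<eta> x \<le> norm x powr - \<mu>) \<and>
      (\<forall>x. x \<noteq> 0 \<longrightarrow> \<bar>ln (norm x)\<bar> \<le> real L \<longrightarrow> \<eta> x = norm x powr - \<mu>) \<and>
      (\<forall>b\<in>Basis. \<eta>2 b 0 = 0) \<and>
      (\<forall>x. x \<noteq> 0 \<longrightarrow> (\<Sum>b\<in>Basis. \<eta>2 b x) \<le> norm x powr (- \<mu> - 2) * (M' / real L)
          * indicator {S. real L \<le> \<bar>S\<bar> \<and> \<bar>S\<bar> \<le> 2 * real L} (- ln (norm x)))" if L: "L > 0" for L :: nat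
  proof -
    define l where "l = real L"
    have l: "l \<ge> 1" using L by (simp add: l_def)
    have l0: "l \<noteq> 0" using l by simp
    define h where "h = (\<lambda>S. exp (\<mu> * S) * \<kappa> (S / l))"
    define h1 where "h1 = (\<lambda>S. exp (\<mu> * S) * (\<mu> * \<kappa> (S / l) + \<kappa>1 (S / l) / l))"
    define h2 where "h2 = (\<lambda>S. exp (\<mu> * S) * (\<mu>\<^sup>2 * \<kappa> (S / l) + 2 * \<mu> * (\<kappa>1 (S / l) / l) + \<kappa>2 (S / l) / l\<^sup>2))"
    have dl: "((\<lambda>S. S / l) has_real_derivative 1 / l) (at S)" for S
      by (rule DERIV_cdivide[OF DERIV_ident])
    have de: "((\<lambda>S. exp (\<mu> * S)) has_real_derivative \<mu> * exp (\<mu> * S)) (at S)" for S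
      by (auto intro!: derivative_eq_intros)
    have dk: "((\<lambda>S. \<kappa> (S / l)) has_real_derivative \<kappa>1 (S / l) * (1 / l)) (at S)"
      "((\<lambda>S. \<kappa>1 (S / l)) has_real_derivative \<kappa>2 (S / l) * (1 / l)) (at S)" for S
      by (rule DERIV_chain2[OF d\<kappa>(1) dl], rule DERIV_chain2[OF d\<kappa>(2) dl])
    have dh: "(h has_real_derivative h1 S) (at S)" for S
      unfolding h_def h1_def
      by (rule DERIV_cong[OF DERIV_mult[OF de dk(1)]]) (simp add: algebra_simps)
    have dh1: "(h1 has_real_derivative h2 S) (at S)" for S
      unfolding h2_def h1_def
      by (rule DERIV_cong[OF DERIV_mult[OF de DERIV_add[OF DERIV_cmult[OF dk(1)] DERIV_cdivide[OF dk(2)]]]])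
         (simp add: algebra_simps power2_eq_square)
    have ck: "continuous_on UNIV (\<lambda>S. k (S / l))" if "continuous_on UNIV k" for k :: "real \<Rightarrow> real"
      by (rule continuous_on_compose2[OF that]) (auto intro!: continuous_intros simp: l0)
    have "continuous_on UNIV \<kappa>" "continuous_on UNIV \<kappa>1"
      by (auto intro!: continuous_at_imp_continuous_on DERIV_isCont d\<kappa>)
    then have ch2: "continuous_on UNIV h2"
      unfolding h2_def by (intro continuous_intros ck c\<kappa>) (auto simp: l0)
    have big: "\<bar>S / l\<bar> \<ge> 2" if "\<bar>S\<bar> \<ge> 2 * l" for S
      using that l by (simp add: abs_divide field_simps)
    have z: "h S = 0" "h1 S = 0" "h2 S = 0" if "\<bar>S\<bar> \<ge> 2 * l" for S
      using \<kappa>(4)[OF big[OF that]] \<kappa>0[OF disjI2[OF big[OF that]]] by (simp_all add: h_def h1_def h2_def)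
    have h0: "h S \<ge> 0" for S by (simp add: h_def \<kappa>)
    define \<eta> where "\<eta> = (\<lambda>x::'a. if x = 0 then 0 else h (- ln (norm x)))"
    obtain \<eta>1 \<eta>2 where t: "test_function {x. exp (- (2 * l)) \<le> norm x \<and> norm x \<le> exp (2 * l)} \<eta> \<eta>1 \<eta>2"
      and lap: "\<And>x. x \<noteq> 0 \<Longrightarrow> (\<Sum>b\<in>Basis. \<eta>2 b x)
       = norm x powr (-2) * (h2 (- ln (norm x)) - (real DIM('a) - 2) * h1 (- ln (norm x)))"
      and zero: "\<And>b. b \<in> Basis \<Longrightarrow> \<eta>2 b 0 = 0"
      by (rule radial_test_function[where 'a='a and R="2 * l", OF dh dh1 ch2 z h0, folded \<eta>_def]) (assumption | rule that)+
    have bound: "h2 S - (n - 2) * h1 S \<le> exp (\<mu> * S) * (M' / l) * indicator {S. l \<le> \<bar>S\<bar> \<and> \<bar>S\<bar> \<le> 2 * l} S" for S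
    proof -
      let ?k1 = "\<kappa>1 (S / l)" and ?k2 = "\<kappa>2 (S / l)"
      have "h2 S - (n - 2) * h1 S = exp (\<mu> * S) * (\<mu> * (\<mu> - (n - 2)) * \<kappa> (S / l) + (q * ?k1 / l + ?k2 / l\<^sup>2))"
        by (simp add: h1_def h2_def q_def algebra_simps power2_eq_square add_divide_distrib diff_divide_distrib)
      also have "\<dots> \<le> exp (\<mu> * S) * (M' / l * indicator {S. l \<le> \<bar>S\<bar> \<and> \<bar>S\<bar> \<le> 2 * l} S)"
      proof (rule mult_left_mono)
        have "\<mu> * (\<mu> - (n - 2)) * \<kappa> (S / l) \<le> 0"
          using \<mu> \<kappa>(1) by (intro mult_nonpos_nonneg mult_nonneg_nonpos) (auto simp: n_def)
        moreover have "q * ?k1 / l + ?k2 / l\<^sup>2 \<le> M' / l * indicator {S. l \<le> \<bar>S\<bar> \<and> \<bar>S\<bar> \<le> 2 * l} S"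
        proof (cases "l \<le> \<bar>S\<bar> \<and> \<bar>S\<bar> \<le> 2 * l")
          case True
          have "q * ?k1 \<le> \<bar>q\<bar> * M"
            using M(1)[of "S / l"] abs_mult[of q ?k1] abs_ge_self[of "q * ?k1"]
              mult_left_mono[of "\<bar>?k1\<bar>" M "\<bar>q\<bar>"] by linarith
          moreover have "?k2 / l \<le> M"
          proof -
            have "?k2 / l \<le> M / l" using M(2)[of "S / l"] l by (intro divide_right_mono) auto
            also have "\<dots> \<le> M" using l M0 by (simp add: divide_le_eq mult_left_le_one_le mult_le_cancel_left1)
            finally show ?thesis .
          qed
          ultimately have "q * ?k1 + ?k2 / l \<le> M'" by (simp add: M'_def algebra_simps)
          then have "(q * ?k1 + ?k2 / l) / l \<le> M' / l" using l by (intro divide_right_mono) auto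
          then show ?thesis using True by (simp add: add_divide_distrib power2_eq_square)
        next
          case False
          then have "\<bar>S / l\<bar> \<le> 1 \<or> \<bar>S / l\<bar> \<ge> 2" using l by (auto simp: abs_divide field_simps)
          from \<kappa>0[OF this] show ?thesis using M' l by (simp add: indicator_def)
        qed
        ultimately show "\<mu> * (\<mu> - (n - 2)) * \<kappa> (S / l) + (q * ?k1 / l + ?k2 / l\<^sup>2)
            \<le> M' / l * indicator {S. l \<le> \<bar>S\<bar> \<and> \<bar>S\<bar> \<le> 2 * l} S" by linarith
      qed simp
      finally show ?thesis by (simp only: mult.assoc)
    qed
    have "(\<Sum>b\<in>Basis. \<eta>2 b x) \<le> norm x powr (- \<mu> - 2) * (M' / real L)
          * indicator {S. real L \<le> \<bar>S\<bar> \<and> \<bar>S\<bar> \<le> 2 * real L} (- ln (norm x))" if x: "x \<noteq> 0" for x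
    proof -
      have split: "norm x powr (- \<mu> - 2) = norm x powr (-2) * norm x powr - \<mu>"
        by (simp add: algebra_simps flip: powr_add)
      have "(\<Sum>b\<in>Basis. \<eta>2 b x) \<le> norm x powr (-2) * (norm x powr - \<mu> * (M' / l)
          * indicator {S. l \<le> \<bar>S\<bar> \<and> \<bar>S\<bar> \<le> 2 * l} (- ln (norm x)))"
        unfolding lap[OF x] pw[OF x, symmetric] n_def[symmetric] by (intro mult_left_mono bound) simp
      also have "norm x powr (-2) * (norm x powr - \<mu> * (M' / l)
          * indicator {S. l \<le> \<bar>S\<bar> \<and> \<bar>S\<bar> \<le> 2 * l} (- ln (norm x)))
          = norm x powr (- \<mu> - 2) * (M' / l) * indicator {S. l \<le> \<bar>S\<bar> \<and> \<bar>S\<bar> \<le> 2 * l} (- ln (norm x))"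
        by (simp only: split mult.assoc)
      finally show ?thesis unfolding l_def .
    qed
    moreover have "\<eta> x \<le> norm x powr - \<mu>" if "x \<noteq> 0" for x
      using that \<kappa>(2)[of "- ln (norm x) / l"] unfolding pw[OF that, symmetric]
      by (simp add: \<eta>_def h_def mult_left_le)
    moreover have "\<eta> x = norm x powr - \<mu>" if "x \<noteq> 0" "\<bar>ln (norm x)\<bar> \<le> real L" for x
    proof -
      have "\<bar>- ln (norm x) / l\<bar> \<le> 1" using that l by (simp add: abs_divide l_def)
      then show ?thesis using that \<kappa>(3) unfolding pw[OF that(1), symmetric] by (simp add: \<eta>_def h_def)
    qed
    ultimately show ?thesis using t zero by blast
  qed
  with M' that show ?thesis by blast
qed

section \<open>Contraction in the weighted space\<close>

lemma cauchy_solution_slice_continuous: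
  assumes "cauchy_solution m u0 u" "t > 0"
  shows "continuous_on punctured (\<lambda>x. u x t)"
  using assms continuous_on_slices(1)[of punctured "{0<..}" u t]
  unfolding cauchy_solution_def C21_def by simp

text \<open>The Bochner integral of a nonintegrable function is 0, so the convergence at time 0
  demanded in \<open>cauchy_solution\<close> measures a distance only together with this
  integrability.\<close>

lemma cauchy_solution_set_integrable:
  fixes u :: "'a::euclidean_space \<Rightarrow> real \<Rightarrow> real"
  assumes u: "cauchy_solution m u0 u" and K: "compact K" "K \<subseteq> punctured" and t: "t > 0"
  shows "integrable lebesgue (\<lambda>x. indicator K x * \<bar>u x t - u0 x\<bar>)"
proof -
  have "continuous_on K (\<lambda>x. u x t)"
    using cauchy_solution_slice_continuous[OF u t] K(2) by (rule continuous_on_subset)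
  then have "integrable lborel (\<lambda>x. indicator K x *\<^sub>R u x t)"
    by (rule borel_integrable_compact[OF K(1)])
  then have "integrable lebesgue (\<lambda>x. indicator K x *\<^sub>R u x t)"
    by (subst integrable_completion) (auto intro: borel_measurable_integrable)
  moreover have "integrable lebesgue (\<lambda>x. indicator K x *\<^sub>R u0 x)"
    using u K unfolding cauchy_solution_def L1_loc_def set_integrable_def by blast
  ultimately have "integrable lebesgue (\<lambda>x. \<bar>indicator K x *\<^sub>R u x t - indicator K x *\<^sub>R u0 x\<bar>)"
    by (intro integrable_abs Bochner_Integration.integrable_diff)
  then show ?thesis
    by (rule back_subst[of "integrable lebesgue"]) (auto simp: indicator_def)
qed

text \<open>As m > 0, the differences u1 - u2 and u1^m - u2^m have the same sign, so Kato's
  inequality applies at each positive time to the difference of the two equations.\<close>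

lemma (in test_function) kato_between_times:
  fixes u1 u2 :: "'a \<Rightarrow> real \<Rightarrow> real"
  assumes u: "cauchy_solution m u01 u1" "cauchy_solution m u02 u2" and m: "m > 0"
    and t: "0 < t0" "t0 \<le> t1"
    and B: "\<And>t. t > 0 \<Longrightarrow>
      (\<integral>x. max (u1 x t powr m - u2 x t powr m) 0 * (\<Sum>b\<in>Basis. \<eta>2 b x) \<partial>lborel) \<le> B"
  shows "(\<integral>x. max (u1 x t1 - u2 x t1) 0 * \<eta> x \<partial>lborel) - (\<integral>x. max (u1 x t0 - u2 x t0) 0 * \<eta> x \<partial>lborel)
    \<le> (t1 - t0) * ((real DIM('a) - 1) / m * B)"
proof -
  define C where "C = (real DIM('a) - 1) / m"
  have C: "C \<ge> 0" using m by (simp add: C_def)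
  have C21: "C21 u1" "C21 u2" using u by (auto simp: cauchy_solution_def)
  have pos: "u1 x t > 0" "u2 x t > 0" if "x \<noteq> 0" "t > 0" for x t
    using u that by (auto simp: cauchy_solution_def)
  have eq: "deriv (u1 x) t = C * laplacian (\<lambda>y. u1 y t powr m) x"
    "deriv (u2 x) t = C * laplacian (\<lambda>y. u2 y t powr m) x" if "x \<noteq> 0" "t > 0" for x t
    using u that by (auto simp: cauchy_solution_def C_def)
  have cont_u: "continuous_on (punctured \<times> {0<..}) (\<lambda>(x, t). v x t)"
    "continuous_on (punctured \<times> {0<..}) (\<lambda>(x, t). deriv (v x) t)" if "C21 v" for v :: "'a \<Rightarrow> real \<Rightarrow> real"
    using that by (auto simp: C21_def)
  have dt: "(v x has_real_derivative deriv (v x) t) (at t)" if "C21 v" "x \<noteq> 0" "t > 0" for v :: "'a \<Rightarrow> real \<Rightarrow> real" and x t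
    using that by (simp add: C21_def DERIV_deriv_iff_real_differentiable)
  define wt where "wt = (\<lambda>x t. deriv (u1 x) t - deriv (u2 x) t)"
  have wt: "continuous_on (punctured \<times> {0<..}) (\<lambda>(x, t). wt x t)"
    using continuous_on_diff[OF cont_u(2)[OF C21(1)] cont_u(2)[OF C21(2)]]
    by (simp add: wt_def case_prod_unfold)
  show ?thesis unfolding C_def[symmetric]
  proof (rule kato_time_integrated[where wt = wt])
    show "continuous_on (punctured \<times> {0<..}) (\<lambda>(x, t). u1 x t - u2 x t)"
      using continuous_on_diff[OF cont_u(1)[OF C21(1)] cont_u(1)[OF C21(2)]]
      by (simp add: case_prod_unfold)
    show "continuous_on (punctured \<times> {0<..}) (\<lambda>(x, t). wt x t)" by (rule wt)
    show "((\<lambda>t. u1 x t - u2 x t) has_real_derivative wt x t) (at t)" if "x \<noteq> 0" "t > 0" for x t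
      unfolding wt_def by (intro DERIV_diff dt C21 that)
    show "(\<integral>x. wt x t * ((1 + sgn (u1 x t - u2 x t)) / 2) * \<eta> x \<partial>lborel) \<le> C * B"
      if "t0 \<le> t" "t \<le> t1" for t
    proof -
      have tp: "t > 0" using that t by simp
      obtain p1 p2 where p: "\<And>b x. b \<in> Basis \<Longrightarrow> x \<noteq> 0 \<Longrightarrow> has_dirderiv (\<lambda>y. u1 y t powr m) (p1 b x) b x"
        "\<And>b x. b \<in> Basis \<Longrightarrow> x \<noteq> 0 \<Longrightarrow> has_dirderiv (p1 b) (p2 b x) b x"
        "continuous_on punctured (\<lambda>y. u1 y t powr m)"
        "\<And>b. b \<in> Basis \<Longrightarrow> continuous_on punctured (p1 b)"
        "\<And>b. b \<in> Basis \<Longrightarrow> continuous_on punctured (p2 b)"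
        "\<And>x. x \<noteq> 0 \<Longrightarrow> laplacian (\<lambda>y. u1 y t powr m) x = (\<Sum>b\<in>Basis. p2 b x)"
        by (rule C21_powr[OF C21(1) pos(1)[OF _ tp] tp]) blast+
      obtain q1 q2 where q: "\<And>b x. b \<in> Basis \<Longrightarrow> x \<noteq> 0 \<Longrightarrow> has_dirderiv (\<lambda>y. u2 y t powr m) (q1 b x) b x"
        "\<And>b x. b \<in> Basis \<Longrightarrow> x \<noteq> 0 \<Longrightarrow> has_dirderiv (q1 b) (q2 b x) b x"
        "continuous_on punctured (\<lambda>y. u2 y t powr m)"
        "\<And>b. b \<in> Basis \<Longrightarrow> continuous_on punctured (q1 b)"
        "\<And>b. b \<in> Basis \<Longrightarrow> continuous_on punctured (q2 b)"
        "\<And>x. x \<noteq> 0 \<Longrightarrow> laplacian (\<lambda>y. u2 y t powr m) x = (\<Sum>b\<in>Basis. q2 b x)"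
        by (rule C21_powr[OF C21(2) pos(2)[OF _ tp] tp]) blast+
      have "(\<integral>x. wt x t * ((1 + sgn (u1 x t - u2 x t)) / 2) * \<eta> x \<partial>lborel)
        \<le> C * (\<integral>x. max (u1 x t powr m - u2 x t powr m) 0 * (\<Sum>b\<in>Basis. \<eta>2 b x) \<partial>lborel)"
      proof (rule kato_inequality[of _ "\<lambda>b x. p1 b x - q1 b x" "\<lambda>b x. p2 b x - q2 b x", OF _ _ _ _ _ _ _ C])
        show "wt x t = C * (\<Sum>b\<in>Basis. p2 b x - q2 b x)" if "x \<noteq> 0" for x
          using eq[OF that tp] p(6)[OF that] q(6)[OF that]
          by (simp add: wt_def sum_subtractf right_diff_distrib)
        show "continuous_on punctured (\<lambda>x. wt x t)"
          using continuous_on_slices(1)[OF wt] tp by simp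
        show "sgn (u1 x t - u2 x t) = sgn (u1 x t powr m - u2 x t powr m)" if "x \<noteq> 0" for x
        proof -
          have "u1 x t powr m < u2 x t powr m \<longleftrightarrow> u1 x t < u2 x t"
            "u2 x t powr m < u1 x t powr m \<longleftrightarrow> u2 x t < u1 x t"
            using pos[OF that tp] m powr_less_cancel_iff powr_less_mono2[of m]
            by (metis less_imp_le linorder_neqE_linordered_idom order_less_asym)+
          then show ?thesis by (auto simp: sgn_if)
        qed
      qed (intro DERIV_diff continuous_on_diff p q; assumption)+
      also have "\<dots> \<le> C * B" using B[OF tp] C by (rule mult_left_mono)
      finally show ?thesis .
    qed
  qed (use t in auto)
qed

text \<open>The starting time s of the previous estimate is sent to 0. The positive part is
  1-Lipschitz, hence replacing both solutions at time s by their initial values costs at most a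
  bound of \<open>\<eta>\<close> times the two L^1(K) distances.\<close>

lemma (in test_function) kato_from_initial_time:
  fixes u1 u2 :: "'a \<Rightarrow> real \<Rightarrow> real"
  assumes u: "cauchy_solution m u01 u1" "cauchy_solution m u02 u2" and m: "m > 0" and t: "t > 0"
    and B: "\<And>t. t > 0 \<Longrightarrow>
      (\<integral>x. max (u1 x t powr m - u2 x t powr m) 0 * (\<Sum>b\<in>Basis. \<eta>2 b x) \<partial>lborel) \<le> B" "B \<ge> 0"
  shows "(\<integral>\<^sup>+x. ennreal (max (u1 x t - u2 x t) 0 * \<eta> x) \<partial>lborel)
    \<le> (\<integral>\<^sup>+x. ennreal (max (u01 x - u02 x) 0 * \<eta> x) \<partial>lebesgue) + ennreal (t * ((real DIM('a) - 1) / m * B))"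
    (is "?L \<le> ?A + ennreal ?c")
proof (rule ennreal_le_epsilon)
  fix e :: real assume e: "e > 0"
  have c: "?c \<ge> 0" using t m B by simp
  have "compact (\<eta> ` K)" using compact_support(1) cont(1)
    by (intro compact_continuous_image) (auto intro: continuous_on_subset)
  then obtain E where E: "E > 0" "\<And>x. x \<in> K \<Longrightarrow> \<eta> x \<le> E"
    using compact_imp_bounded[of "\<eta> ` K"] unfolding bounded_pos by force
  define i1 where "i1 = (\<lambda>t. LINT x:K|lebesgue. \<bar>u1 x t - u01 x\<bar>)"
  define i2 where "i2 = (\<lambda>t. LINT x:K|lebesgue. \<bar>u2 x t - u02 x\<bar>)"
  have "(i1 \<longlongrightarrow> 0) (at_right 0)" "(i2 \<longlongrightarrow> 0) (at_right 0)"
    using u compact_support unfolding cauchy_solution_def i1_def i2_def by auto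
  then have "((\<lambda>t. E * (i1 t + i2 t)) \<longlongrightarrow> E * (0 + 0)) (at_right 0)"
    by (intro tendsto_intros)
  then have "\<forall>\<^sub>F s in at_right 0. E * (i1 s + i2 s) < e"
    using e by (intro order_tendstoD) auto
  moreover have "\<forall>\<^sub>F s in at_right 0. s \<in> {0<..<t}"
    using t by (rule eventually_at_right_real)
  ultimately have "\<forall>\<^sub>F s in at_right 0. E * (i1 s + i2 s) < e \<and> s \<in> {0<..<t}" by (rule eventually_conj)
  then obtain s where s: "E * (i1 s + i2 s) < e" "0 < s" "s < t"
    using eventually_happens'[OF trivial_limit_at_right_real] by force
  have cw: "continuous_on punctured (\<lambda>x. max (u1 x r - u2 x r) 0)" if "r > 0" for r
    by (intro continuous_intros cauchy_solution_slice_continuous[OF u(1) that] cauchy_solution_slice_continuous[OF u(2) that])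
  have nn: "(\<integral>\<^sup>+x. ennreal (max (u1 x r - u2 x r) 0 * \<eta> x) \<partial>lborel)
     = ennreal (\<integral>x. max (u1 x r - u2 x r) 0 * \<eta> x \<partial>lborel)" if "r > 0" for r
    using nonneg by (intro nn_integral_eq_integral integrable_times cw that) auto
  have "(\<integral>x. max (u1 x t - u2 x t) 0 * \<eta> x \<partial>lborel)
     \<le> (\<integral>x. max (u1 x s - u2 x s) 0 * \<eta> x \<partial>lborel) + (t - s) * ((real DIM('a) - 1) / m * B)"
    using kato_between_times[OF u m s(2) less_imp_le[OF s(3)] B(1)] by simp
  also have "\<dots> \<le> (\<integral>x. max (u1 x s - u2 x s) 0 * \<eta> x \<partial>lborel) + ?c"
    using s(2) m B(2) by (intro add_left_mono mult_right_mono) auto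
  finally have "?L \<le> ennreal ((\<integral>x. max (u1 x s - u2 x s) 0 * \<eta> x \<partial>lborel) + ?c)"
    unfolding nn[OF t] by (rule ennreal_leI)
  also have "\<dots> = (\<integral>\<^sup>+x. ennreal (max (u1 x s - u2 x s) 0 * \<eta> x) \<partial>lborel) + ennreal ?c"
    unfolding nn[OF s(2)] using c nonneg by (intro ennreal_plus integral_nonneg_AE) auto
  \<comment> \<open>The initial values are measurable with respect to the completion, so the
    comparison with them takes place there.\<close>
  also have "(\<integral>\<^sup>+x. ennreal (max (u1 x s - u2 x s) 0 * \<eta> x) \<partial>lborel)
     = (\<integral>\<^sup>+x. ennreal (max (u1 x s - u2 x s) 0 * \<eta> x) \<partial>lebesgue)"
    by (rule nn_integral_completion[symmetric])
  also have "\<dots> \<le> (\<integral>\<^sup>+x. ennreal (max (u01 x - u02 x) 0 * \<eta> x)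
      + ennreal (E * (indicator K x * \<bar>u1 x s - u01 x\<bar> + indicator K x * \<bar>u2 x s - u02 x\<bar>)) \<partial>lebesgue)"
  proof (rule nn_integral_mono)
    fix x
    show "ennreal (max (u1 x s - u2 x s) 0 * \<eta> x) \<le> ennreal (max (u01 x - u02 x) 0 * \<eta> x)
      + ennreal (E * (indicator K x * \<bar>u1 x s - u01 x\<bar> + indicator K x * \<bar>u2 x s - u02 x\<bar>))"
    proof (cases "x \<in> K")
      case True
      let ?d = "\<bar>u1 x s - u01 x\<bar> + \<bar>u2 x s - u02 x\<bar>"
      have "max (u1 x s - u2 x s) 0 * \<eta> x \<le> (max (u01 x - u02 x) 0 + ?d) * \<eta> x"
        by (intro mult_right_mono nonneg) linarith
      also have "\<dots> \<le> max (u01 x - u02 x) 0 * \<eta> x + E * ?d"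
        using mult_right_mono[OF E(2)[OF True], of ?d] by (simp add: algebra_simps)
      finally show ?thesis
        using True E nonneg by (simp add: ennreal_leI flip: ennreal_plus)
    qed (simp add: outside)
  qed
  also have "\<dots> = ?A + (\<integral>\<^sup>+x. ennreal (E * (indicator K x * \<bar>u1 x s - u01 x\<bar> + indicator K x * \<bar>u2 x s - u02 x\<bar>)) \<partial>lebesgue)"
  proof (rule nn_integral_add)
    have "(\<lambda>x. indicator K x *\<^sub>R u01 x) \<in> borel_measurable lebesgue" "(\<lambda>x. indicator K x *\<^sub>R u02 x) \<in> borel_measurable lebesgue"
      using u compact_support unfolding cauchy_solution_def L1_loc_def set_integrable_def
      by (auto intro: borel_measurable_integrable)
    moreover have "\<eta> \<in> borel_measurable lebesgue"
      using borel_measurable_continuous_onI[OF cont(1)] by (intro measurable_completion) simp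
    ultimately have "(\<lambda>x. ennreal (max (indicator K x *\<^sub>R u01 x - indicator K x *\<^sub>R u02 x) 0 * \<eta> x)) \<in> borel_measurable lebesgue"
      by measurable
    also have "(\<lambda>x. ennreal (max (indicator K x *\<^sub>R u01 x - indicator K x *\<^sub>R u02 x) 0 * \<eta> x))
      = (\<lambda>x. ennreal (max (u01 x - u02 x) 0 * \<eta> x))"
      using outside(1) by (force simp: indicator_def fun_eq_iff)
    finally show "(\<lambda>x. ennreal (max (u01 x - u02 x) 0 * \<eta> x)) \<in> borel_measurable lebesgue" .
    show "(\<lambda>x. ennreal (E * (indicator K x * \<bar>u1 x s - u01 x\<bar> + indicator K x * \<bar>u2 x s - u02 x\<bar>))) \<in> borel_measurable lebesgue"
      using cauchy_solution_set_integrable[OF u(1) compact_support s(2)] cauchy_solution_set_integrable[OF u(2) compact_support s(2)]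
      by (intro measurable_compose[OF _ measurable_ennreal] borel_measurable_integrable integrable_mult_right Bochner_Integration.integrable_add)
  qed
  also have "(\<integral>\<^sup>+x. ennreal (E * (indicator K x * \<bar>u1 x s - u01 x\<bar> + indicator K x * \<bar>u2 x s - u02 x\<bar>)) \<partial>lebesgue)
     = ennreal (E * (i1 s + i2 s))"
  proof (subst nn_integral_eq_integral)
    note i = cauchy_solution_set_integrable[OF u(1) compact_support s(2)] cauchy_solution_set_integrable[OF u(2) compact_support s(2)]
    show "integrable lebesgue (\<lambda>x. E * (indicator K x * \<bar>u1 x s - u01 x\<bar> + indicator K x * \<bar>u2 x s - u02 x\<bar>))"
      by (intro integrable_mult_right Bochner_Integration.integrable_add i)
    show "ennreal (\<integral>x. E * (indicator K x * \<bar>u1 x s - u01 x\<bar> + indicator K x * \<bar>u2 x s - u02 x\<bar>) \<partial>lebesgue)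
      = ennreal (E * (i1 s + i2 s))"
      using i by (simp add: i1_def i2_def set_lebesgue_integral_def)
  qed (use E in auto)
  also have "\<dots> \<le> ennreal e" using s(1) by (intro ennreal_leI) simp
  finally show "?L \<le> ?A + ennreal ?c + ennreal e" by (simp add: add_ac)
qed

text \<open>Local integrability gives measurability on compact sets; compact annuli exhaust the
  punctured space, and the restriction is a pointwise limit.\<close>

lemma L1_loc_borel_measurable_punctured:
  fixes h :: "'a::euclidean_space \<Rightarrow> real"
  assumes h: "h \<in> L1_loc"
  shows "(\<lambda>x. indicator punctured x * h x) \<in> borel_measurable lebesgue"
proof (rule borel_measurable_LIMSEQ_real)
  let ?K = "\<lambda>k. cball (0::'a) (real k) - ball 0 (1 / real (Suc k))"
  have "compact (?K k)" "?K k \<subseteq> punctured" for k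
    by (auto intro!: compact_diff)
  then have "set_integrable lebesgue (?K k) h" for k using h unfolding L1_loc_def by blast
  then show "(\<lambda>x. indicator (?K k) x *\<^sub>R h x) \<in> borel_measurable lebesgue" for k
    unfolding set_integrable_def by (rule borel_measurable_integrable)
  show "(\<lambda>k. indicator (?K k) x *\<^sub>R h x) \<longlonglongrightarrow> indicator punctured x * h x" for x
  proof (cases "x = 0")
    case False
    have "(\<lambda>k. 1 / real (Suc k)) \<longlonglongrightarrow> 0"
      using LIMSEQ_inverse_real_of_nat by (simp add: inverse_eq_divide)
    then have "\<forall>\<^sub>F k in sequentially. 1 / real (Suc k) < norm x"
      using False by (intro order_tendstoD) auto
    moreover have "\<forall>\<^sub>F k in sequentially. norm x \<le> real k"
      using filterlim_real_sequentially unfolding filterlim_at_top by (rule spec)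
    ultimately have "\<forall>\<^sub>F k in sequentially. indicator (?K k) x *\<^sub>R h x = indicator punctured x * h x"
      by eventually_elim (use False in \<open>auto simp: indicator_def\<close>)
    then show ?thesis by (rule tendsto_eventually)
  qed simp
qed

text \<open>Dilation by \<lambda> exp (-\<beta>t) shifts -ln |x| by -ln \<lambda> + \<beta>t, and
  \<alpha> = c \<beta> makes the prefactor the c-th power of the same dilation factor. The power
  \<open>m\<close> turns c into a = c m.\<close>

lemma U_selfsim_powr:
  fixes x :: "'a::euclidean_space"
  assumes f: "\<And>r. r > 0 \<Longrightarrow> f r > 0" and m: "m < 1" and l: "l > 0" and x: "x \<noteq> 0"
    and \<alpha>: "\<alpha> = 2 * \<beta> / (1 - m)" and a: "a = 2 * m / (1 - m)"
    and V: "V = (\<lambda>S. exp (- a * S) * f (exp (- S)) powr m)"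
  shows "U_selfsim m \<alpha> \<beta> f l x t powr m = exp (a * - ln (norm x)) * V (- ln (norm x) + - ln l + \<beta> * t)"
proof -
  define S where "S = - ln (norm x) + - ln l + \<beta> * t"
  define c where "c = 2 / (1 - m)"
  have "norm (l *\<^sub>R exp (- \<beta> * t) *\<^sub>R x) = exp (- S)"
    using l x by (simp add: S_def exp_add exp_diff exp_minus divide_inverse algebra_simps)
  moreover have \<alpha>c: "\<alpha> = \<beta> * c" by (simp add: \<alpha> c_def)
  have "exp (- \<alpha> * t) * l powr c = exp (c * (- ln (norm x) - S))"
    using l by (simp add: \<alpha>c S_def powr_def algebra_simps flip: exp_add)
  ultimately have U: "U_selfsim m \<alpha> \<beta> f l x t = exp (c * (- ln (norm x) - S)) * f (exp (- S))"
    unfolding U_selfsim_def f_scaled_def c_def[symmetric] by (simp add: mult.assoc[symmetric])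
  have "m * c = a" by (simp add: a c_def)
  then have "m * (c * (- ln (norm x) - S)) = a * (- ln (norm x) - S)"
    by (metis mult.assoc)
  also have "\<dots> = a * - ln (norm x) + - a * S" by (simp add: algebra_simps)
  finally have e: "m * (c * (- ln (norm x) - S)) = a * - ln (norm x) + - a * S" .
  have "U_selfsim m \<alpha> \<beta> f l x t powr m = exp (m * (c * (- ln (norm x) - S))) * f (exp (- S)) powr m"
    using f[of "exp (- S)"] unfolding U by (simp add: powr_mult powr_def[of "exp _"])
  also have "\<dots> = exp (a * - ln (norm x)) * V S"
    unfolding e V exp_add by (simp only: mult.assoc)
  finally show ?thesis unfolding S_def .
qed

text \<open>An arbitrary \<open>e > 0\<close> pays for the cutoff. On the annulus \<open>A k\<close>
  a test function with L \<ge> k equals the full weight, so the estimate with error \<open>e\<close>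
  holds there; then \<open>k\<close> tends to infinity by monotone convergence.\<close>

lemma weighted_positive_part_contraction:
  fixes n :: nat and f :: "real \<Rightarrow> real"
    and u01 u02 :: "'a::euclidean_space \<Rightarrow> real" and u1 u2 :: "'a \<Rightarrow> real \<Rightarrow> real"
  assumes n: "n = DIM('a)" "n \<ge> 3" and m: "0 < m" "m < (real n - 2) / real n"
    and lam: "lam1 > lam2" "lam2 > 0" and \<beta>: "\<beta> < 0" and \<alpha>: "\<alpha> = 2 * \<beta> / (1 - m)"
    and prof: "is_profile n m \<alpha> \<beta> f"
    and u: "cauchy_solution m u01 u1" "cauchy_solution m u02 u2"
    and U1: "\<And>x t. x \<noteq> 0 \<Longrightarrow> t > 0 \<Longrightarrow> u1 x t \<le> U_selfsim m \<alpha> \<beta> f lam2 x t"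
    and U2: "\<And>x t. x \<noteq> 0 \<Longrightarrow> t > 0 \<Longrightarrow> U_selfsim m \<alpha> \<beta> f lam1 x t \<le> u2 x t"
    and \<mu>: "0 < \<mu>" "\<mu> \<le> real n - 2 / (1 - m)" "\<mu> = real n - 2 / (1 - m) \<Longrightarrow> m < 1 / 2"
    and t: "t > 0"
  shows "(\<integral>\<^sup>+x\<in>punctured. ennreal (max (u1 x t - u2 x t) 0 * norm x powr - \<mu>) \<partial>lebesgue)
    \<le> (\<integral>\<^sup>+x\<in>punctured. ennreal (max (u01 x - u02 x) 0 * norm x powr - \<mu>) \<partial>lebesgue)"
    (is "?L \<le> ?R")
proof (rule ennreal_le_epsilon)
  fix e :: real assume e: "e > 0"
  have "(real n - 2) / real n < 1" using n by simp
  then have m1: "m < 1" using m(2) by linarith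
  define a where "a = 2 * m / (1 - m)"
  define V where "V = (\<lambda>S. exp (- a * S) * f (exp (- S)) powr m)"
  \<comment> \<open>This is n - 2/(1-m) - \<mu>, written with the decay rate of \<open>V\<close>.
    The bound \<delta> < n - 2 - a expresses \<mu> > 0, and \<delta> = 0 is the borderline
    case.\<close>
  define \<delta> where "\<delta> = real n - 2 - a - \<mu>"
  have a2: "2 / (1 - m) = a + 2" unfolding a_def using m1 by (simp add: field_simps)
  have a0: "a > 0" using m m1 by (simp add: a_def)
  have \<delta>: "\<delta> \<ge> 0" "\<delta> < real n - 2 - a" "\<delta> = 0 \<Longrightarrow> m < 1 / 2"
    using \<mu> by (auto simp: \<delta>_def a2)
  have \<mu>n: "\<mu> \<le> real DIM('a) - 2" using \<mu>(2) a0 n(1) by (simp add: a2)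
  note Vp = profile_rescaled_properties[OF prof m n(2) \<alpha> \<beta> a_def V_def]
  have fpos: "f r > 0" if "r > 0" for r using prof that unfolding is_profile_def by blast
  define c1 where "c1 = - ln lam1"
  define c2 where "c2 = - ln lam2"
  have c: "c1 \<le> c2" using lam by (simp add: c1_def c2_def)
  have Upow1: "U_selfsim m \<alpha> \<beta> f lam1 x t powr m = exp (a * - ln (norm x)) * V (- ln (norm x) + c1 + \<beta> * t)"
    and Upow2: "U_selfsim m \<alpha> \<beta> f lam2 x t powr m = exp (a * - ln (norm x)) * V (- ln (norm x) + c2 + \<beta> * t)"
    if "x \<noteq> 0" for x :: 'a and t
    unfolding c1_def c2_def
    by (rule U_selfsim_powr[OF fpos m1 _ that \<alpha> a_def V_def]; use lam in simp)+
  have Upos: "U_selfsim m \<alpha> \<beta> f lam1 x t > 0" if "x \<noteq> 0" for x :: 'a and t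
    unfolding U_selfsim_def f_scaled_def using lam that by (intro mult_pos_pos fpos) auto
  have D: "max (u1 x t powr m - u2 x t powr m) 0
     \<le> exp (a * - ln (norm x)) * (V (- ln (norm x) + c2 + \<beta> * t) - V (- ln (norm x) + c1 + \<beta> * t))"
    if "x \<noteq> 0" "t > 0" for x t
  proof -
    have "u1 x t > 0" using u(1) that by (simp add: cauchy_solution_def)
    then have "u1 x t powr m \<le> exp (a * - ln (norm x)) * V (- ln (norm x) + c2 + \<beta> * t)"
      unfolding Upow2[OF that(1), symmetric] using U1[OF that] m by (intro powr_mono2) auto
    moreover have "exp (a * - ln (norm x)) * V (- ln (norm x) + c1 + \<beta> * t) \<le> u2 x t powr m"
      unfolding Upow1[OF that(1), symmetric] using U2[OF that] m Upos[OF that(1), of t]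
      by (intro powr_mono2) auto
    \<comment> \<open>This inequality covers the case in which the maximum is 0.\<close>
    moreover have "exp (a * - ln (norm x)) * V (- ln (norm x) + c1 + \<beta> * t)
        \<le> exp (a * - ln (norm x)) * V (- ln (norm x) + c2 + \<beta> * t)"
      using c by (intro mult_left_mono monoD[OF Vp(2)]) auto
    ultimately show ?thesis unfolding right_diff_distrib by linarith
  qed
  obtain M where M: "M > 0"
    and test: "\<And>L::nat. L > 0 \<Longrightarrow> \<exists>K (\<eta> :: 'a \<Rightarrow> real) \<eta>1 \<eta>2. test_function K \<eta> \<eta>1 \<eta>2 \<and>
      (\<forall>x. x \<noteq> 0 \<longrightarrow> \<eta> x \<le> norm x powr - \<mu>) \<and>
      (\<forall>x. x \<noteq> 0 \<longrightarrow> \<bar>ln (norm x)\<bar> \<le> real L \<longrightarrow> \<eta> x = norm x powr - \<mu>) \<and>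
      (\<forall>b\<in>Basis. \<eta>2 b 0 = 0) \<and>
      (\<forall>x. x \<noteq> 0 \<longrightarrow> (\<Sum>b\<in>Basis. \<eta>2 b x) \<le> norm x powr (- \<mu> - 2) * (M / real L)
          * indicator {S. real L \<le> \<bar>S\<bar> \<and> \<bar>S\<bar> \<le> 2 * real L} (- ln (norm x)))"
    by (rule radial_cutoff_test_functions[OF \<mu>(1) \<mu>n]) blast
  define C where "C = t * ((real DIM('a) - 1) / m)"
  have C: "C > 0" unfolding C_def using t n m by simp
  \<comment> \<open>The cutoff error will total C M \<epsilon>, which this choice makes equal to
    \<open>e\<close>.\<close>
  define \<epsilon> where "\<epsilon> = e / (C * M)"
  have \<epsilon>: "\<epsilon> > 0" using e C M by (simp add: \<epsilon>_def)
  have "\<forall>\<^sub>F L :: nat in sequentially. \<forall>\<tau>\<le>0.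
    (\<integral>\<^sup>+S. indicator {S. real L \<le> \<bar>S\<bar> \<and> \<bar>S\<bar> \<le> 2 * real L} S
        * ennreal (exp (- \<delta> * S) * (V (S + c2 + \<tau>) - V (S + c1 + \<tau>))) \<partial>log_radial_measure TYPE('a))
      \<le> ennreal (real L * \<epsilon>)"
  proof (rule cutoff_error_negligible[OF Vp(1) Vp(2) c _ _ _ \<epsilon>])
    show "((\<lambda>S. V (S + c2) / S) \<longlongrightarrow> 0) at_top" if "\<delta> = 0" by (rule Vp(3)[OF \<delta>(3)[OF that]])
    show "((\<lambda>S. exp (- \<delta> * S) * V (S + c2)) \<longlongrightarrow> 0) at_top" if "\<delta> \<noteq> 0"
      using that \<delta>(1) by (intro Vp(4)) simp
    show "((\<lambda>S. exp (- \<delta> * S) * V (S + c2)) \<longlongrightarrow> 0) at_bot" by (rule Vp(5)[OF \<delta>(2)])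
  qed
  then obtain L0 :: nat where L0: "\<And>L \<tau>. L \<ge> L0 \<Longrightarrow> \<tau> \<le> 0 \<Longrightarrow>
    (\<integral>\<^sup>+S. indicator {S. real L \<le> \<bar>S\<bar> \<and> \<bar>S\<bar> \<le> 2 * real L} S
        * ennreal (exp (- \<delta> * S) * (V (S + c2 + \<tau>) - V (S + c1 + \<tau>))) \<partial>log_radial_measure TYPE('a))
      \<le> ennreal (real L * \<epsilon>)"
    unfolding eventually_sequentially by blast
  have [measurable]: "V \<in> borel_measurable borel" using Vp(2) by (rule borel_measurable_mono)
  define A where "A = (\<lambda>L::nat. {x::'a. x \<noteq> 0 \<and> \<bar>ln (norm x)\<bar> \<le> real L})"
  have [measurable]: "A L \<in> sets borel" for L
    unfolding A_def by measurable
  define g where "g = (\<lambda>x. ennreal (max (u1 x t - u2 x t) 0 * norm x powr - \<mu>))"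
  have step: "(\<integral>\<^sup>+x. g x * indicator (A k) x \<partial>lborel) \<le> ?R + ennreal e" for k
  proof -
    \<comment> \<open>\<open>L\<close> lies beyond the threshold \<open>L0\<close>, makes the test
      function equal to the weight on \<open>A k\<close>, and is positive.\<close>
    define L where "L = max (max L0 k) 1"
    have L: "L \<ge> L0" "L \<ge> k" "L > 0" by (auto simp: L_def)
    let ?I = "{S. real L \<le> \<bar>S\<bar> \<and> \<bar>S\<bar> \<le> 2 * real L}"
    obtain K and \<eta> :: "'a \<Rightarrow> real" and \<eta>1 \<eta>2 where tf: "test_function K \<eta> \<eta>1 \<eta>2"
      and \<eta>le: "\<And>x. x \<noteq> 0 \<Longrightarrow> \<eta> x \<le> norm x powr - \<mu>"
      and \<eta>eq: "\<And>x. x \<noteq> 0 \<Longrightarrow> \<bar>ln (norm x)\<bar> \<le> real L \<Longrightarrow> \<eta> x = norm x powr - \<mu>"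
      and \<eta>20: "\<And>b. b \<in> Basis \<Longrightarrow> \<eta>2 b 0 = 0"
      and lap: "\<And>x. x \<noteq> 0 \<Longrightarrow> (\<Sum>b\<in>Basis. \<eta>2 b x) \<le> norm x powr (- \<mu> - 2) * (M / real L) * indicator ?I (- ln (norm x))"
      using test[OF L(3)] by blast
    interpret test_function K \<eta> \<eta>1 \<eta>2 by (rule tf)
    have err: "(\<integral>x. max (u1 x s powr m - u2 x s powr m) 0 * (\<Sum>b\<in>Basis. \<eta>2 b x) \<partial>lborel) \<le> M * \<epsilon>"
      if s: "s > 0" for s
    \<comment> \<open>Passing to the nonnegative integral discards the points with negative
      Laplacian, about which the one-sided bound says nothing.\<close>
    proof (rule integral_real_bounded)
      show "0 \<le> M * \<epsilon>" using M \<epsilon> by simp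
      define \<psi> where "\<psi> = (\<lambda>S. ennreal (M / real L) * (indicator ?I S
         * ennreal (exp (- \<delta> * S) * (V (S + c2 + \<beta> * s) - V (S + c1 + \<beta> * s)))))"
      have [measurable]: "\<psi> \<in> borel_measurable borel" unfolding \<psi>_def by measurable
      have "(\<integral>\<^sup>+x. ennreal (max (u1 x s powr m - u2 x s powr m) 0 * (\<Sum>b\<in>Basis. \<eta>2 b x)) \<partial>lborel)
        \<le> (\<integral>\<^sup>+(x::'a). ennreal (norm x powr - real DIM('a)) * \<psi> (- ln (norm x)) \<partial>lborel)"
      proof (rule nn_integral_mono)
        fix x :: 'a
        show "ennreal (max (u1 x s powr m - u2 x s powr m) 0 * (\<Sum>b\<in>Basis. \<eta>2 b x))
          \<le> ennreal (norm x powr - real DIM('a)) * \<psi> (- ln (norm x))"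
        proof (cases "x = 0")
          case False
          define S where "S = - ln (norm x)"
          define W where "W = V (S + c2 + \<beta> * s) - V (S + c1 + \<beta> * s)"
          have W: "W \<ge> 0" unfolding W_def using c by (simp add: monoD[OF Vp(2)])
          have "max (u1 x s powr m - u2 x s powr m) 0 * (\<Sum>b\<in>Basis. \<eta>2 b x)
            \<le> max (u1 x s powr m - u2 x s powr m) 0 * (norm x powr (- \<mu> - 2) * (M / real L) * indicator ?I S)"
            unfolding S_def by (intro mult_left_mono lap False) simp
          also have "\<dots> \<le> (exp (a * S) * W) * (norm x powr (- \<mu> - 2) * (M / real L) * indicator ?I S)"
            using D[OF False s] M unfolding S_def W_def by (intro mult_right_mono) auto
          also have "\<dots> = (exp (a * S) * norm x powr (- \<mu> - 2)) * ((M / real L) * (indicator ?I S * W))"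
            by (simp only: mult_ac)
          \<comment> \<open>The exponents match through n = a + \<mu> + 2 + \<delta>.\<close>
          also have "exp (a * S) * norm x powr (- \<mu> - 2) = norm x powr - real DIM('a) * exp (- \<delta> * S)"
            using False n(1) by (simp add: powr_def S_def \<delta>_def algebra_simps flip: exp_add)
          also have "norm x powr - real DIM('a) * exp (- \<delta> * S) * ((M / real L) * (indicator ?I S * W))
             = norm x powr - real DIM('a) * ((M / real L) * (indicator ?I S * (exp (- \<delta> * S) * W)))"
            by (simp only: mult_ac)
          finally have "ennreal (max (u1 x s powr m - u2 x s powr m) 0 * (\<Sum>b\<in>Basis. \<eta>2 b x))
            \<le> ennreal (norm x powr - real DIM('a) * ((M / real L) * (indicator ?I S * (exp (- \<delta> * S) * W))))"
            by (rule ennreal_leI)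
          also have "\<dots> = ennreal (norm x powr - real DIM('a)) * \<psi> S"
          proof (cases "S \<in> ?I")
            case True
            then have i: "indicator ?I S = (1 :: real)" "indicator ?I S = (1 :: ennreal)"
              by (simp_all only: indicator_simps)
            have E: "ennreal (p * (q * z)) = ennreal p * (ennreal q * ennreal z)" if "p \<ge> 0" "q \<ge> 0" for p q z :: real
              using that by (simp add: ennreal_mult')
            show ?thesis unfolding \<psi>_def W_def[symmetric] i mult_1_left by (rule E) (use M in auto)
          qed (simp add: \<psi>_def)
          finally show ?thesis by (simp add: S_def)
        qed (simp add: \<eta>20)
      qed
      also have "\<dots> = (\<integral>\<^sup>+S. \<psi> S \<partial>log_radial_measure TYPE('a))"
        by (rule nn_integral_log_radial_measure[symmetric]) measurable
      also have "\<dots> = ennreal (M / real L) * (\<integral>\<^sup>+S. indicator ?I S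
         * ennreal (exp (- \<delta> * S) * (V (S + c2 + \<beta> * s) - V (S + c1 + \<beta> * s))) \<partial>log_radial_measure TYPE('a))"
        unfolding \<psi>_def by (rule nn_integral_cmult) measurable
      \<comment> \<open>Here \<tau> = \<beta> s, which is at most 0 because \<beta> < 0.\<close>
      also have "\<dots> \<le> ennreal (M / real L) * ennreal (real L * \<epsilon>)"
        using \<beta> s by (intro mult_left_mono L0 L) (auto simp: mult_nonpos_nonneg)
      also have "\<dots> = ennreal (M * \<epsilon>)"
        using L(3) M by (simp flip: ennreal_mult')
      finally show "(\<integral>\<^sup>+x. ennreal (max (u1 x s powr m - u2 x s powr m) 0 * (\<Sum>b\<in>Basis. \<eta>2 b x)) \<partial>lborel) \<le> ennreal (M * \<epsilon>)" .
    qed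
    have "(\<integral>\<^sup>+x. g x * indicator (A k) x \<partial>lborel) \<le> (\<integral>\<^sup>+x. ennreal (max (u1 x t - u2 x t) 0 * \<eta> x) \<partial>lborel)"
    proof (rule nn_integral_mono)
      fix x
      show "g x * indicator (A k) x \<le> ennreal (max (u1 x t - u2 x t) 0 * \<eta> x)"
        using \<eta>eq[of x] L(2) by (auto simp: g_def A_def indicator_def)
    qed
    also have "\<dots> \<le> (\<integral>\<^sup>+x. ennreal (max (u01 x - u02 x) 0 * \<eta> x) \<partial>lebesgue)
        + ennreal (t * ((real DIM('a) - 1) / m * (M * \<epsilon>)))"
      by (rule kato_from_initial_time[OF u m(1) t err]) (use M \<epsilon> in auto)
    also have "t * ((real DIM('a) - 1) / m * (M * \<epsilon>)) = e"
    proof -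
      have "t * ((real DIM('a) - 1) / m * (M * \<epsilon>)) = C * M * \<epsilon>" by (simp add: C_def)
      then show ?thesis using C M by (simp add: \<epsilon>_def)
    qed
    also have "(\<integral>\<^sup>+x. ennreal (max (u01 x - u02 x) 0 * \<eta> x) \<partial>lebesgue) \<le> ?R"
    proof (rule nn_integral_mono)
      fix x :: 'a
      show "ennreal (max (u01 x - u02 x) 0 * \<eta> x)
        \<le> ennreal (max (u01 x - u02 x) 0 * norm x powr - \<mu>) * indicator punctured x"
      proof (cases "x = 0")
        case False
        then show ?thesis using \<eta>le[OF False] by (auto intro!: ennreal_leI mult_left_mono)
      qed (simp add: zero_outside)
    qed
    finally show ?thesis by (simp add: add_right_mono)
  qed
  have gm: "(\<lambda>x. g x * indicator (A k) x) \<in> borel_measurable lborel" for k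
  proof -
    have "continuous_on punctured (\<lambda>x. u1 x t - u2 x t)"
      by (intro continuous_intros cauchy_solution_slice_continuous[OF u(1) t] cauchy_solution_slice_continuous[OF u(2) t])
    then have [measurable]: "(\<lambda>x. indicator punctured x *\<^sub>R (u1 x t - u2 x t)) \<in> borel_measurable borel"
      by (intro borel_measurable_continuous_on_indicator) auto
    have "(\<lambda>x. ennreal (max (indicator punctured x *\<^sub>R (u1 x t - u2 x t)) 0 * norm x powr - \<mu>) * indicator (A k) x)
      \<in> borel_measurable lborel" by measurable
    also have "(\<lambda>x. ennreal (max (indicator punctured x *\<^sub>R (u1 x t - u2 x t)) 0 * norm x powr - \<mu>) * indicator (A k) x)
      = (\<lambda>x. g x * indicator (A k) x)"
      by (auto simp: g_def A_def indicator_def fun_eq_iff)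
    finally show ?thesis .
  qed
  have "?L = (\<integral>\<^sup>+x. g x * indicator punctured x \<partial>lborel)"
    unfolding g_def by (rule nn_integral_completion)
  also have "\<dots> = (\<integral>\<^sup>+x. (SUP k. g x * indicator (A k) x) \<partial>lborel)"
  proof (rule nn_integral_cong)
    fix x :: 'a
    show "g x * indicator punctured x = (SUP k. g x * indicator (A k) x)"
    proof (cases "x = 0")
      case False
      obtain k :: nat where "\<bar>ln (norm x)\<bar> \<le> real k" using real_arch_simple by blast
      then have "x \<in> A k" using False by (simp add: A_def)
      then have "(SUP k. g x * indicator (A k) x) = g x"
        by (intro antisym SUP_least SUP_upper2[of k]) (auto simp: indicator_def)
      then show ?thesis using False by simp
    qed (simp add: A_def)
  qed
  also have "\<dots> = (SUP k. \<integral>\<^sup>+x. g x * indicator (A k) x \<partial>lborel)"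
    by (rule nn_integral_monotone_convergence_SUP[OF _ gm])
       (auto simp: incseq_def le_fun_def A_def indicator_def)
  also have "\<dots> \<le> ?R + ennreal e" by (intro SUP_least step)
  finally show "?L \<le> ?R + ennreal e" .
qed

section \<open>From positive parts to absolute values\<close>

lemma nn_integral_abs_eq_pos_parts:
  fixes w k :: "'a \<Rightarrow> real"
  assumes w: "(\<lambda>x. indicator A x * w x) \<in> borel_measurable M" and k: "k \<in> borel_measurable M" "\<And>x. k x \<ge> 0"
  shows "(\<integral>\<^sup>+x\<in>A. ennreal (\<bar>w x\<bar> * k x) \<partial>M)
    = (\<integral>\<^sup>+x\<in>A. ennreal (max (w x) 0 * k x) \<partial>M) + (\<integral>\<^sup>+x\<in>A. ennreal (max (- w x) 0 * k x) \<partial>M)"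
proof -
  have 1: "ennreal (max (w x) 0 * k x) * indicator A x = ennreal (max (indicator A x * w x) 0 * k x)"
    and 2: "ennreal (max (- w x) 0 * k x) * indicator A x = ennreal (max (- (indicator A x * w x)) 0 * k x)"
    and 3: "ennreal (\<bar>w x\<bar> * k x) * indicator A x
      = ennreal (max (indicator A x * w x) 0 * k x) + ennreal (max (- (indicator A x * w x)) 0 * k x)" for x
    using k(2)[of x] by (auto simp: indicator_def max_def abs_if simp flip: ennreal_plus)
  show ?thesis unfolding 1 2 3 by (rule nn_integral_add) (use w k(1) in measurable)
qed

theorem theorem1p4:
  fixes n :: nat and m lam1 lam2 \<alpha> \<beta> \<mu> \<mu>\<^sub>1 :: real
    and f\<^sub>1 :: "real \<Rightarrow> real"
    and u01 u02 :: "'a::euclidean_space \<Rightarrow> real"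
    and u1 u2 :: "'a \<Rightarrow> real \<Rightarrow> real"
  assumes "n = DIM('a)" and "n \<ge> 3"
    and "0 < m" and "m < (real n - 2) / real n"
    and "lam1 > lam2" and "lam2 > 0"
    and "\<beta> < 0" and "\<alpha> = 2 * \<beta> / (1 - m)"
    and "\<mu>\<^sub>1 = real n - 2 / (1 - m)"
    and "is_profile n m \<alpha> \<beta> f\<^sub>1"
    and "AE x\<in>punctured in lebesgue. f_scaled m f\<^sub>1 lam1 x \<le> u01 x \<and> u01 x \<le> f_scaled m f\<^sub>1 lam2 x"
    and "AE x\<in>punctured in lebesgue. f_scaled m f\<^sub>1 lam1 x \<le> u02 x \<and> u02 x \<le> f_scaled m f\<^sub>1 lam2 x"
    and "cauchy_solution m u01 u1" and "cauchy_solution m u02 u2"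
    and "\<forall>x\<in>punctured. \<forall>t>0.
           U_selfsim m \<alpha> \<beta> f\<^sub>1 lam1 x t \<le> u1 x t \<and> u1 x t \<le> U_selfsim m \<alpha> \<beta> f\<^sub>1 lam2 x t"
    and "\<forall>x\<in>punctured. \<forall>t>0.
           U_selfsim m \<alpha> \<beta> f\<^sub>1 lam1 x t \<le> u2 x t \<and> u2 x t \<le> U_selfsim m \<alpha> \<beta> f\<^sub>1 lam2 x t"
    and "0 < \<mu>" and "\<mu> \<le> \<mu>\<^sub>1"
    and "(\<lambda>x. u01 x - u02 x) \<in> L1_weighted (\<lambda>x. norm x powr (- \<mu>))"
    and "\<mu> < \<mu>\<^sub>1 \<or> (\<mu> = \<mu>\<^sub>1 \<and> 0 < m \<and> m < min ((real n - 2) / real n) (1 / 2))"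
  shows "(\<forall>t>0.
            (\<integral>\<^sup>+ x\<in>punctured. ennreal (\<bar>u1 x t - u2 x t\<bar> * norm x powr (- \<mu>)) \<partial>lebesgue)
          \<le> (\<integral>\<^sup>+ x\<in>punctured. ennreal (\<bar>u01 x - u02 x\<bar> * norm x powr (- \<mu>)) \<partial>lebesgue)) \<and>
         (\<forall>t>0.
            (\<integral>\<^sup>+ x\<in>punctured. ennreal (max (u1 x t - u2 x t) 0 * norm x powr (- \<mu>)) \<partial>lebesgue)
          \<le> (\<integral>\<^sup>+ x\<in>punctured. ennreal (max (u01 x - u02 x) 0 * norm x powr (- \<mu>)) \<partial>lebesgue))"
proof -
  have pos: "(\<integral>\<^sup>+ x\<in>punctured. ennreal (max (v1 x t - v2 x t) 0 * norm x powr (- \<mu>)) \<partial>lebesgue)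
      \<le> (\<integral>\<^sup>+ x\<in>punctured. ennreal (max (v01 x - v02 x) 0 * norm x powr (- \<mu>)) \<partial>lebesgue)"
    if "t > 0" "cauchy_solution m v01 v1" "cauchy_solution m v02 v2"
      "\<And>x t. x \<noteq> 0 \<Longrightarrow> t > 0 \<Longrightarrow> v1 x t \<le> U_selfsim m \<alpha> \<beta> f\<^sub>1 lam2 x t"
      "\<And>x t. x \<noteq> 0 \<Longrightarrow> t > 0 \<Longrightarrow> U_selfsim m \<alpha> \<beta> f\<^sub>1 lam1 x t \<le> v2 x t"
    for t and v01 v02 :: "'a \<Rightarrow> real" and v1 v2
    by (rule weighted_positive_part_contraction[OF assms(1-8) assms(10) that(2-5) assms(17) _ _ that(1)])
       (use assms(9,18,20) in auto)
  have p12: "(\<integral>\<^sup>+ x\<in>punctured. ennreal (max (u1 x t - u2 x t) 0 * norm x powr (- \<mu>)) \<partial>lebesgue)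
      \<le> (\<integral>\<^sup>+ x\<in>punctured. ennreal (max (u01 x - u02 x) 0 * norm x powr (- \<mu>)) \<partial>lebesgue)"
    if "t > 0" for t
    by (rule pos[OF that assms(13,14)]) (use assms(15,16) in auto)
  \<comment> \<open>The negative part of a difference is the positive part of the exchanged
    one.\<close>
  have p21: "(\<integral>\<^sup>+ x\<in>punctured. ennreal (max (- (u1 x t - u2 x t)) 0 * norm x powr (- \<mu>)) \<partial>lebesgue)
      \<le> (\<integral>\<^sup>+ x\<in>punctured. ennreal (max (- (u01 x - u02 x)) 0 * norm x powr (- \<mu>)) \<partial>lebesgue)"
    if "t > 0" for t
    unfolding minus_diff_eq by (rule pos[OF that assms(14,13)]) (use assms(15,16) in auto)
  have km: "(\<lambda>x::'a. norm x powr (- \<mu>)) \<in> borel_measurable lebesgue"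
    by (intro measurable_completion) measurable
  have w0: "(\<lambda>x. indicator punctured x * (u01 x - u02 x)) \<in> borel_measurable lebesgue"
    using assms(19) by (intro L1_loc_borel_measurable_punctured) (simp add: L1_weighted_def)
  have wt: "(\<lambda>x. indicator punctured x * (u1 x t - u2 x t)) \<in> borel_measurable lebesgue" if "t > 0" for t
  proof -
    have "continuous_on punctured (\<lambda>x. u1 x t - u2 x t)"
      by (intro continuous_on_diff cauchy_solution_slice_continuous[OF assms(13) that]
          cauchy_solution_slice_continuous[OF assms(14) that])
    then have "(\<lambda>x. indicator punctured x *\<^sub>R (u1 x t - u2 x t)) \<in> borel_measurable borel"
      by (intro borel_measurable_continuous_on_indicator) auto
    then show ?thesis by (intro measurable_completion) simp
  qed
  show ?thesis
    unfolding nn_integral_abs_eq_pos_parts[OF w0 km powr_ge_zero]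
    using p12 p21 nn_integral_abs_eq_pos_parts[OF wt km powr_ge_zero]
    by (auto intro: add_mono)
qed

end
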